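(* Let $M$ be a locally compact, connected metric space with a $C^0$ flow $\theta$ and $K$ a nonvoid, compact, invariant, proper subset of $M$. Then exactly one of the following five alternatives (A)–(E) takes place. (A) Condition 1: $K$ is an attractor. (B) Condition 2: $K$ is a repeller. (C) At least one of the following four conditions holds: - 3: $K$ is isolated from minimals and stagnant. - 4: $K$ is isolated from minimals and there is a $K$-$\alpha$shell. - 5: $K$ is isolated from minimals and there is a $K$-$\omega$shell. - 6: $K$ is isolated from minimals and there is a $K$-tree. (D) At least one of the following eighteen conditions holds (here $1\le i\le 6$, and "condition $i.X$" is defined in the context): - 7.i: there is a sequence $\{e_n\}\in\mathrm{Eq}(M\setminus K)$, $d_H$-converging to some $\{q\}\in\mathrm{Eq}(\mathrm{bd}\,K)$, such that condition $i.X$ is satisfied by all equilibrium orbits $X=\{e_n\}$. - 8.i: there is a sequence $\gamma_n\in\mathrm{Per}(M\setminus K)$, $d_H$-converging to some $Q\in\mathfrak S(\mathrm{bd}\,K)$, such that condition $i.X$ is satisfied by all periodic orbits $X=\gamma_n$. - 9.i: there is a sequence $\Gamma_n\in\mathrm{Am}(M\setminus K)$, $d_H$-converging to some $Q\in\mathfrak S(\mathrm{bd}\,K)$, such that condition $i.X$ is satisfied by all compact aperiodic minimal sets $X=\Gamma_n$. (E) Condition 10: there is an open neighbourhood $U$ of $K$ such that $\mathrm{CMin}(U\setminus K)$ is $\mathfrak c$-dense in itself and at least one of the following four conditions holds: - 10.1: $\mathrm{Eq}(U\setminus K)$ is a $\mathfrak c$-dense in itself set, $d_H$-accumulating in $\mathrm{Eq}(\mathrm{bd}\,K)$.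 - 10.2: $\mathrm{Per}(U\setminus K)$ is a $\mathfrak c$-dense in itself set, $d_H$-accumulating in $\mathfrak S(\mathrm{bd}\,K)$. - 10.3: $\mathrm{Am}(U\setminus K)$ is a $\mathfrak c$-dense in itself set, $d_H$-accumulating in $\mathfrak S(\mathrm{bd}\,K)$. - 10.4: there are $\mathfrak c$-dense in itself sets $P\subset\mathrm{Per}(U\setminus K)$ and $A\subset\mathrm{Am}(U\setminus K)$, $d_H$-open in $\mathrm{Per}(M)$ and in $\mathrm{Am}(M)$, respectively, such that: both $P$ and $A$ $d_H$-accumulate in $\mathfrak S(\mathrm{bd}\,K)$; $K$ is bi-stable in relation to $P^*=\bigcup_{\gamma\in P}\gamma$ and in relation to $A^*=\bigcup_{\Gamma\in A}\Gamma$; and for any sequence $\gamma_n\in P$, $\mathrm{dist}(\gamma_n,K)\to 0$ implies $\mathrm{period}(\gamma_n)\to+\infty$.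
   Context: **Flow notions.** A $C^0$ flow is a continuous action $\theta:\mathbb R\times M\to M$ of $(\mathbb R,+)$. A set is invariant if it is a union of orbits $\mathcal O(x)=\{\theta(t,x):t\in\mathbb R\}$; $\mathcal O^{\pm}(x)$ are the half orbits ($t\ge0$, resp. $t\le 0$); $\mathcal O(V)$, $\mathcal O^{\pm}(V)$ are the unions of these over $x\in V$. $\omega(x),\alpha(x)$ are the usual limit sets (possibly empty); for an orbit $\gamma=\mathcal O(x)$, $\alpha(\gamma)=\alpha(x)$, $\omega(\gamma)=\omega(x)$. $\mathrm{cl},\mathrm{bd}$ are closure and boundary in $M$; $B(X,\epsilon)$ is the open $\epsilon$-neighbourhood of $X$; a neighbourhood of a set is a set whose interior contains it; $\mathrm{dist}(X,Y)=\inf\{d(x,y):x\in X,y\in Y\}$. A minimal set is a nonvoid, closed, invariant set containing no proper subset with these properties. An equilibrium orbit is $\{z\}$ with $\theta(t,z)=z$ for all $t$. A periodic orbit is an orbit $\mathcal O(x)$ with $\{t:\theta(t,x)=x\}=\lambda\mathbb Z$, $\lambda>0$; $\lambda$ is its period. An aperiodic minimal set is a minimal set that is neither an equilibrium orbit nor a periodic orbit. For $X\subset M$: $\mathrm{CMin}(X)$, $\mathrm{Eq}(X)$, $\mathrm{Per}(X)$, $\mathrm{Am}(X)$, $\mathrm{Orb}(X)$ are the sets of, respectively, compact minimal sets, equilibrium orbits, periodic orbits, compact aperiodic minimal sets, orbits contained in $X$; $\mathfrak S(X)$ is the set of nonvoid, compact, connected, invariant subsets of $X$. **Stability.** For a nonvoid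 compact invariant $X$: $B^{+}(X)=\{x:\emptyset\ne\omega(x)\subset X\}$, $B^{-}(X)=\{x:\emptyset\ne\alpha(x)\subset X\}$. $X$ is stable (negatively stable) if every neighbourhood $U$ of $X$ contains $\mathcal O^+(V)$ (resp. $\mathcal O^-(V)$) for some neighbourhood $V$ of $X$; an attractor if stable with $B^+(X)$ a neighbourhood of $X$; a repeller if negatively stable with $B^-(X)$ a neighbourhood of $X$; stagnant if there are $x,y\in M\setminus X$ with $\emptyset\ne\alpha(x)\subset X$ and $\emptyset\neq\omega(y)\subset X$; isolated from minimals if for some neighbourhood $U$ of $X$, $U\setminus X$ contains no minimal set; bi-stable in relation to $N\subset M$ if for every neighbourhood $U$ of $X$ there is a neighbourhood $V$ of $X$ with $\mathcal O(N\cap V)\subset U$. **Hausdorff metric.** $\mathrm C(M)$ is the set of nonvoid compact subsets of $M$ with the Hausdorff metric $d_H$; the prefix $d_H$- refers to it. $\mathfrak A\subset \mathrm C(M)$ $d_H$-accumulates in $\mathfrak B\subset \mathrm C(M)$ if $\mathrm{cl}_H\mathfrak A\cap\mathfrak B\neq\emptyset$. $\mathfrak C\subset \mathrm C(M)$ is $\mathfrak c$-dense in itself if for every $\Lambda\in\mathfrak C$ and $\epsilon>0$, $\#\{Y\in\mathfrak C:d_H(\Lambda,Y)<\epsilon\}\ge\mathfrak c$ ($\mathfrak c$ = cardinal of the continuum). **Orbital structures.** For nonvoid $X,Y\subset M$, $|Y|_X=\sup\{\mathrm{dist}(y,X):y\in Y\}$. For orbits $\gamma,\zeta$: $\gamma\overset{0}{\succ}\zeta$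 means $\zeta\subset\alpha(\gamma)$; $\gamma\overset{1}{\succ}\zeta$ means $\zeta\subset\omega(\gamma)$; $\gamma\succ\zeta$ means $\zeta\subset\alpha(\gamma)\cup\omega(\gamma)$. Let $X$ be a nonvoid compact invariant proper subset of $M$. - Let $\mathcal E$ be the set of nonempty finite sequences of 0's and 1's with first digit $0$, and $E_\infty$ the set of infinite such sequences; for $v=0c_1c_2\ldots\in E_\infty$ put $v_0=0$, $v_n=0c_1\ldots c_n$. An $X$-tree is a pair $(\Theta,\psi)$ where, for some compact neighbourhood $U$ of $X$, $\Theta\subset\mathrm{Orb}(U\setminus X)$ and $\psi:\mathcal E\to\Theta$, $a\mapsto\gamma_a$, is a surjection such that for each $b\in\mathcal E$ and $c\in\{0,1\}$, $\gamma_b\overset{c}{\succ}\gamma_{bc}$ and $\gamma_{bc}\not\succ\gamma_b$ ($bc$ is $b$ followed by the digit $c$), and for each $v\in E_\infty$, $|\mathrm{cl}\,\gamma_{v_n}|_X\to0$. - An $X$-$\omega$shell is a sequence of orbits $(\gamma_n)_{n\ge1}$ contained in $U\setminus X$ for some compact neighbourhood $U$ of $X$ such that, for all $n\ge1$, $\gamma_n\subset B^-(X)$, $\gamma_n\overset{1}{\succ}\gamma_{n+1}$ and $\gamma_{n+1}\not\succ\gamma_n$; and $|\mathrm{cl}\,\gamma_n|_X\to0$. - An $X$-$\alpha$shell is a sequence of orbits that is an $X$-$\omega$shell for the time-reversed flow $(t,x)\mapsto\theta(-t,x)$. **Conditions $i.X$** (for $X$ a nonvoid compact invariant set): 1.$X$: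 $X$ is an attractor. 2.$X$: $X$ is a repeller. 3.$X$: $X$ is isolated from minimals and stagnant. 4.$X$: $X$ is isolated from minimals and there is an $X$-$\alpha$shell. 5.$X$: $X$ is isolated from minimals and there is an $X$-$\omega$shell. 6.$X$: $X$ is isolated from minimals and there is an $X$-tree. *)

theory Defs
  imports "HOL-Analysis.Analysis"
begin

section \<open>Flows, orbits and limit sets\<close>

text \<open>The phase space \<open>M\<close> is the whole type \<open>'a\<close>; subsets of \<open>M\<close> are sets over \<open>'a\<close>, and orbits are
  treated as sets of points.\<close>

definition flow :: "(real \<Rightarrow> 'a::metric_space \<Rightarrow> 'a) \<Rightarrow> bool" where
  "flow \<theta> \<longleftrightarrow> continuous_on UNIV (\<lambda>(t, x). \<theta> t x) \<and> (\<forall>x. \<theta> 0 x = x)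
     \<and> (\<forall>s t x. \<theta> (s + t) x = \<theta> s (\<theta> t x))"

definition time_reversed :: "(real \<Rightarrow> 'a \<Rightarrow> 'a) \<Rightarrow> real \<Rightarrow> 'a \<Rightarrow> 'a" where
  "time_reversed \<theta> = (\<lambda>t x. \<theta> (- t) x)"

definition orbit :: "(real \<Rightarrow> 'a \<Rightarrow> 'a) \<Rightarrow> 'a \<Rightarrow> 'a set" where
  "orbit \<theta> x = {\<theta> t x | t. True}"

definition pos_orbit :: "(real \<Rightarrow> 'a \<Rightarrow> 'a) \<Rightarrow> 'a \<Rightarrow> 'a set" where
  "pos_orbit \<theta> x = {\<theta> t x | t. t \<ge> 0}"

definition neg_orbit :: "(real \<Rightarrow> 'a \<Rightarrow> 'a) \<Rightarrow> 'a \<Rightarrow> 'a set" where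
  "neg_orbit \<theta> x = {\<theta> t x | t. t \<le> 0}"

definition invariant :: "(real \<Rightarrow> 'a \<Rightarrow> 'a) \<Rightarrow> 'a set \<Rightarrow> bool" where
  "invariant \<theta> X \<longleftrightarrow> (\<exists>S. X = (\<Union>x\<in>S. orbit \<theta> x))"

definition omega_lim :: "(real \<Rightarrow> 'a::metric_space \<Rightarrow> 'a) \<Rightarrow> 'a \<Rightarrow> 'a set" where
  "omega_lim \<theta> x =
     {y. \<exists>t. filterlim t at_top sequentially \<and> (\<lambda>n. \<theta> (t n) x) \<longlonglongrightarrow> y}"

definition alpha_lim :: "(real \<Rightarrow> 'a::metric_space \<Rightarrow> 'a) \<Rightarrow> 'a \<Rightarrow> 'a set" where
  "alpha_lim \<theta> x =
     {y. \<exists>t. filterlim t at_bot sequentially \<and> (\<lambda>n. \<theta> (t n) x) \<longlonglongrightarrow> y}"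

text \<open>Limit sets of an orbit. All points of an orbit have the same limit sets, so the unions below
  are just the limit sets of any of its points; see the two lemmas that follow.\<close>

definition omega_orb :: "(real \<Rightarrow> 'a::metric_space \<Rightarrow> 'a) \<Rightarrow> 'a set \<Rightarrow> 'a set" where
  "omega_orb \<theta> \<gamma> = (\<Union>x\<in>\<gamma>. omega_lim \<theta> x)"

definition alpha_orb :: "(real \<Rightarrow> 'a::metric_space \<Rightarrow> 'a) \<Rightarrow> 'a set \<Rightarrow> 'a set" where
  "alpha_orb \<theta> \<gamma> = (\<Union>x\<in>\<gamma>. alpha_lim \<theta> x)"

lemma omega_orb_orbit:
  assumes "flow \<theta>"
  shows "omega_orb \<theta> (orbit \<theta> x) = omega_lim \<theta> x"
proof -
  have "y \<in> omega_lim \<theta> x" if y: "y \<in> omega_lim \<theta> (\<theta> s x)" for s y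
  proof -
    obtain t where t: "filterlim t at_top sequentially" "(\<lambda>n. \<theta> (t n) (\<theta> s x)) \<longlonglongrightarrow> y"
      using y unfolding omega_lim_def by blast
    have "filterlim (\<lambda>n. s + t n) at_top sequentially"
      by (rule filterlim_tendsto_add_at_top[OF tendsto_const t(1)])
    moreover have "(\<lambda>n. \<theta> (s + t n) x) \<longlonglongrightarrow> y"
      using t(2) assms by (simp add: flow_def add.commute[of s])
    ultimately show ?thesis unfolding omega_lim_def by blast
  qed
  moreover have "x \<in> orbit \<theta> x"
    using assms by (auto simp: orbit_def flow_def intro!: exI[of _ 0])
  ultimately show ?thesis by (fastforce simp: omega_orb_def orbit_def)
qed

lemma alpha_orb_orbit:
  assumes "flow \<theta>"
  shows "alpha_orb \<theta> (orbit \<theta> x) = alpha_lim \<theta> x"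
proof -
  have "y \<in> alpha_lim \<theta> x" if y: "y \<in> alpha_lim \<theta> (\<theta> s x)" for s y
  proof -
    obtain t where t: "filterlim t at_bot sequentially" "(\<lambda>n. \<theta> (t n) (\<theta> s x)) \<longlonglongrightarrow> y"
      using y unfolding alpha_lim_def by blast
    have "filterlim (\<lambda>n. - s + - t n) at_top sequentially"
      by (rule filterlim_tendsto_add_at_top[OF tendsto_const])
        (use t(1) in \<open>simp add: filterlim_uminus_at_bot\<close>)
    then have "filterlim (\<lambda>n. s + t n) at_bot sequentially"
      by (simp add: filterlim_uminus_at_bot)
    moreover have "(\<lambda>n. \<theta> (s + t n) x) \<longlonglongrightarrow> y"
      using t(2) assms by (simp add: flow_def add.commute[of s])
    ultimately show ?thesis unfolding alpha_lim_def by blast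
  qed
  moreover have "x \<in> orbit \<theta> x"
    using assms by (auto simp: orbit_def flow_def intro!: exI[of _ 0])
  ultimately show ?thesis by (fastforce simp: alpha_orb_def orbit_def)
qed

definition minimal_set :: "(real \<Rightarrow> 'a::metric_space \<Rightarrow> 'a) \<Rightarrow> 'a set \<Rightarrow> bool" where
  "minimal_set \<theta> N \<longleftrightarrow> N \<noteq> {} \<and> closed N \<and> invariant \<theta> N
     \<and> (\<forall>L. L \<subset> N \<longrightarrow> \<not> (L \<noteq> {} \<and> closed L \<and> invariant \<theta> L))"

definition has_period :: "(real \<Rightarrow> 'a \<Rightarrow> 'a) \<Rightarrow> 'a set \<Rightarrow> real \<Rightarrow> bool" where
  "has_period \<theta> \<gamma> p \<longleftrightarrow> p > 0
     \<and> (\<exists>x. \<gamma> = orbit \<theta> x \<and> {t. \<theta> t x = x} = range (\<lambda>k::int. p * of_int k))"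

definition period :: "(real \<Rightarrow> 'a \<Rightarrow> 'a) \<Rightarrow> 'a set \<Rightarrow> real" where
  "period \<theta> \<gamma> = (THE p. has_period \<theta> \<gamma> p)"

lemma has_period_unique:
  assumes "flow \<theta>" "has_period \<theta> \<gamma> a" "has_period \<theta> \<gamma> b"
  shows "a = b"
proof -
  obtain x y where a: "a > 0" "\<gamma> = orbit \<theta> x" "{t. \<theta> t x = x} = range (\<lambda>k::int. a * of_int k)"
    and b: "b > 0" "\<gamma> = orbit \<theta> y" "{t. \<theta> t y = y} = range (\<lambda>k::int. b * of_int k)"
    using assms(2,3) unfolding has_period_def by blast
  have add: "\<theta> (s + t) z = \<theta> s (\<theta> t z)" and zero: "\<theta> 0 z = z" for s t z
    using assms(1) by (auto simp: flow_def)
  have "y \<in> orbit \<theta> y"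
    by (auto simp: orbit_def zero intro!: exI[of _ 0])
  then obtain s where s: "y = \<theta> s x"
    using a(2) b(2) by (auto simp: orbit_def)
  have "\<theta> t x = x \<longleftrightarrow> \<theta> t y = y" for t
  proof
    assume "\<theta> t x = x" then show "\<theta> t y = y"
      by (metis s add add.commute)
  next
    assume "\<theta> t y = y"
    moreover have "x = \<theta> (- s) y"
      using add[of "- s" s x] by (simp add: s zero)
    ultimately show "\<theta> t x = x"
      by (metis add add.commute)
  qed
  then have eq: "range (\<lambda>k::int. a * of_int k) = range (\<lambda>k::int. b * of_int k)"
    using a(3) b(3) by simp
  have le: "c \<le> d" if "c > 0" "d > 0" "d \<in> range (\<lambda>k::int. c * of_int k)" for c d :: real
  proof -
    from that(3) obtain k :: int where k: "d = c * of_int k" by auto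
    then have "k \<ge> 1" using that(1,2) by (simp add: zero_less_mult_iff)
    then show ?thesis using that(1) k by simp
  qed
  have "a \<in> range (\<lambda>k::int. a * of_int k)" "b \<in> range (\<lambda>k::int. b * of_int k)"
    by (auto intro!: image_eqI[of _ _ 1])
  then show ?thesis
    using le[of a b] le[of b a] a(1) b(1) eq by auto
qed

definition Orb :: "(real \<Rightarrow> 'a \<Rightarrow> 'a) \<Rightarrow> 'a set \<Rightarrow> 'a set set" where
  "Orb \<theta> X = {orbit \<theta> x | x. orbit \<theta> x \<subseteq> X}"

definition CMin :: "(real \<Rightarrow> 'a::metric_space \<Rightarrow> 'a) \<Rightarrow> 'a set \<Rightarrow> 'a set set" where
  "CMin \<theta> X = {N. minimal_set \<theta> N \<and> compact N \<and> N \<subseteq> X}"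

definition Eq :: "(real \<Rightarrow> 'a \<Rightarrow> 'a) \<Rightarrow> 'a set \<Rightarrow> 'a set set" where
  "Eq \<theta> X = {{z} | z. z \<in> X \<and> (\<forall>t. \<theta> t z = z)}"

definition Per :: "(real \<Rightarrow> 'a \<Rightarrow> 'a) \<Rightarrow> 'a set \<Rightarrow> 'a set set" where
  "Per \<theta> X = {\<gamma>. (\<exists>p. has_period \<theta> \<gamma> p) \<and> \<gamma> \<subseteq> X}"

definition Am :: "(real \<Rightarrow> 'a::metric_space \<Rightarrow> 'a) \<Rightarrow> 'a set \<Rightarrow> 'a set set" where
  "Am \<theta> X = {N. minimal_set \<theta> N \<and> compact N \<and> N \<subseteq> X \<and> N \<notin> Eq \<theta> UNIV \<and> N \<notin> Per \<theta> UNIV}"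

text \<open>The set \<open>\<SS>(X)\<close> of nonvoid, compact, connected, invariant subsets of \<open>X\<close>.\<close>

definition CCI :: "(real \<Rightarrow> 'a::metric_space \<Rightarrow> 'a) \<Rightarrow> 'a set \<Rightarrow> 'a set set" where
  "CCI \<theta> X = {Q. Q \<noteq> {} \<and> compact Q \<and> connected Q \<and> invariant \<theta> Q \<and> Q \<subseteq> X}"


section \<open>Stability\<close>

definition nbhd :: "'a::metric_space set \<Rightarrow> 'a set \<Rightarrow> bool" where
  "nbhd U X \<longleftrightarrow> X \<subseteq> interior U"

definition pos_basin :: "(real \<Rightarrow> 'a::metric_space \<Rightarrow> 'a) \<Rightarrow> 'a set \<Rightarrow> 'a set" where
  "pos_basin \<theta> X = {x. omega_lim \<theta> x \<noteq> {} \<and> omega_lim \<theta> x \<subseteq> X}"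

definition neg_basin :: "(real \<Rightarrow> 'a::metric_space \<Rightarrow> 'a) \<Rightarrow> 'a set \<Rightarrow> 'a set" where
  "neg_basin \<theta> X = {x. alpha_lim \<theta> x \<noteq> {} \<and> alpha_lim \<theta> x \<subseteq> X}"

definition stable :: "(real \<Rightarrow> 'a::metric_space \<Rightarrow> 'a) \<Rightarrow> 'a set \<Rightarrow> bool" where
  "stable \<theta> X \<longleftrightarrow> (\<forall>U. nbhd U X \<longrightarrow> (\<exists>V. nbhd V X \<and> (\<Union>x\<in>V. pos_orbit \<theta> x) \<subseteq> U))"

definition neg_stable :: "(real \<Rightarrow> 'a::metric_space \<Rightarrow> 'a) \<Rightarrow> 'a set \<Rightarrow> bool" where
  "neg_stable \<theta> X \<longleftrightarrow> (\<forall>U. nbhd U X \<longrightarrow> (\<exists>V. nbhd V X \<and> (\<Union>x\<in>V. neg_orbit \<theta> x) \<subseteq> U))"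

definition attractor :: "(real \<Rightarrow> 'a::metric_space \<Rightarrow> 'a) \<Rightarrow> 'a set \<Rightarrow> bool" where
  "attractor \<theta> X \<longleftrightarrow> stable \<theta> X \<and> nbhd (pos_basin \<theta> X) X"

definition repeller :: "(real \<Rightarrow> 'a::metric_space \<Rightarrow> 'a) \<Rightarrow> 'a set \<Rightarrow> bool" where
  "repeller \<theta> X \<longleftrightarrow> neg_stable \<theta> X \<and> nbhd (neg_basin \<theta> X) X"

definition stagnant :: "(real \<Rightarrow> 'a::metric_space \<Rightarrow> 'a) \<Rightarrow> 'a set \<Rightarrow> bool" where
  "stagnant \<theta> X \<longleftrightarrow> (\<exists>x y. x \<notin> X \<and> y \<notin> X \<and> alpha_lim \<theta> x \<noteq> {} \<and> alpha_lim \<theta> x \<subseteq> X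
     \<and> omega_lim \<theta> y \<noteq> {} \<and> omega_lim \<theta> y \<subseteq> X)"

definition isolated_from_minimals :: "(real \<Rightarrow> 'a::metric_space \<Rightarrow> 'a) \<Rightarrow> 'a set \<Rightarrow> bool" where
  "isolated_from_minimals \<theta> X \<longleftrightarrow>
     (\<exists>U. nbhd U X \<and> \<not> (\<exists>N. minimal_set \<theta> N \<and> N \<subseteq> U - X))"

definition bi_stable_rel :: "(real \<Rightarrow> 'a::metric_space \<Rightarrow> 'a) \<Rightarrow> 'a set \<Rightarrow> 'a set \<Rightarrow> bool" where
  "bi_stable_rel \<theta> X N \<longleftrightarrow>
     (\<forall>U. nbhd U X \<longrightarrow> (\<exists>V. nbhd V X \<and> (\<Union>x\<in>N \<inter> V. orbit \<theta> x) \<subseteq> U))"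


section \<open>The Hausdorff metric\<close>

text \<open>\<open>excess Y X\<close> is \<open>|Y|\<^sub>X\<close>. It is a supremum of reals, hence only meaningful for bounded nonvoid
  \<open>Y\<close> and nonvoid \<open>X\<close>; it is only used for such sets.\<close>

definition excess :: "'a::metric_space set \<Rightarrow> 'a set \<Rightarrow> real" where
  "excess Y X = (SUP y\<in>Y. infdist y X)"

definition hdist :: "'a::metric_space set \<Rightarrow> 'a set \<Rightarrow> real" where
  "hdist X Y = max (excess X Y) (excess Y X)"

definition Cpt :: "'a::metric_space set set" where
  "Cpt = {X. X \<noteq> {} \<and> compact X}"

definition h_converges :: "(nat \<Rightarrow> 'a::metric_space set) \<Rightarrow> 'a set \<Rightarrow> bool" where
  "h_converges F Q \<longleftrightarrow> (\<lambda>n. hdist (F n) Q) \<longlonglongrightarrow> 0"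

definition h_closure :: "'a::metric_space set set \<Rightarrow> 'a set set" where
  "h_closure \<AA> = {Y \<in> Cpt. \<forall>\<epsilon>>0. \<exists>Z\<in>\<AA>. hdist Y Z < \<epsilon>}"

definition h_accumulates :: "'a::metric_space set set \<Rightarrow> 'a set set \<Rightarrow> bool" where
  "h_accumulates \<AA> \<BB> \<longleftrightarrow> h_closure \<AA> \<inter> \<BB> \<noteq> {}"

definition h_open_in :: "'a::metric_space set set \<Rightarrow> 'a set set \<Rightarrow> bool" where
  "h_open_in \<AA> \<BB> \<longleftrightarrow> \<AA> \<subseteq> \<BB> \<and> (\<forall>Y\<in>\<AA>. \<exists>\<epsilon>>0. \<forall>Z\<in>\<BB>. hdist Y Z < \<epsilon> \<longrightarrow> Z \<in> \<AA>)"

definition c_dense_in_itself :: "'a::metric_space set set \<Rightarrow> bool" where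
  "c_dense_in_itself \<CC> \<longleftrightarrow>
     (\<forall>\<Lambda>\<in>\<CC>. \<forall>\<epsilon>>0. (UNIV :: real set) \<lesssim> {Y \<in> \<CC>. hdist \<Lambda> Y < \<epsilon>})"


section \<open>Orbital structures\<close>

text \<open>The relations between orbits: \<open>succ_by \<theta> False\<close> is \<open>\<succ>\<close> with superscript \<open>0\<close> (via \<open>\<alpha>\<close>),
  \<open>succ_by \<theta> True\<close> is \<open>\<succ>\<close> with superscript \<open>1\<close> (via \<open>\<omega>\<close>). Throughout, the digits \<open>0\<close> and \<open>1\<close> are
  encoded as \<open>False\<close> and \<open>True\<close>.\<close>

definition succ_by ::
    "(real \<Rightarrow> 'a::metric_space \<Rightarrow> 'a) \<Rightarrow> bool \<Rightarrow> 'a set \<Rightarrow> 'a set \<Rightarrow> bool" where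
  "succ_by \<theta> c \<gamma> \<zeta> \<longleftrightarrow> \<zeta> \<subseteq> (if c then omega_orb \<theta> \<gamma> else alpha_orb \<theta> \<gamma>)"

definition succ :: "(real \<Rightarrow> 'a::metric_space \<Rightarrow> 'a) \<Rightarrow> 'a set \<Rightarrow> 'a set \<Rightarrow> bool" where
  "succ \<theta> \<gamma> \<zeta> \<longleftrightarrow> \<zeta> \<subseteq> alpha_orb \<theta> \<gamma> \<union> omega_orb \<theta> \<gamma>"

definition words :: "bool list set" where
  "words = {w. w \<noteq> [] \<and> hd w = False}"

text \<open>An infinite sequence \<open>v\<close> of digits has first digit \<open>v 0\<close>, and \<open>v\<^sub>n\<close> is the word formed by its
  first \<open>n + 1\<close> digits.\<close>

definition is_tree :: "(real \<Rightarrow> 'a::metric_space \<Rightarrow> 'a) \<Rightarrow> 'a set \<Rightarrow> 'a set set \<Rightarrow>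
    (bool list \<Rightarrow> 'a set) \<Rightarrow> bool" where
  "is_tree \<theta> X \<Theta> \<psi> \<longleftrightarrow>
     (\<exists>U. compact U \<and> nbhd U X \<and> \<Theta> \<subseteq> Orb \<theta> (U - X)) \<and>
     \<psi> ` words = \<Theta> \<and>
     (\<forall>b\<in>words. \<forall>c. succ_by \<theta> c (\<psi> b) (\<psi> (b @ [c])) \<and> \<not> succ \<theta> (\<psi> (b @ [c])) (\<psi> b)) \<and>
     (\<forall>v :: nat \<Rightarrow> bool. v 0 = False \<longrightarrow>
        (\<lambda>n. excess (closure (\<psi> (map v [0..<Suc n]))) X) \<longlonglongrightarrow> 0)"

text \<open>Shells are indexed from \<open>0\<close> instead of \<open>1\<close>.\<close>

definition is_omega_shell ::
    "(real \<Rightarrow> 'a::metric_space \<Rightarrow> 'a) \<Rightarrow> 'a set \<Rightarrow> (nat \<Rightarrow> 'a set) \<Rightarrow> bool" where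
  "is_omega_shell \<theta> X \<gamma> \<longleftrightarrow>
     (\<exists>U. compact U \<and> nbhd U X \<and> (\<forall>n. \<gamma> n \<in> Orb \<theta> (U - X))) \<and>
     (\<forall>n. \<gamma> n \<subseteq> neg_basin \<theta> X \<and> succ_by \<theta> True (\<gamma> n) (\<gamma> (Suc n))
        \<and> \<not> succ \<theta> (\<gamma> (Suc n)) (\<gamma> n)) \<and>
     (\<lambda>n. excess (closure (\<gamma> n)) X) \<longlonglongrightarrow> 0"

definition is_alpha_shell ::
    "(real \<Rightarrow> 'a::metric_space \<Rightarrow> 'a) \<Rightarrow> 'a set \<Rightarrow> (nat \<Rightarrow> 'a set) \<Rightarrow> bool" where
  "is_alpha_shell \<theta> X \<gamma> \<longleftrightarrow> is_omega_shell (time_reversed \<theta>) X \<gamma>"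


section \<open>The alternatives\<close>

definition condition :: "(real \<Rightarrow> 'a::metric_space \<Rightarrow> 'a) \<Rightarrow> nat \<Rightarrow> 'a set \<Rightarrow> bool" where
  "condition \<theta> i X \<longleftrightarrow>
     (i = 1 \<and> attractor \<theta> X) \<or>
     (i = 2 \<and> repeller \<theta> X) \<or>
     (i = 3 \<and> isolated_from_minimals \<theta> X \<and> stagnant \<theta> X) \<or>
     (i = 4 \<and> isolated_from_minimals \<theta> X \<and> (\<exists>\<gamma>. is_alpha_shell \<theta> X \<gamma>)) \<or>
     (i = 5 \<and> isolated_from_minimals \<theta> X \<and> (\<exists>\<gamma>. is_omega_shell \<theta> X \<gamma>)) \<or>
     (i = 6 \<and> isolated_from_minimals \<theta> X \<and> (\<exists>\<Theta> \<psi>. is_tree \<theta> X \<Theta> \<psi>))"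

definition condition7 :: "(real \<Rightarrow> 'a::metric_space \<Rightarrow> 'a) \<Rightarrow> nat \<Rightarrow> 'a set \<Rightarrow> bool" where
  "condition7 \<theta> i K \<longleftrightarrow> (\<exists>e q. (\<forall>n::nat. {e n} \<in> Eq \<theta> (- K)) \<and> {q} \<in> Eq \<theta> (frontier K)
     \<and> h_converges (\<lambda>n. {e n}) {q} \<and> (\<forall>n. condition \<theta> i {e n}))"

definition condition8 :: "(real \<Rightarrow> 'a::metric_space \<Rightarrow> 'a) \<Rightarrow> nat \<Rightarrow> 'a set \<Rightarrow> bool" where
  "condition8 \<theta> i K \<longleftrightarrow> (\<exists>\<gamma> Q. (\<forall>n::nat. \<gamma> n \<in> Per \<theta> (- K)) \<and> Q \<in> CCI \<theta> (frontier K)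
     \<and> h_converges \<gamma> Q \<and> (\<forall>n. condition \<theta> i (\<gamma> n)))"

definition condition9 :: "(real \<Rightarrow> 'a::metric_space \<Rightarrow> 'a) \<Rightarrow> nat \<Rightarrow> 'a set \<Rightarrow> bool" where
  "condition9 \<theta> i K \<longleftrightarrow> (\<exists>\<Gamma> Q. (\<forall>n::nat. \<Gamma> n \<in> Am \<theta> (- K)) \<and> Q \<in> CCI \<theta> (frontier K)
     \<and> h_converges \<Gamma> Q \<and> (\<forall>n. condition \<theta> i (\<Gamma> n)))"

definition condition10_1 :: "(real \<Rightarrow> 'a::metric_space \<Rightarrow> 'a) \<Rightarrow> 'a set \<Rightarrow> 'a set \<Rightarrow> bool" where
  "condition10_1 \<theta> U K \<longleftrightarrow>
     c_dense_in_itself (Eq \<theta> (U - K)) \<and> h_accumulates (Eq \<theta> (U - K)) (Eq \<theta> (frontier K))"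

definition condition10_2 :: "(real \<Rightarrow> 'a::metric_space \<Rightarrow> 'a) \<Rightarrow> 'a set \<Rightarrow> 'a set \<Rightarrow> bool" where
  "condition10_2 \<theta> U K \<longleftrightarrow>
     c_dense_in_itself (Per \<theta> (U - K)) \<and> h_accumulates (Per \<theta> (U - K)) (CCI \<theta> (frontier K))"

definition condition10_3 :: "(real \<Rightarrow> 'a::metric_space \<Rightarrow> 'a) \<Rightarrow> 'a set \<Rightarrow> 'a set \<Rightarrow> bool" where
  "condition10_3 \<theta> U K \<longleftrightarrow>
     c_dense_in_itself (Am \<theta> (U - K)) \<and> h_accumulates (Am \<theta> (U - K)) (CCI \<theta> (frontier K))"

definition condition10_4 :: "(real \<Rightarrow> 'a::metric_space \<Rightarrow> 'a) \<Rightarrow> 'a set \<Rightarrow> 'a set \<Rightarrow> bool" where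
  "condition10_4 \<theta> U K \<longleftrightarrow> (\<exists>P A.
     P \<subseteq> Per \<theta> (U - K) \<and> A \<subseteq> Am \<theta> (U - K) \<and>
     c_dense_in_itself P \<and> c_dense_in_itself A \<and>
     h_open_in P (Per \<theta> UNIV) \<and> h_open_in A (Am \<theta> UNIV) \<and>
     h_accumulates P (CCI \<theta> (frontier K)) \<and> h_accumulates A (CCI \<theta> (frontier K)) \<and>
     bi_stable_rel \<theta> K (\<Union>P) \<and> bi_stable_rel \<theta> K (\<Union>A) \<and>
     (\<forall>\<gamma> :: nat \<Rightarrow> 'a set. (\<forall>n. \<gamma> n \<in> P) \<longrightarrow> (\<lambda>n. setdist (\<gamma> n) K) \<longlonglongrightarrow> 0 \<longrightarrow>
        filterlim (\<lambda>n. period \<theta> (\<gamma> n)) at_top sequentially))"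

definition condition10 :: "(real \<Rightarrow> 'a::metric_space \<Rightarrow> 'a) \<Rightarrow> 'a set \<Rightarrow> bool" where
  "condition10 \<theta> K \<longleftrightarrow> (\<exists>U. open U \<and> K \<subseteq> U \<and> c_dense_in_itself (CMin \<theta> (U - K)) \<and>
     (condition10_1 \<theta> U K \<or> condition10_2 \<theta> U K \<or> condition10_3 \<theta> U K \<or> condition10_4 \<theta> U K))"

end

theory Submission
  imports Defs
begin

text \<open>Whether \<open>K\<close> is isolated from minimals separates alternatives A, B, C from alternatives D, E.

  Suppose that \<open>K\<close> is isolated from minimals. A half orbit that stays close to \<open>K\<close> has a limit set that
  meets \<open>K\<close>, so a stable \<open>K\<close> is an attractor (\<open>stable_isolated_imp_attractor\<close>) and a negatively stable
  \<open>K\<close> is a repeller. If \<open>K\<close> is unstable in both time directions, points that start near \<open>K\<close> and leave a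
  tube around it have limits outside \<open>K\<close> whose negative half orbits stay in the tube (\<open>exit_point\<close>). The
  same argument applies to an orbit whose \<open>\<alpha>\<close>-limit set meets \<open>K\<close> without lying in it: this limit set
  contains orbits outside \<open>K\<close> with negative half orbits as near \<open>K\<close> as desired (\<open>alpha_lim_exit\<close>). If
  nothing outside \<open>K\<close> is asymptotic to \<open>K\<close> in negative time, the \<open>\<alpha>\<close>-limit sets of the latter leave \<open>K\<close>
  again, and the step can be repeated for ever, with orbits that converge to \<open>K\<close>. Choosing
  always orbits asymptotic to \<open>K\<close> in positive time gives a shell; if such a choice is impossible at some
  stage, then below it no orbit is asymptotic to \<open>K\<close> in either direction, both limit sets
  can be followed at every step, and a tree arises (\<open>alpha_shell_or_core\<close>, \<open>tree_exists\<close>). Time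
  reversal covers the case that nothing outside \<open>K\<close> is asymptotic to \<open>K\<close> in positive time. In the
  remaining case \<open>K\<close> is stagnant.

  Suppose that \<open>K\<close> is not isolated from minimals. If minimal sets that are themselves isolated from
  minimals occur arbitrarily near \<open>K\<close>, each satisfies one of the six conditions by the first part. There
  are finitely many conditions and kinds of minimal sets, and the selection theorem of Blaschke
  (\<open>hausdorff_subsequence\<close>) turns a constant combination into alternative D. Otherwise no minimal
  set near \<open>K\<close> has a neighbourhood free of others. A Cantor scheme of tubes then produces continuum many
  minimal sets near each of them (\<open>continuum_many_minimal_sets\<close>). For invariant sets, nearness to a
  minimal set in the Hausdorff metric amounts to being contained in a small tube
  (\<open>minimal_hdist_small\<close>), so this is density in itself. The same scheme works within the aperiodic minimal sets, since aperiodicity is a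
  countable intersection of conditions that persist in small tubes. The case distinction of
  condition 10 compares the kinds: when neither the aperiodic sets nor the periodic orbits are dense
  in themselves near \<open>K\<close>, there are, at every scale, an aperiodic set almost all of whose neighbours
  are periodic of long period and a periodic orbit most of whose neighbours are aperiodic; windows around
  them, shrinking to \<open>K\<close>, give condition 10.4 (\<open>condition10_4_windows\<close>).

  The alternatives exclude one another because an \<open>\<alpha>\<close>-limit set of a point outside a stable set misses
  that set and its basin (\<open>stable_alpha_lim_disjoint\<close>), because \<open>M\<close> is connected (A against B), and
  because a \<open>\<cc>\<close>-dense family has no members isolated from minimals (D against E).\<close>

section \<open>Closed tubes around compact sets\<close>

definition tube :: "'a::metric_space set \<Rightarrow> real \<Rightarrow> 'a set" where
  "tube X e = {y. infdist y X \<le> e}"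

lemma closed_tube: "closed (tube X e)"
  unfolding tube_def by (intro closed_Collect_le continuous_intros)

lemma open_infdist_less: "open {y. infdist y X < e}"
  by (intro open_Collect_less continuous_intros)

lemma tube_mono: "d \<le> e \<Longrightarrow> tube X d \<subseteq> tube X e"
  by (auto simp: tube_def)

lemma subset_tube: "0 \<le> e \<Longrightarrow> X \<subseteq> tube X e"
  by (auto simp: tube_def)

lemma compact_tube_mono: "compact (tube X e) \<Longrightarrow> d \<le> e \<Longrightarrow> compact (tube X d)"
  by (metis closed_tube compact_Int_closed inf.absorb_iff2 tube_mono)

lemma tube_tube: "Y \<noteq> {} \<Longrightarrow> Y \<subseteq> tube X d \<Longrightarrow> tube Y e \<subseteq> tube X (d + e)"
proof
  fix z assume Y: "Y \<noteq> {}" "Y \<subseteq> tube X d" and z: "z \<in> tube Y e"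
  have "infdist z X - d \<le> dist z y" if "y \<in> Y" for y
    using infdist_triangle[of z X y] Y that by (auto simp: tube_def)
  then have "infdist z X - d \<le> infdist z Y"
    using Y by (auto simp: infdist_notempty intro!: cINF_greatest)
  then show "z \<in> tube X (d + e)"
    using z by (simp add: tube_def)
qed

lemma compact_subseq:
  fixes C :: "'a::metric_space set"
  assumes "compact C" "\<And>n. x n \<in> C"
  obtains r l where "strict_mono (r :: nat \<Rightarrow> nat)" "l \<in> C" "(\<lambda>n. x (r n)) \<longlonglongrightarrow> l"
proof -
  have "seq_compact C" using assms(1) by (simp add: compact_eq_seq_compact_metric)
  then obtain l r where "l \<in> C" "strict_mono r" "(x \<circ> r) \<longlonglongrightarrow> l"
    by (rule seq_compactE) (use assms(2) in auto)
  then show thesis using that by (simp add: o_def)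
qed

lemmas subseq_LIMSEQ = LIMSEQ_subseq_LIMSEQ[unfolded o_def]

lemmas strict_mono_compose = strict_mono_o[unfolded o_def]

lemma null_le:
  fixes f g :: "nat \<Rightarrow> real"
  assumes "g \<longlonglongrightarrow> 0" "\<And>n. 0 \<le> f n" "\<And>n. f n \<le> g n"
  shows "f \<longlonglongrightarrow> 0"
  using tendsto_sandwich[OF always_eventually always_eventually tendsto_const assms(1)] assms(2,3)
  by blast

lemma infdist_less_witness:
  assumes "X \<noteq> {}" "infdist y X < e"
  obtains x where "x \<in> X" "dist y x < e"
  using assms cINF_less_iff[of X "dist y" e] by (auto simp: infdist_notempty)

lemma nearly_nearest_points:
  assumes "\<And>n. X n \<noteq> {}" "(\<lambda>n. infdist (y n) (X n)) \<longlonglongrightarrow> 0"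
  obtains p where "\<And>n::nat. p n \<in> X n" "(\<lambda>n. dist (y n) (p n)) \<longlonglongrightarrow> 0"
proof -
  have "\<forall>n. \<exists>p. p \<in> X n \<and> dist (y n) p < infdist (y n) (X n) + inverse (real (Suc n))"
  proof
    fix n
    have "infdist (y n) (X n) < infdist (y n) (X n) + inverse (real (Suc n))" by simp
    then show "\<exists>p. p \<in> X n \<and> dist (y n) p < infdist (y n) (X n) + inverse (real (Suc n))"
      by (rule infdist_less_witness[OF assms(1)]) blast
  qed
  from choice[OF this] obtain p where p: "\<And>n. p n \<in> X n"
    "\<And>n. dist (y n) (p n) \<le> infdist (y n) (X n) + inverse (real (Suc n))"
    using less_imp_le by blast
  have "(\<lambda>n. infdist (y n) (X n) + inverse (real (Suc n))) \<longlonglongrightarrow> 0"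
    using tendsto_add[OF assms(2) LIMSEQ_inverse_real_of_nat] by simp
  from null_le[OF this zero_le_dist p(2)] show thesis using that p(1) by blast
qed

text \<open>Nearly nearest points of \<open>X\<close> subconverge by compactness, and drag the given sequence along.\<close>

lemma limit_in_compact:
  fixes X :: "'a::metric_space set"
  assumes X: "compact X" "X \<noteq> {}" and y: "(\<lambda>n. infdist (y n) X) \<longlonglongrightarrow> 0"
  obtains r x where "strict_mono (r :: nat \<Rightarrow> nat)" "x \<in> X" "(\<lambda>n. y (r n)) \<longlonglongrightarrow> x"
proof -
  obtain p where p: "\<And>n. p n \<in> X" "(\<lambda>n. dist (y n) (p n)) \<longlonglongrightarrow> 0"
    using nearly_nearest_points[of "\<lambda>_. X", OF X(2) y] by blast
  obtain r x where r: "strict_mono r" "x \<in> X" "(\<lambda>n. p (r n)) \<longlonglongrightarrow> x"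
    using compact_subseq[OF X(1) p(1)] .
  have "(\<lambda>n. dist (y (r n)) (p (r n)) + dist (p (r n)) x) \<longlonglongrightarrow> 0 + 0"
    using subseq_LIMSEQ[OF p(2) r(1)] r(3) by (intro tendsto_add) (simp_all add: tendsto_dist_iff[symmetric])
  then have "(\<lambda>n. dist (y (r n)) (p (r n)) + dist (p (r n)) x) \<longlonglongrightarrow> 0" by simp
  from null_le[OF this zero_le_dist dist_triangle] show thesis
    using that[OF r(1,2)] by (simp add: tendsto_dist_iff[symmetric])
qed

lemma infdist_tendsto_0I:
  assumes "\<And>n::nat. y n \<in> tube X (inverse (real (Suc n)))"
  shows "(\<lambda>n. infdist (y n) X) \<longlonglongrightarrow> 0"
  by (rule null_le[OF LIMSEQ_inverse_real_of_nat infdist_nonneg])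
    (use assms in \<open>simp add: tube_def\<close>)

lemma limit_of_tubes:
  fixes X :: "'a::metric_space set"
  assumes X: "compact X" "X \<noteq> {}" and y: "\<And>n. y n \<in> tube X (inverse (real (Suc n)))"
  obtains r x where "strict_mono (r :: nat \<Rightarrow> nat)" "x \<in> X" "(\<lambda>n. y (r n)) \<longlonglongrightarrow> x"
  using limit_in_compact[OF X infdist_tendsto_0I[OF y]] .

lemma tube_subset_open:
  assumes X: "compact X" "X \<noteq> {}" and "open W" "X \<subseteq> W"
  obtains e where "e > 0" "tube X e \<subseteq> W"
proof (rule ccontr)
  assume "\<not> thesis"
  then have "\<not> tube X (inverse (real (Suc n))) \<subseteq> W" for n
    using that by (metis inverse_positive_iff_positive of_nat_0_less_iff zero_less_Suc)
  then have "\<forall>n. \<exists>z. z \<in> tube X (inverse (real (Suc n))) \<and> z \<notin> W"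
    by blast
  from choice[OF this] obtain y
    where y: "\<And>n. y n \<in> tube X (inverse (real (Suc n)))" "\<And>n. y n \<notin> W"
    by blast
  obtain r x where r: "x \<in> X" "(\<lambda>n. y (r n)) \<longlonglongrightarrow> x"
    using limit_of_tubes[OF X y(1)] .
  have "x \<in> - W"
    by (rule closed_sequentially[OF _ _ r(2)]) (use assms y in auto)
  then show False using r assms by auto
qed

lemma nbhd_tube: "e > 0 \<Longrightarrow> nbhd (tube X e) X"
  unfolding nbhd_def
  by (rule subset_trans[OF _ interior_maximal[OF _ open_infdist_less[of X e]]])
    (auto simp: tube_def)

lemma nbhd_subset_tube:
  assumes "compact X" "X \<noteq> {}" "nbhd U X"
  obtains e where "e > 0" "tube X e \<subseteq> U"
  using tube_subset_open[OF assms(1,2) open_interior] assms(3)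
  by (metis interior_subset nbhd_def subset_trans)

lemma tube_avoids_closed:
  assumes "compact X" "X \<noteq> {}" "closed Y" "X \<inter> Y = {}"
  obtains e where "e > 0" "tube X e \<inter> Y = {}"
  by (rule tube_subset_open[of X "- Y"]) (use assms in blast)+

text \<open>Finitely many compact neighbourhoods of points cover \<open>X\<close>, and a tube fits into their union.\<close>

lemma compact_tube_exists:
  fixes X :: "'a::metric_space set"
  assumes M: "locally compact (UNIV :: 'a set)" and X: "compact X" "X \<noteq> {}"
  obtains e where "e > 0" "compact (tube X e)"
proof -
  have "\<exists>u v. open u \<and> compact v \<and> x \<in> u \<and> u \<subseteq> v" for x :: 'a
    using M[unfolded locally_def, THEN spec, of UNIV, THEN spec, of x]
    unfolding subtopology_UNIV open_openin[symmetric] by (meson UNIV_I open_UNIV)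
  then obtain u v where uv: "\<And>x::'a. open (u x)" "\<And>x. compact (v x)" "\<And>x. x \<in> u x"
      "\<And>x. u x \<subseteq> v x"
    by metis
  have "X \<subseteq> (\<Union>c\<in>X. u c)" using uv(3) by blast
  then obtain C where C: "C \<subseteq> X" "finite C" "X \<subseteq> (\<Union>c\<in>C. u c)"
    by (rule compactE_image[OF X(1) uv(1)])
  have "open (\<Union>c\<in>C. u c)" using uv(1) by blast
  from tube_subset_open[OF X this C(3)]
  obtain e where e: "e > 0" "tube X e \<subseteq> (\<Union>c\<in>C. u c)" .
  have "compact (\<Union>c\<in>C. v c)" using C uv by auto
  moreover have "tube X e \<subseteq> (\<Union>c\<in>C. v c)" using e(2) uv(4) by blast
  ultimately have "compact (tube X e)"
    by (metis closed_tube compact_Int_closed inf.absorb_iff2)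
  then show thesis using e that by blast
qed


section \<open>Flows, invariance and time reversal\<close>

lemma flow_zero: "flow \<theta> \<Longrightarrow> \<theta> 0 x = x"
  and flow_add: "flow \<theta> \<Longrightarrow> \<theta> s (\<theta> t x) = \<theta> (s + t) x"
  by (auto simp: flow_def)

lemma flow_tendsto:
  assumes "flow \<theta>" "(t \<longlongrightarrow> a) F" "(x \<longlongrightarrow> y) F"
  shows "((\<lambda>n. \<theta> (t n) (x n)) \<longlongrightarrow> \<theta> a y) F"
proof -
  have "isCont (\<lambda>p. \<theta> (fst p) (snd p)) (a, y)"
    using assms(1) by (simp add: flow_def continuous_on_eq_continuous_at case_prod_beta)
  from isCont_tendsto_compose[OF this tendsto_Pair[OF assms(2,3)]] show ?thesis by simp
qed

lemma flow_continuous_on_time: "flow \<theta> \<Longrightarrow> continuous_on S (\<lambda>t. \<theta> t x)"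
  unfolding continuous_on by (auto intro: flow_tendsto tendsto_ident_at)

lemma invariant_iff: "flow \<theta> \<Longrightarrow> invariant \<theta> X \<longleftrightarrow> (\<forall>x\<in>X. \<forall>t. \<theta> t x \<in> X)"
proof
  assume F: "flow \<theta>"
  show "\<forall>x\<in>X. \<forall>t. \<theta> t x \<in> X" if "invariant \<theta> X"
    using that F by (fastforce simp: invariant_def orbit_def flow_add)
  show "invariant \<theta> X" if "\<forall>x\<in>X. \<forall>t. \<theta> t x \<in> X"
    unfolding invariant_def
  proof (intro exI[of _ X] set_eqI iffI)
    fix x assume "x \<in> X"
    then show "x \<in> (\<Union>x\<in>X. orbit \<theta> x)"
      using flow_zero[OF F, of x] unfolding orbit_def by (metis (mono_tags, lifting) UN_I mem_Collect_eq)
  qed (use that in \<open>auto simp: orbit_def\<close>)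
qed

lemma invariantD: "flow \<theta> \<Longrightarrow> invariant \<theta> X \<Longrightarrow> x \<in> X \<Longrightarrow> \<theta> t x \<in> X"
  by (simp add: invariant_iff)

lemma orbit_self: "flow \<theta> \<Longrightarrow> x \<in> orbit \<theta> x"
  unfolding orbit_def by (metis (mono_tags, lifting) flow_zero mem_Collect_eq)

lemma in_orbit: "\<theta> t x \<in> orbit \<theta> x"
  by (auto simp: orbit_def)

lemma orbit_subset: "flow \<theta> \<Longrightarrow> invariant \<theta> X \<Longrightarrow> x \<in> X \<Longrightarrow> orbit \<theta> x \<subseteq> X"
  by (auto simp: orbit_def invariant_iff)

lemma orbit_disjoint: "flow \<theta> \<Longrightarrow> invariant \<theta> X \<Longrightarrow> x \<notin> X \<Longrightarrow> orbit \<theta> x \<inter> X = {}"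
proof -
  assume F: "flow \<theta>" "invariant \<theta> X" "x \<notin> X"
  have "\<theta> t x \<notin> X" for t
    using F invariantD[of \<theta> X "\<theta> t x" "- t"] by (auto simp: flow_add flow_zero)
  then show ?thesis by (auto simp: orbit_def)
qed

lemma invariant_orbit: "flow \<theta> \<Longrightarrow> invariant \<theta> (orbit \<theta> x)"
  unfolding invariant_def by (intro exI[of _ "{x}"]) simp



lemma invariant_closure:
  assumes F: "flow \<theta>" and X: "invariant \<theta> X"
  shows "invariant \<theta> (closure X)"
  unfolding invariant_iff[OF F]
proof (intro ballI allI)
  fix x t assume "x \<in> closure X"
  then obtain y where y: "\<And>n::nat. y n \<in> X" "y \<longlonglongrightarrow> x"
    unfolding closure_sequential by blast
  have "\<forall>n. \<theta> t (y n) \<in> X" using invariantD[OF F X] y(1) by blast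
  moreover have "(\<lambda>n. \<theta> t (y n)) \<longlonglongrightarrow> \<theta> t x" by (rule flow_tendsto[OF F tendsto_const y(2)])
  ultimately show "\<theta> t x \<in> closure X"
    unfolding closure_sequential by (intro exI[of _ "\<lambda>n. \<theta> t (y n)"]) blast
qed

text \<open>The largest invariant subset of \<open>C\<close>.\<close>

lemma invariant_core:
  assumes F: "flow \<theta>"
  shows "invariant \<theta> {x. orbit \<theta> x \<subseteq> C}"
  using F by (auto simp: invariant_iff orbit_def flow_add)

lemma closed_core:
  assumes F: "flow \<theta>" and C: "closed C"
  shows "closed {x. orbit \<theta> x \<subseteq> C}"
  unfolding closed_sequential_limits
proof (intro allI impI, elim conjE)
  fix x l assume x: "\<forall>n::nat. x n \<in> {x. orbit \<theta> x \<subseteq> C}" "x \<longlonglongrightarrow> l"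
  have "\<theta> t l \<in> C" for t
    by (rule closed_sequentially[OF C _ flow_tendsto[OF F tendsto_const x(2)]])
      (use x(1) in \<open>auto simp: orbit_def\<close>)
  then show "l \<in> {x. orbit \<theta> x \<subseteq> C}" by (auto simp: orbit_def)
qed

text \<open>The notions for negative time are those for positive time of the reversed flow. The following
  rewrite rules make every result available in both time directions.\<close>

lemma flow_time_reversed: "flow \<theta> \<Longrightarrow> flow (time_reversed \<theta>)"
proof -
  assume F: "flow \<theta>"
  have "continuous_on UNIV (\<lambda>p. \<theta> (- fst p) (snd p))"
    unfolding continuous_on
    by (intro ballI flow_tendsto[OF F] tendsto_minus tendsto_fst tendsto_snd tendsto_ident_at)
  moreover have "\<theta> (- (s + t)) x = \<theta> (- s) (\<theta> (- t) x)" for s t x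
    by (simp add: flow_add[OF F])
  ultimately show ?thesis
    using F unfolding flow_def time_reversed_def case_prod_beta by simp
qed

lemma time_reversed_twice [simp]: "time_reversed (time_reversed \<theta>) = \<theta>"
  by (simp add: time_reversed_def)

lemma orbit_time_reversed [simp]: "orbit (time_reversed \<theta>) = orbit \<theta>"
proof (intro ext set_eqI)
  fix x y
  show "y \<in> orbit (time_reversed \<theta>) x \<longleftrightarrow> y \<in> orbit \<theta> x"
    unfolding orbit_def time_reversed_def mem_Collect_eq simp_thms(22)
    using minus_minus by metis
qed

lemma invariant_time_reversed [simp]: "invariant (time_reversed \<theta>) = invariant \<theta>"
  unfolding invariant_def by (intro ext) simp

lemma pos_orbit_time_reversed [simp]: "pos_orbit (time_reversed \<theta>) = neg_orbit \<theta>"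
proof (intro ext set_eqI)
  fix x y
  have "(\<exists>t. y = \<theta> (- t) x \<and> t \<ge> 0) \<longleftrightarrow> (\<exists>t. y = \<theta> t x \<and> t \<le> 0)"
    by (metis minus_minus neg_0_le_iff_le)
  then show "y \<in> pos_orbit (time_reversed \<theta>) x \<longleftrightarrow> y \<in> neg_orbit \<theta> x"
    by (simp add: pos_orbit_def neg_orbit_def time_reversed_def)
qed



lemma omega_lim_time_reversed [simp]: "omega_lim (time_reversed \<theta>) = alpha_lim \<theta>"
proof (intro ext set_eqI iffI)
  fix x y
  show "y \<in> alpha_lim \<theta> x" if y: "y \<in> omega_lim (time_reversed \<theta>) x"
  proof -
    obtain t where "filterlim t at_top sequentially" "(\<lambda>n. \<theta> (- t n) x) \<longlonglongrightarrow> y"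
      using y by (auto simp: omega_lim_def time_reversed_def)
    then show ?thesis
      unfolding alpha_lim_def filterlim_uminus_at_top by blast
  qed
  show "y \<in> omega_lim (time_reversed \<theta>) x" if y: "y \<in> alpha_lim \<theta> x"
  proof -
    obtain t where "filterlim t at_bot sequentially" "(\<lambda>n. \<theta> (t n) x) \<longlonglongrightarrow> y"
      using y by (auto simp: alpha_lim_def)
    then have "filterlim (\<lambda>n. - t n) at_top sequentially" "(\<lambda>n. \<theta> (- (- t n)) x) \<longlonglongrightarrow> y"
      by (auto simp: filterlim_uminus_at_bot)
    then show ?thesis
      unfolding omega_lim_def time_reversed_def by blast
  qed
qed

lemma alpha_lim_time_reversed [simp]: "alpha_lim (time_reversed \<theta>) = omega_lim \<theta>"
  by (metis omega_lim_time_reversed time_reversed_twice)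

lemma minimal_set_time_reversed [simp]: "minimal_set (time_reversed \<theta>) = minimal_set \<theta>"
  unfolding minimal_set_def by (intro ext) simp

lemma isolated_time_reversed [simp]:
  "isolated_from_minimals (time_reversed \<theta>) = isolated_from_minimals \<theta>"
  unfolding isolated_from_minimals_def by (intro ext) simp

lemma stable_time_reversed [simp]: "stable (time_reversed \<theta>) = neg_stable \<theta>"
  unfolding stable_def neg_stable_def by (intro ext) simp

lemma pos_basin_time_reversed [simp]: "pos_basin (time_reversed \<theta>) = neg_basin \<theta>"
  unfolding pos_basin_def neg_basin_def by (intro ext) simp

lemma neg_basin_time_reversed [simp]: "neg_basin (time_reversed \<theta>) = pos_basin \<theta>"
  by (metis pos_basin_time_reversed time_reversed_twice)

lemma attractor_time_reversed [simp]: "attractor (time_reversed \<theta>) = repeller \<theta>"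
  unfolding attractor_def repeller_def by (intro ext) simp


section \<open>Limit sets\<close>

text \<open>A description without sequences, from which limit points can be approximated by orbit points at
  arbitrarily late times.\<close>

lemma omega_lim_iff:
  "y \<in> omega_lim \<theta> x \<longleftrightarrow> (\<forall>e>0. \<forall>T. \<exists>t\<ge>T. dist (\<theta> t x) y < e)"
proof
  assume "y \<in> omega_lim \<theta> x"
  then obtain t where t: "filterlim t at_top sequentially" "(\<lambda>n. \<theta> (t n) x) \<longlonglongrightarrow> y"
    by (auto simp: omega_lim_def)
  show "\<forall>e>0. \<forall>T. \<exists>t\<ge>T. dist (\<theta> t x) y < e"
  proof (intro allI impI)
    fix e T :: real assume "e > 0"
    then have "eventually (\<lambda>n. dist (\<theta> (t n) x) y < e \<and> t n \<ge> T) sequentially"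
      using t by (intro eventually_conj tendstoD) (auto simp: filterlim_at_top)
    then show "\<exists>t\<ge>T. dist (\<theta> t x) y < e"
      by (auto dest: eventually_happens)
  qed
next
  assume R: "\<forall>e>0. \<forall>T. \<exists>t\<ge>T. dist (\<theta> t x) y < e"
  then have "\<exists>t\<ge>real n. dist (\<theta> t x) y < inverse (real (Suc n))" for n
    by simp
  then obtain t where t: "\<And>n. t n \<ge> real n" "\<And>n. dist (\<theta> (t n) x) y < inverse (real (Suc n))"
    by metis
  have "filterlim t at_top sequentially"
    by (rule filterlim_at_top_mono[OF filterlim_real_sequentially]) (use t in auto)
  moreover have "(\<lambda>n. dist (\<theta> (t n) x) y) \<longlonglongrightarrow> 0"
    by (rule null_le[OF LIMSEQ_inverse_real_of_nat zero_le_dist less_imp_le[OF t(2)]])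
  ultimately show "y \<in> omega_lim \<theta> x"
    unfolding omega_lim_def tendsto_dist_iff[of "\<lambda>n. \<theta> (_ n) x"] by blast
qed

lemma alpha_lim_iff:
  "y \<in> alpha_lim \<theta> x \<longleftrightarrow> (\<forall>e>0. \<forall>T. \<exists>t\<le>T. dist (\<theta> t x) y < e)"
  unfolding omega_lim_time_reversed[symmetric] omega_lim_iff time_reversed_def
  by (metis minus_le_iff minus_minus)

lemma closed_omega_lim: "closed (omega_lim \<theta> x)"
  unfolding closed_sequential_limits
proof (intro allI impI, elim conjE)
  fix y l assume y: "\<forall>n::nat. y n \<in> omega_lim \<theta> x" "y \<longlonglongrightarrow> l"
  show "l \<in> omega_lim \<theta> x"
    unfolding omega_lim_iff
  proof (intro allI impI)
    fix e T :: real assume e: "e > 0"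
    then obtain n where "dist (y n) l < e / 2"
      using tendstoD[OF y(2), of "e / 2"] by (auto dest: eventually_happens)
    moreover obtain t where "t \<ge> T" "dist (\<theta> t x) (y n) < e / 2"
      using y(1) e half_gt_zero unfolding omega_lim_iff by blast
    ultimately show "\<exists>t\<ge>T. dist (\<theta> t x) l < e"
      by (metis dist_triangle_half_l dist_commute)
  qed
qed

lemma invariant_omega_lim: "flow \<theta> \<Longrightarrow> invariant \<theta> (omega_lim \<theta> x)"
proof -
  assume F: "flow \<theta>"
  have "\<theta> s y \<in> omega_lim \<theta> x" if y: "y \<in> omega_lim \<theta> x" for y s
  proof -
    obtain t where t: "filterlim t at_top sequentially" "(\<lambda>n. \<theta> (t n) x) \<longlonglongrightarrow> y"
      using y by (auto simp: omega_lim_def)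
    have "filterlim (\<lambda>n. s + t n) at_top sequentially"
      by (rule filterlim_tendsto_add_at_top[OF tendsto_const t(1)])
    moreover have "(\<lambda>n. \<theta> (s + t n) x) \<longlonglongrightarrow> \<theta> s y"
      using flow_tendsto[OF F tendsto_const t(2), of s] by (simp add: flow_add[OF F])
    ultimately show ?thesis unfolding omega_lim_def by blast
  qed
  then show ?thesis using F by (simp add: invariant_iff)
qed

lemma omega_lim_subset:
  assumes "closed C" "\<And>t. t \<ge> T \<Longrightarrow> \<theta> t x \<in> C"
  shows "omega_lim \<theta> x \<subseteq> C"
proof
  fix y assume y: "y \<in> omega_lim \<theta> x"
  have "y \<in> closure C"
    unfolding closure_approachable
    using y assms(2) unfolding omega_lim_iff by blast
  then show "y \<in> C" using assms(1) by simp
qed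

lemma omega_lim_nonempty:
  assumes C: "compact C" and x: "\<And>t. t \<ge> 0 \<Longrightarrow> \<theta> t x \<in> C"
  shows "omega_lim \<theta> x \<noteq> {}"
proof -
  have "\<theta> (real n) x \<in> C" for n using x by simp
  from compact_subseq[OF C this]
  obtain r l where r: "strict_mono r" "l \<in> C" "(\<lambda>n. \<theta> (real (r n)) x) \<longlonglongrightarrow> l" .
  have "filterlim (\<lambda>n. real (r n)) at_top sequentially"
    using filterlim_compose[OF filterlim_real_sequentially filterlim_subseq[OF r(1)]] .
  then have "l \<in> omega_lim \<theta> x"
    using r(3) unfolding omega_lim_def by blast
  then show ?thesis by blast
qed

lemma omega_lim_shift: "flow \<theta> \<Longrightarrow> omega_lim \<theta> (\<theta> s x) = omega_lim \<theta> x"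
proof -
  assume F: "flow \<theta>"
  have "orbit \<theta> x \<subseteq> orbit \<theta> (\<theta> s x)"
    using orbit_subset[OF F invariant_orbit[OF F], of x "\<theta> s x"] in_orbit[of \<theta> "- s" "\<theta> s x"]
    by (simp add: flow_add[OF F] flow_zero[OF F])
  then have "orbit \<theta> (\<theta> s x) = orbit \<theta> x"
    using orbit_subset[OF F invariant_orbit[OF F] in_orbit] by blast
  then show ?thesis by (metis F omega_orb_orbit)
qed

lemmas closed_alpha_lim =
    closed_omega_lim[of "time_reversed \<theta>" for \<theta>, unfolded omega_lim_time_reversed]

lemma invariant_alpha_lim: "flow \<theta> \<Longrightarrow> invariant \<theta> (alpha_lim \<theta> x)"
  using invariant_omega_lim[OF flow_time_reversed] by simp

lemma omega_lim_subset_pos_orbit: "closed C \<Longrightarrow> pos_orbit \<theta> x \<subseteq> C \<Longrightarrow> omega_lim \<theta> x \<subseteq> C"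
  by (rule omega_lim_subset[of _ 0]) (auto simp: pos_orbit_def)

lemma omega_lim_nonempty_pos_orbit: "compact C \<Longrightarrow> pos_orbit \<theta> x \<subseteq> C \<Longrightarrow> omega_lim \<theta> x \<noteq> {}"
  by (rule omega_lim_nonempty) (auto simp: pos_orbit_def)

lemma alpha_lim_subset_neg_orbit: "closed C \<Longrightarrow> neg_orbit \<theta> x \<subseteq> C \<Longrightarrow> alpha_lim \<theta> x \<subseteq> C"
  using omega_lim_subset_pos_orbit[of C "time_reversed \<theta>"] by simp

lemma alpha_lim_nonempty_neg_orbit: "compact C \<Longrightarrow> neg_orbit \<theta> x \<subseteq> C \<Longrightarrow> alpha_lim \<theta> x \<noteq> {}"
  using omega_lim_nonempty_pos_orbit[of C "time_reversed \<theta>"] by simp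

lemma half_orbits_subset_orbit: "pos_orbit \<theta> x \<subseteq> orbit \<theta> x" "neg_orbit \<theta> x \<subseteq> orbit \<theta> x"
  by (auto simp: orbit_def pos_orbit_def neg_orbit_def)


section \<open>Minimal sets\<close>

lemma minimal_subset:
  assumes F: "flow \<theta>" and N: "minimal_set \<theta> N" and L: "closed L" "invariant \<theta> L" "N \<inter> L \<noteq> {}"
  shows "N \<subseteq> L"
proof (rule ccontr)
  assume "\<not> N \<subseteq> L"
  then have "N \<inter> L \<subset> N" by blast
  moreover have "closed (N \<inter> L)" "invariant \<theta> (N \<inter> L)"
    using N L F by (auto simp: minimal_set_def invariant_iff)
  ultimately show False using N L(3) unfolding minimal_set_def by blast
qed

lemma minimal_eq:
  assumes "flow \<theta>" "minimal_set \<theta> N" "minimal_set \<theta> L" "N \<inter> L \<noteq> {}"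
  shows "N = L"
  using minimal_subset[OF assms(1,2), of L] minimal_subset[OF assms(1,3), of N] assms(2-4)
  unfolding minimal_set_def by blast

text \<open>Zorn's lemma, applied to the complements of closed invariant subsets: a chain of them cannot
  cover the compact set \<open>C\<close>, since a finite subchain has a largest member.\<close>

lemma minimal_set_exists:
  fixes C :: "'a::metric_space set"
  assumes F: "flow \<theta>" and C: "compact C" "C \<noteq> {}" "invariant \<theta> C"
  obtains N where "minimal_set \<theta> N" "N \<subseteq> C" "compact N"
proof -
  define \<A> where "\<A> = {A. open A \<and> invariant \<theta> (- A) \<and> - A \<subseteq> C \<and> A \<noteq> UNIV}"
  have "- C \<in> \<A>"
    using C by (auto simp: \<A>_def compact_imp_closed)
  then have "\<A> \<noteq> {}" by blast
  moreover have "\<Union>\<C> \<in> \<A>" if \<C>: "\<C> \<noteq> {}" "subset.chain \<A> \<C>" for \<C>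
  proof -
    have sub: "\<C> \<subseteq> \<A>" using \<C> by (auto simp: subset.chain_def)
    have "open (\<Union>\<C>)" "invariant \<theta> (- \<Union>\<C>)" "- \<Union>\<C> \<subseteq> C"
      using sub \<C>(1) F by (auto simp: \<A>_def invariant_iff)
    moreover have "\<Union>\<C> \<noteq> UNIV"
    proof
      assume "\<Union>\<C> = UNIV"
      then have "C \<subseteq> \<Union>\<C>" by simp
      moreover have "\<And>B. B \<in> \<C> \<Longrightarrow> open B" using sub by (auto simp: \<A>_def)
      ultimately obtain \<D> where \<D>: "\<D> \<subseteq> \<C>" "finite \<D>" "C \<subseteq> \<Union>\<D>"
        by (rule compactE[OF C(1)])
      moreover have "\<D> \<noteq> {}" using \<D>(3) C(2) by blast
      moreover have "subset.chain \<A> \<D>"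
        using \<D>(1) \<C>(2) unfolding subset.chain_def by blast
      ultimately have "\<Union>\<D> \<in> \<D>"
        by (metis Union_in_chain)
      then have "\<Union>\<D> \<in> \<A>" using \<D>(1) sub by blast
      then show False using \<D>(3) unfolding \<A>_def by blast
    qed
    ultimately show ?thesis by (simp add: \<A>_def)
  qed
  ultimately have "\<exists>A\<in>\<A>. \<forall>B\<in>\<A>. A \<subseteq> B \<longrightarrow> B = A"
    by (rule subset_Zorn_nonempty)
  then obtain A where A: "A \<in> \<A>" "\<And>B. B \<in> \<A> \<Longrightarrow> A \<subseteq> B \<Longrightarrow> B = A"
    by metis
  have "minimal_set \<theta> (- A)"
    unfolding minimal_set_def
  proof (intro conjI allI impI notI; (elim conjE)?)
    fix L assume L: "L \<subset> - A" "L \<noteq> {}" "closed L" "invariant \<theta> L"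
    then have "- L \<in> \<A>" using A(1) by (auto simp: \<A>_def)
    then have "- L = A" using A(2) L(1) by blast
    then show False using L(1) by blast
  qed (use A in \<open>auto simp: \<A>_def\<close>)
  moreover have "- A \<subseteq> C" "closed (- A)" using A by (auto simp: \<A>_def)
  ultimately show thesis
    using that C(1) by (metis compact_Int_closed inf.absorb_iff2)
qed

lemma minimal_closure_orbit:
  assumes F: "flow \<theta>" and N: "minimal_set \<theta> N" and x: "x \<in> N"
  shows "closure (orbit \<theta> x) = N"
proof
  have N': "closed N" "invariant \<theta> N" using N by (auto simp: minimal_set_def)
  show "closure (orbit \<theta> x) \<subseteq> N"
    by (intro closure_minimal orbit_subset) (use F N' x in auto)
  show "N \<subseteq> closure (orbit \<theta> x)"
  proof (rule minimal_subset[OF F N closed_closure])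
    show "invariant \<theta> (closure (orbit \<theta> x))"
      by (intro invariant_closure invariant_orbit F)
    show "N \<inter> closure (orbit \<theta> x) \<noteq> {}"
      using x orbit_self[OF F, of x] closure_subset by blast
  qed
qed

lemma connected_orbit: "flow \<theta> \<Longrightarrow> connected (orbit \<theta> x)"
proof -
  assume F: "flow \<theta>"
  have "orbit \<theta> x = (\<lambda>t. \<theta> t x) ` UNIV" by (auto simp: orbit_def)
  then show ?thesis
    using connected_continuous_image[OF flow_continuous_on_time[OF F, of UNIV x]] by simp
qed

lemma connected_minimal:
  assumes "flow \<theta>" "minimal_set \<theta> N"
  shows "connected N"
proof -
  obtain x where "x \<in> N" using assms by (auto simp: minimal_set_def)
  then show ?thesis
    using minimal_closure_orbit[OF assms] connected_orbit[OF assms(1)]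
    by (metis connected_imp_connected_closure)
qed

lemma CMinD:
  assumes "N \<in> CMin \<theta> S"
  shows "minimal_set \<theta> N" "compact N" "N \<noteq> {}" "closed N" "invariant \<theta> N" "N \<subseteq> S"
  using assms by (auto simp: CMin_def minimal_set_def)

lemma CMin_time: "flow \<theta> \<Longrightarrow> N \<in> CMin \<theta> S \<Longrightarrow> x \<in> N \<Longrightarrow> \<theta> t x \<in> N"
  using CMinD(5) invariantD by blast

lemma CMin_disjoint: "flow \<theta> \<Longrightarrow> X \<in> CMin \<theta> S \<Longrightarrow> Y \<in> CMin \<theta> T \<Longrightarrow> X \<noteq> Y \<Longrightarrow> X \<inter> Y = {}"
  using minimal_eq CMinD(1) by blast

lemma CMin_mono: "N \<in> CMin \<theta> S \<Longrightarrow> N \<subseteq> T \<Longrightarrow> N \<in> CMin \<theta> T"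
  by (simp add: CMin_def)

lemma CMin_exists:
  assumes "flow \<theta>" "compact C" "C \<noteq> {}" "invariant \<theta> C"
  obtains N where "N \<in> CMin \<theta> C"
  using minimal_set_exists[OF assms] by (metis (mono_tags, lifting) CMin_def mem_Collect_eq)


section \<open>Equilibria, periodic orbits and aperiodic minimal sets\<close>

lemma return_multiple:
  assumes F: "flow \<theta>" and p: "\<theta> p y = y"
  shows "\<theta> (of_int k * p) y = y"
proof (induction k rule: int_induct[of _ 0])
  case base show ?case using F by (simp add: flow_zero)
next
  case (step1 i)
  have "\<theta> (of_int (i + 1) * p) y = \<theta> (of_int i * p) (\<theta> p y)"
    by (simp add: flow_add[OF F] algebra_simps)
  then show ?case using p step1 by simp
next
  case (step2 i)
  have "\<theta> (of_int (i - 1) * p) y = \<theta> (- p) (\<theta> (of_int i * p) y)"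
    by (simp add: flow_add[OF F] algebra_simps)
  also have "\<dots> = \<theta> (- p) (\<theta> p y)" using p step2 by simp
  finally show ?case by (simp add: flow_add[OF F] flow_zero[OF F])
qed

lemma floor_remainder:
  fixes s t :: real
  assumes "t > 0"
  shows "0 \<le> s - of_int \<lfloor>s / t\<rfloor> * t" "s - of_int \<lfloor>s / t\<rfloor> * t < t"
proof -
  have "of_int \<lfloor>s / t\<rfloor> \<le> s / t" "s / t < of_int \<lfloor>s / t\<rfloor> + 1" by linarith+
  then have "of_int \<lfloor>s / t\<rfloor> * t \<le> s" "s < (of_int \<lfloor>s / t\<rfloor> + 1) * t"
    using assms by (simp_all only: pos_le_divide_eq pos_divide_less_eq)
  then show "0 \<le> s - of_int \<lfloor>s / t\<rfloor> * t" "s - of_int \<lfloor>s / t\<rfloor> * t < t"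
    by (simp_all add: algebra_simps)
qed

text \<open>The return times of a point form a closed subgroup of the line. Such a group is everything as
  soon as it contains arbitrarily small positive numbers; otherwise its least positive element
  generates it.\<close>

lemma orbit_of_returning_point:
  assumes F: "flow \<theta>" and p: "p > 0" "\<theta> p y = y"
  shows "orbit \<theta> y \<in> Eq \<theta> UNIV \<union> Per \<theta> UNIV"
proof -
  have reduce: "\<theta> (s - of_int k * t) y = \<theta> s y" if "\<theta> t y = y" for s t k
  proof -
    have "\<theta> (s - of_int k * t) y = \<theta> s (\<theta> (of_int (- k) * t) y)"
      by (simp add: flow_add[OF F])
    then show ?thesis using return_multiple[OF F that] by metis
  qed
  show ?thesis
  proof (cases "\<forall>e>0. \<exists>t. 0 < t \<and> t < e \<and> \<theta> t y = y")
    case True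
    then have "\<exists>t. 0 < t \<and> t < inverse (real (Suc n)) \<and> \<theta> t y = y" for n by simp
    then obtain t where t: "\<And>n. 0 < t n" "\<And>n. t n < inverse (real (Suc n))" "\<And>n. \<theta> (t n) y = y"
      by metis
    have "\<theta> s y = y" for s
    proof -
      define u where "u n = s - of_int \<lfloor>s / t n\<rfloor> * t n" for n
      have u: "0 \<le> u n" "u n < inverse (real (Suc n))" "\<theta> (u n) y = \<theta> s y" for n
        using floor_remainder[OF t(1), of s n] t(2)[of n] reduce[OF t(3)] by (auto simp: u_def)
      have "u \<longlonglongrightarrow> 0"
        by (rule null_le[OF LIMSEQ_inverse_real_of_nat u(1) less_imp_le[OF u(2)]])
      from flow_tendsto[OF F this tendsto_const, of y] have "(\<lambda>n::nat. \<theta> s y) \<longlonglongrightarrow> y"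
        by (simp add: u(3) flow_zero[OF F])
      then show ?thesis by (simp add: LIMSEQ_const_iff)
    qed
    then have "orbit \<theta> y \<in> Eq \<theta> UNIV" by (auto simp: orbit_def Eq_def)
    then show ?thesis by blast
  next
    case False
    then obtain e where e: "e > 0" "\<And>t. 0 < t \<Longrightarrow> t < e \<Longrightarrow> \<theta> t y \<noteq> y" by blast
    define G where "G = {e..p} \<inter> {t. \<theta> t y = y}"
    have "closed {t. \<theta> t y = y}"
      by (intro closed_Collect_eq flow_continuous_on_time F continuous_on_const)
    then have "compact G" unfolding G_def by (intro compact_Int_closed) auto
    moreover have "p \<in> G" using p e(2)[of p] by (auto simp: G_def not_less[symmetric])
    ultimately obtain m where m: "m \<in> G" "\<And>t. t \<in> G \<Longrightarrow> m \<le> t"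
      using compact_attains_inf[of G] by blast
    have m': "m > 0" "\<theta> m y = y" "m \<le> p" using m(1) e(1) by (auto simp: G_def)
    have least: "t = 0" if "0 \<le> t" "t < m" "\<theta> t y = y" for t
      using m(2)[of t] e(2)[of t] that m'(3) by (cases "t = 0"; cases "t < e") (auto simp: G_def)
    have "{t. \<theta> t y = y} = range (\<lambda>k::int. m * of_int k)"
    proof (intro equalityI subsetI)
      fix t assume "t \<in> {t. \<theta> t y = y}"
      then have "t - of_int \<lfloor>t / m\<rfloor> * m = 0"
        using least[OF floor_remainder[OF m'(1)]] reduce[OF m'(2)] by simp
      then show "t \<in> range (\<lambda>k::int. m * of_int k)" by (auto simp: mult.commute)
    next
      fix t assume "t \<in> range (\<lambda>k::int. m * of_int k)"
      then show "t \<in> {t. \<theta> t y = y}"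
        using return_multiple[OF F m'(2)] by (auto simp: mult.commute)
    qed
    then have "has_period \<theta> (orbit \<theta> y) m" using m'(1) unfolding has_period_def by blast
    then show ?thesis unfolding Per_def by blast
  qed
qed

text \<open>The flow commutes with itself, so all points of a periodic orbit return after the same times.\<close>

lemma periodic_point:
  assumes F: "flow \<theta>" and \<gamma>: "has_period \<theta> \<gamma> p" and z: "z \<in> \<gamma>"
  shows "\<gamma> = orbit \<theta> z" "\<theta> p z = z" "p > 0"
proof -
  obtain x where x: "\<gamma> = orbit \<theta> x" "{t. \<theta> t x = x} = range (\<lambda>k::int. p * of_int k)"
    using \<gamma> by (auto simp: has_period_def)
  obtain s where s: "z = \<theta> s x" using z x(1) by (auto simp: orbit_def)
  have "p \<in> {t. \<theta> t x = x}" unfolding x(2) by (auto intro!: image_eqI[of _ _ 1])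
  then show "\<theta> p z = z" by (simp add: s flow_add[OF F]) (metis F add.commute flow_add mem_Collect_eq)
  have "x = \<theta> (- s) z" by (simp add: s flow_add[OF F] flow_zero[OF F])
  then show "\<gamma> = orbit \<theta> z"
    using orbit_subset[OF F invariant_orbit[OF F] in_orbit] s x(1) by (metis subset_antisym)
  show "p > 0" using \<gamma> by (simp add: has_period_def)
qed

lemma Eq_subset_CMin: "flow \<theta> \<Longrightarrow> Eq \<theta> S \<subseteq> CMin \<theta> S"
  by (auto simp: Eq_def CMin_def minimal_set_def invariant_iff psubset_eq subset_singleton_iff)

lemma Per_subset_CMin:
  assumes F: "flow \<theta>"
  shows "Per \<theta> S \<subseteq> CMin \<theta> S"
proof
  fix \<gamma> assume "\<gamma> \<in> Per \<theta> S"
  then obtain p where p: "has_period \<theta> \<gamma> p" "\<gamma> \<subseteq> S" by (auto simp: Per_def)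
  obtain x where x: "x \<in> \<gamma>" using p orbit_self[OF F] by (auto simp: has_period_def)
  note per = periodic_point[OF F p(1) x]
  have "\<gamma> \<subseteq> (\<lambda>t. \<theta> t x) ` {0..p}"
  proof
    fix z assume "z \<in> \<gamma>"
    then obtain t where t: "z = \<theta> t x" using per(1) by (auto simp: orbit_def)
    define u where "u = t - of_int \<lfloor>t / p\<rfloor> * p"
    have "u \<in> {0..p}"
      using floor_remainder[OF per(3), of t] by (simp add: u_def)
    moreover have "z = \<theta> u (\<theta> (of_int \<lfloor>t / p\<rfloor> * p) x)"
      by (simp add: t u_def flow_add[OF F])
    ultimately show "z \<in> (\<lambda>t. \<theta> t x) ` {0..p}"
      using return_multiple[OF F per(2)] by auto
  qed
  then have "\<gamma> = (\<lambda>t. \<theta> t x) ` {0..p}" using per(1) by (auto simp: orbit_def)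
  then have cpt: "compact \<gamma>"
    using compact_continuous_image[OF flow_continuous_on_time[OF F] compact_Icc] by metis
  have "\<not> (L \<noteq> {} \<and> closed L \<and> invariant \<theta> L)" if L: "L \<subset> \<gamma>" for L
  proof
    assume A: "L \<noteq> {} \<and> closed L \<and> invariant \<theta> L"
    then obtain z where "z \<in> L" by blast
    then have "orbit \<theta> z \<subseteq> L" "\<gamma> = orbit \<theta> z"
      using orbit_subset[OF F] A periodic_point(1)[OF F p(1)] L by auto
    then show False using L by blast
  qed
  then show "\<gamma> \<in> CMin \<theta> S"
    using cpt x p per(1) invariant_orbit[OF F, of x]
    unfolding CMin_def minimal_set_def by (auto simp: compact_imp_closed)
qed

lemma Am_subset_CMin: "Am \<theta> S \<subseteq> CMin \<theta> S"
  by (auto simp: Am_def CMin_def)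

lemma CMin_cases:
  assumes F: "flow \<theta>"
  shows "CMin \<theta> S = Eq \<theta> S \<union> Per \<theta> S \<union> Am \<theta> S"
proof -
  have "CMin \<theta> S \<subseteq> Eq \<theta> S \<union> Per \<theta> S \<union> Am \<theta> S"
    by (auto simp: CMin_def Am_def Eq_def Per_def)
  then show ?thesis
    using Eq_subset_CMin[OF F, of S] Per_subset_CMin[OF F, of S] Am_subset_CMin[of \<theta> S] by blast
qed

lemma orbit_in_CMin:
  assumes F: "flow \<theta>" and N: "N \<in> CMin \<theta> S" and p: "x \<in> N" "orbit \<theta> x \<in> CMin \<theta> T"
  shows "N = orbit \<theta> x"
  using minimal_eq[OF F CMinD(1)[OF N] CMinD(1)[OF p(2)]] p orbit_self[OF F] by blast

text \<open>A returning point would have a minimal orbit, which then is the whole minimal set.\<close>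

lemma Am_no_return:
  assumes F: "flow \<theta>" and N: "N \<in> Am \<theta> S" and x: "x \<in> N" and p: "p > 0"
  shows "\<theta> p x \<noteq> x"
proof
  assume "\<theta> p x = x"
  then have o: "orbit \<theta> x \<in> Eq \<theta> UNIV \<union> Per \<theta> UNIV"
    using orbit_of_returning_point[OF F p] by blast
  then have "N = orbit \<theta> x"
    using orbit_in_CMin[OF F subsetD[OF Am_subset_CMin N] x] Eq_subset_CMin[OF F]
      Per_subset_CMin[OF F] by blast
  then show False using o N by (auto simp: Am_def)
qed

lemma Per_not_Eq:
  assumes F: "flow \<theta>" and \<gamma>: "\<gamma> \<in> Per \<theta> S"
  shows "\<gamma> \<notin> Eq \<theta> T"
proof
  assume "\<gamma> \<in> Eq \<theta> T"
  then obtain z where z: "\<gamma> = {z}" "\<And>t. \<theta> t z = z" by (auto simp: Eq_def)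
  obtain p x where p: "p > 0" "\<gamma> = orbit \<theta> x" "{t. \<theta> t x = x} = range (\<lambda>k::int. p * of_int k)"
    using \<gamma> by (auto simp: Per_def has_period_def)
  have "x = z" using orbit_self[OF F, of x] p(2) z(1) by blast
  then have "p / 2 \<in> range (\<lambda>k::int. p * of_int k)"
    using z(2) p(3) by auto
  then obtain k :: int where "p / 2 = p * of_int k" by blast
  then have "(1::real) = of_int (2 * k)" using p(1) by (simp add: field_simps)
  then have "2 * k = 1" by linarith
  then show False by presburger
qed

lemma Eq_mono: "X \<in> Eq \<theta> S \<Longrightarrow> X \<subseteq> T \<Longrightarrow> X \<in> Eq \<theta> T"
  by (auto simp: Eq_def)




section \<open>Stability near a set that is isolated from minimals\<close>

lemma in_all_tubes:
  assumes "closed K" "K \<noteq> {}" "\<And>e. e > 0 \<Longrightarrow> y \<in> tube K e"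
  shows "y \<in> K"
proof -
  have "infdist y K \<le> 0"
    by (rule field_le_epsilon) (use assms(3) in \<open>auto simp: tube_def\<close>)
  then have "infdist y K = 0" using infdist_nonneg[of y K] by linarith
  then show ?thesis using in_closed_iff_infdist_zero[OF assms(1,2)] by blast
qed

text \<open>Once the orbit is close enough to \<open>K\<close>, stability confines it to a given tube for ever.\<close>

lemma stable_omega_subset:
  assumes F: "flow \<theta>" and K: "compact K" and st: "stable \<theta> K"
    and y: "omega_lim \<theta> y \<inter> K \<noteq> {}"
  shows "omega_lim \<theta> y \<subseteq> K"
proof -
  obtain k where k: "k \<in> omega_lim \<theta> y" "k \<in> K" using y by blast
  have "omega_lim \<theta> y \<subseteq> tube K e" if e: "e > 0" for e
  proof -
    obtain V where V: "nbhd V K" "(\<Union>x\<in>V. pos_orbit \<theta> x) \<subseteq> tube K e"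
      using st nbhd_tube[OF e] unfolding stable_def by blast
    have "k \<in> interior V" using V(1) k(2) by (auto simp: nbhd_def)
    then obtain d where d: "d > 0" "ball k d \<subseteq> interior V"
      using open_interior open_contains_ball by metis
    obtain t where t: "t \<ge> 0" "dist (\<theta> t y) k < d"
      using k(1) d(1) unfolding omega_lim_iff by blast
    have "\<theta> t y \<in> V"
      using t(2) d(2) interior_subset[of V] by (auto simp: dist_commute subset_eq)
    then have sub: "pos_orbit \<theta> (\<theta> t y) \<subseteq> tube K e" using V(2) by blast
    show ?thesis
    proof (rule omega_lim_subset[OF closed_tube])
      fix s assume "t \<le> s"
      then have "\<theta> s y \<in> pos_orbit \<theta> (\<theta> t y)"
        unfolding pos_orbit_def by (auto simp: flow_add[OF F] intro!: exI[of _ "s - t"])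
      then show "\<theta> s y \<in> tube K e" using sub by blast
    qed
  qed
  then show ?thesis
    using in_all_tubes[OF compact_imp_closed[OF K]] k(2) by blast
qed

text \<open>Besides excluding minimal sets outside \<open>K\<close>, such a tube is compact, so that half orbits in it
  have nonempty limit sets.\<close>

definition isolating_radius :: "(real \<Rightarrow> 'a::metric_space \<Rightarrow> 'a) \<Rightarrow> 'a set \<Rightarrow> real \<Rightarrow> bool" where
  "isolating_radius \<theta> K e \<longleftrightarrow> e > 0 \<and> compact (tube K e) \<and>
     (\<forall>N. minimal_set \<theta> N \<longrightarrow> N \<subseteq> tube K e \<longrightarrow> N \<inter> K \<noteq> {})"

lemma isolating_radius_time_reversed [simp]:
  "isolating_radius (time_reversed \<theta>) = isolating_radius \<theta>"
  unfolding isolating_radius_def by (intro ext) simp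

lemma isolating_radius_exists:
  fixes K :: "'a::metric_space set"
  assumes "locally compact (UNIV :: 'a set)" and K: "compact K" "K \<noteq> {}"
    and iso: "isolated_from_minimals \<theta> K"
  obtains e where "isolating_radius \<theta> K e"
proof -
  obtain e where e: "e > 0" "compact (tube K e)"
    using compact_tube_exists[OF assms(1) K] .
  obtain U where U: "nbhd U K" "\<And>N. minimal_set \<theta> N \<Longrightarrow> \<not> N \<subseteq> U - K"
    using iso by (auto simp: isolated_from_minimals_def)
  obtain d where d: "d > 0" "tube K d \<subseteq> U" using nbhd_subset_tube[OF K U(1)] .
  have "isolating_radius \<theta> K (min d e)"
    unfolding isolating_radius_def
  proof (intro conjI allI impI)
    show "compact (tube K (min d e))" using compact_tube_mono[OF e(2)] by simp
    fix N assume "minimal_set \<theta> N" "N \<subseteq> tube K (min d e)"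
    then show "N \<inter> K \<noteq> {}" using U(2)[of N] d(2) tube_mono[of "min d e" d K] by auto
  qed (use d e in auto)
  then show thesis using that by blast
qed

lemma isolating_meets:
  assumes F: "flow \<theta>" and e: "isolating_radius \<theta> K e"
    and C: "closed C" "C \<noteq> {}" "invariant \<theta> C" "C \<subseteq> tube K e"
  shows "C \<inter> K \<noteq> {}"
proof -
  have "compact C"
    using e C(1,4) unfolding isolating_radius_def by (metis compact_Int_closed inf.absorb_iff2)
  then obtain N where "minimal_set \<theta> N" "N \<subseteq> C"
    using minimal_set_exists[OF F _ C(2,3)] by metis
  then show ?thesis using e C(4) unfolding isolating_radius_def by blast
qed

text \<open>Orbits that stay near \<open>K\<close> have a limit set that meets \<open>K\<close>; stability then forces the whole limit
  set into \<open>K\<close>.\<close>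

lemma stable_isolated_imp_attractor:
  assumes F: "flow \<theta>" and K: "compact K" "K \<noteq> {}" and e: "isolating_radius \<theta> K e"
    and st: "stable \<theta> K"
  shows "attractor \<theta> K"
proof -
  have e0: "e > 0" "compact (tube K e)" using e by (auto simp: isolating_radius_def)
  obtain V where V: "nbhd V K" "(\<Union>x\<in>V. pos_orbit \<theta> x) \<subseteq> tube K e"
    using st nbhd_tube[OF e0(1)] unfolding stable_def by blast
  have "V \<subseteq> pos_basin \<theta> K"
  proof
    fix y assume "y \<in> V"
    then have y: "pos_orbit \<theta> y \<subseteq> tube K e" using V(2) by blast
    have ne: "omega_lim \<theta> y \<noteq> {}" by (rule omega_lim_nonempty_pos_orbit[OF e0(2) y])
    have "omega_lim \<theta> y \<inter> K \<noteq> {}"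
      by (rule isolating_meets[OF F e closed_omega_lim ne invariant_omega_lim[OF F]])
        (rule omega_lim_subset_pos_orbit[OF closed_tube y])
    from stable_omega_subset[OF F K(1) st this] ne show "y \<in> pos_basin \<theta> K"
      by (simp add: pos_basin_def)
  qed
  then have "nbhd (pos_basin \<theta> K) K"
    using V(1) interior_mono unfolding nbhd_def by blast
  then show ?thesis using st by (simp add: attractor_def)
qed


section \<open>Excursions away from a compact invariant set\<close>

text \<open>Points that start close to \<open>K\<close> and reach distance \<open>e\<close> have a first time of doing so, and this time
  tends to infinity because \<open>K\<close> is invariant. A limit point of the first exit points therefore has a
  whole negative half orbit within distance \<open>e\<close>.\<close>

lemma exit_point:
  fixes K :: "'a::metric_space set"
  assumes F: "flow \<theta>" and K: "compact K" "K \<noteq> {}" "invariant \<theta> K"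
    and e: "e > 0" "compact (tube K e)"
    and x: "(\<lambda>n. infdist (x n) K) \<longlonglongrightarrow> 0" "\<And>n. infdist (x n) K < e"
    and t: "\<And>n. 0 \<le> t n" "\<And>n. e \<le> infdist (\<theta> (t n) (x n)) K"
  obtains r s z where "strict_mono (r :: nat \<Rightarrow> nat)" "\<And>n. 0 \<le> s n" "\<And>n. s n \<le> t (r n)"
    "(\<lambda>n. \<theta> (s n) (x (r n))) \<longlonglongrightarrow> z" "z \<notin> K" "neg_orbit \<theta> z \<subseteq> tube K e"
proof -
  have "\<exists>s. 0 \<le> s \<and> s \<le> t n \<and> infdist (\<theta> s (x n)) K = e \<and>
      (\<forall>u. 0 \<le> u \<longrightarrow> u \<le> s \<longrightarrow> infdist (\<theta> u (x n)) K \<le> e)" for n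
  proof -
    define g where "g u = infdist (\<theta> u (x n)) K" for u
    have g: "continuous_on S g" for S
      unfolding g_def by (intro continuous_on_infdist flow_continuous_on_time F)
    define S where "S = {0..t n} \<inter> {u. e \<le> g u}"
    have "compact S"
      unfolding S_def by (intro compact_Int_closed closed_Collect_le g continuous_on_const) auto
    moreover have "t n \<in> S" using t by (auto simp: S_def g_def)
    ultimately obtain m where m: "m \<in> S" "\<And>u. u \<in> S \<Longrightarrow> m \<le> u"
      using compact_attains_inf[of S] by blast
    have less: "g u < e" if "0 \<le> u" "u < m" for u
      using m(2)[of u] that m(1) by (force simp: S_def)
    obtain u where u: "0 \<le> u" "u \<le> m" "g u = e"
      using IVT'[of g 0 e m] g x(2)[of n] m(1) by (auto simp: S_def g_def flow_zero[OF F])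
    then have "u = m" using less[of u] by force
    then show ?thesis
      using u m(1) less unfolding g_def
      by (intro exI[of _ m]) (auto simp: S_def le_less)
  qed
  then obtain s where s: "\<And>n. 0 \<le> s n" "\<And>n. s n \<le> t n" "\<And>n. infdist (\<theta> (s n) (x n)) K = e"
      "\<And>n u. 0 \<le> u \<Longrightarrow> u \<le> s n \<Longrightarrow> infdist (\<theta> u (x n)) K \<le> e"
    by metis
  have "\<theta> (s n) (x n) \<in> tube K e" for n by (simp add: tube_def s(3))
  from compact_subseq[OF e(2) this]
  obtain r z where r: "strict_mono r" "z \<in> tube K e" "(\<lambda>n. \<theta> (s (r n)) (x (r n))) \<longlonglongrightarrow> z" .
  have "(\<lambda>n. infdist (\<theta> (s (r n)) (x (r n))) K) \<longlonglongrightarrow> infdist z K"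
    by (intro tendsto_infdist r(3))
  then have "infdist z K = e" by (simp add: s(3) LIMSEQ_const_iff)
  then have zK: "z \<notin> K" using e(1) by auto
  have long: "eventually (\<lambda>n. T \<le> s (r n)) sequentially" for T
  proof (rule ccontr)
    assume *: "\<not> ?thesis"
    obtain r2 :: "nat \<Rightarrow> nat" where r2: "strict_mono r2" "\<And>n. \<not> T \<le> s (r (r2 n))"
      using not_eventually_sequentiallyD[OF *] by blast
    have "s (r (r2 n)) \<in> {0..T}" for n using s(1) r2(2)[of n] by (auto simp: less_imp_le)
    from compact_subseq[OF compact_Icc this]
    obtain r3 a where r3: "strict_mono r3" "a \<in> {0..T}" "(\<lambda>n. s (r (r2 (r3 n)))) \<longlonglongrightarrow> a" .
    have "strict_mono (\<lambda>n. r (r2 (r3 n)))"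
      by (rule strict_mono_compose[OF r(1) strict_mono_compose[OF r2(1) r3(1)]])
    from limit_in_compact[OF K(1,2) subseq_LIMSEQ[OF x(1) this]]
    obtain r4 k where r4: "strict_mono r4" "k \<in> K" "(\<lambda>n. x (r (r2 (r3 (r4 n))))) \<longlonglongrightarrow> k" .
    from flow_tendsto[OF F subseq_LIMSEQ[OF r3(3) r4(1)] r4(3)]
    have lim1: "(\<lambda>n. \<theta> (s (r (r2 (r3 (r4 n))))) (x (r (r2 (r3 (r4 n)))))) \<longlonglongrightarrow> \<theta> a k" .
    have "strict_mono (\<lambda>n. r2 (r3 (r4 n)))"
      by (rule strict_mono_compose[OF r2(1) strict_mono_compose[OF r3(1) r4(1)]])
    from LIMSEQ_unique[OF subseq_LIMSEQ[OF r(3) this] lim1] have "z = \<theta> a k" .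
    then show False using zK invariantD[OF F K(3) r4(2)] by simp
  qed
  have "\<theta> \<tau> z \<in> tube K e" if "\<tau> \<le> 0" for \<tau>
  proof (rule Lim_in_closed_set[OF closed_tube _ _ flow_tendsto[OF F tendsto_const r(3)]])
    show "eventually (\<lambda>n. \<theta> \<tau> (\<theta> (s (r n)) (x (r n))) \<in> tube K e) sequentially"
      using long[of "- \<tau>"]
    proof (rule eventually_mono)
      fix n assume "- \<tau> \<le> s (r n)"
      then show "\<theta> \<tau> (\<theta> (s (r n)) (x (r n))) \<in> tube K e"
        using s(4)[of "\<tau> + s (r n)" "r n"] that by (simp add: flow_add[OF F] tube_def)
    qed
  qed simp
  then have "neg_orbit \<theta> z \<subseteq> tube K e" by (auto simp: neg_orbit_def)
  then show thesis
    using that[of r "\<lambda>n. s (r n)" z] r s(1,2) zK by blast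
qed

text \<open>Instability provides points arbitrarily near \<open>K\<close> that later leave a fixed neighbourhood.\<close>

lemma unstable_exit:
  fixes K :: "'a::metric_space set"
  assumes F: "flow \<theta>" and K: "compact K" "K \<noteq> {}" "invariant \<theta> K"
    and e: "e > 0" "compact (tube K e)" and un: "\<not> stable \<theta> K"
  obtains z where "z \<notin> K" "neg_orbit \<theta> z \<subseteq> tube K e"
proof -
  obtain U where U: "nbhd U K" "\<And>V. nbhd V K \<Longrightarrow> \<not> (\<Union>x\<in>V. pos_orbit \<theta> x) \<subseteq> U"
    using un by (auto simp: stable_def)
  obtain e0 where e0: "e0 > 0" "tube K e0 \<subseteq> U" using nbhd_subset_tube[OF K(1,2) U(1)] .
  define d where "d = min e e0"
  have d: "d > 0" "d \<le> e" "d \<le> e0" using e e0 by (auto simp: d_def)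
  have "\<exists>x t. x \<in> tube K (min (d / 2) (inverse (real (Suc n)))) \<and> 0 \<le> t \<and> \<theta> t x \<notin> U" for n
    using U(2)[OF nbhd_tube, of "min (d / 2) (inverse (real (Suc n)))"] d(1)
    by (fastforce simp: pos_orbit_def)
  then obtain x t where xt: "\<And>n. x n \<in> tube K (min (d / 2) (inverse (real (Suc n))))"
      "\<And>n. 0 \<le> t n" "\<And>n. \<theta> (t n) (x n) \<notin> U" by metis
  have 1: "(\<lambda>n. infdist (x n) K) \<longlonglongrightarrow> 0"
    by (rule infdist_tendsto_0I) (use xt(1) in \<open>auto simp: tube_def\<close>)
  have 2: "infdist (x n) K < d" for n
    using xt(1)[of n] d(1) by (auto simp: tube_def)
  have 3: "d \<le> infdist (\<theta> (t n) (x n)) K" for n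
  proof -
    have "\<theta> (t n) (x n) \<notin> tube K e0" using xt(3) e0(2) by blast
    then show ?thesis using d(3) by (simp add: tube_def)
  qed
  obtain z where "z \<notin> K" "neg_orbit \<theta> z \<subseteq> tube K d"
    by (rule exit_point[OF F K d(1) compact_tube_mono[OF e(2) d(2)] 1 2 xt(2) 3]) (rule that)
  then show thesis using that tube_mono[OF d(2)] by blast
qed

text \<open>An orbit whose \<open>\<alpha>\<close>-limit set meets \<open>K\<close> without lying in \<open>K\<close> makes infinitely many excursions from
  \<open>K\<close>, further and further back in time; the exit points accumulate inside the limit set.\<close>

lemma alpha_lim_exit:
  fixes K :: "'a::metric_space set"
  assumes F: "flow \<theta>" and K: "compact K" "K \<noteq> {}" "invariant \<theta> K"
    and e: "e > 0" "compact (tube K e)"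
    and x: "alpha_lim \<theta> x \<inter> K \<noteq> {}" "\<not> alpha_lim \<theta> x \<subseteq> K"
  obtains z where "z \<in> alpha_lim \<theta> x" "z \<notin> K" "neg_orbit \<theta> z \<subseteq> tube K e"
proof -
  obtain p q where p: "p \<in> alpha_lim \<theta> x" "p \<notin> K" and q: "q \<in> alpha_lim \<theta> x" "q \<in> K"
    using x by blast
  define c where "c = infdist p K / 2"
  have c: "c > 0"
    using infdist_pos_not_in_closed[OF compact_imp_closed[OF K(1)] K(2) p(2)] by (simp add: c_def)
  define d where "d = min e c"
  have d: "d > 0" "d \<le> e" "d \<le> c" using e c by (auto simp: d_def)
  have "\<exists>a b. a \<le> b \<and> b \<le> - real n \<and> d \<le> infdist (\<theta> b x) K \<and>
      infdist (\<theta> a x) K < min d (inverse (real (Suc n)))" for n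
  proof -
    obtain b where b: "b \<le> - real n" "dist (\<theta> b x) p < c"
      using p(1) c unfolding alpha_lim_iff by blast
    have "infdist p K \<le> infdist (\<theta> b x) K + dist p (\<theta> b x)" by (rule infdist_triangle)
    then have "d \<le> infdist (\<theta> b x) K" using b(2) d(3) by (simp add: c_def dist_commute)
    moreover obtain a where a: "a \<le> b" "dist (\<theta> a x) q < min d (inverse (real (Suc n)))"
      using q(1) d(1) unfolding alpha_lim_iff
      by (metis min_less_iff_conj inverse_positive_iff_positive of_nat_0_less_iff zero_less_Suc)
    moreover have "infdist (\<theta> a x) K \<le> dist (\<theta> a x) q" using q(2) by (rule infdist_le)
    ultimately show ?thesis using b(1) by (meson le_less_trans)
  qed
  then obtain a b where ab: "\<And>n. a n \<le> b n" "\<And>n. b n \<le> - real n"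
      "\<And>n. d \<le> infdist (\<theta> (b n) x) K"
      "\<And>n. infdist (\<theta> (a n) x) K < min d (inverse (real (Suc n)))" by metis
  have 1: "(\<lambda>n. infdist (\<theta> (a n) x) K) \<longlonglongrightarrow> 0"
    by (rule infdist_tendsto_0I) (use ab(4) in \<open>auto simp: tube_def less_imp_le\<close>)
  have 2: "infdist (\<theta> (a n) x) K < d" for n using ab(4)[of n] by simp
  have 3: "0 \<le> b n - a n" "d \<le> infdist (\<theta> (b n - a n) (\<theta> (a n) x)) K" for n
    using ab(1,3)[of n] by (auto simp: flow_add[OF F])
  obtain r :: "nat \<Rightarrow> nat" and s z
    where r: "strict_mono r" and s: "\<And>n. 0 \<le> s n" "\<And>n. s n \<le> b (r n) - a (r n)"
      and z: "(\<lambda>n. \<theta> (s n) (\<theta> (a (r n)) x)) \<longlonglongrightarrow> z" "z \<notin> K" "neg_orbit \<theta> z \<subseteq> tube K d"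
    by (rule exit_point[OF F K d(1) compact_tube_mono[OF e(2) d(2)] 1 2 3]) (rule that)
  have "s n + a (r n) \<le> - real n" for n
    using s(2)[of n] ab(2)[of "r n"] seq_suble[OF r, of n] by linarith
  then have "filterlim (\<lambda>n. - (s n + a (r n))) at_top sequentially"
    by (intro filterlim_at_top_mono[OF filterlim_real_sequentially] always_eventually allI)
      (metis le_minus_iff)
  then have "filterlim (\<lambda>n. s n + a (r n)) at_bot sequentially"
    by (simp add: filterlim_uminus_at_bot)
  moreover have "(\<lambda>n. \<theta> (s n + a (r n)) x) \<longlonglongrightarrow> z" using z(1) by (simp add: flow_add[OF F])
  ultimately have "z \<in> alpha_lim \<theta> x" unfolding alpha_lim_def by blast
  then show thesis using that z tube_mono[OF d(2)] by blast
qed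


section \<open>Shells and trees\<close>

text \<open>The exit point \<open>z\<close> only has a negative half orbit near \<open>K\<close>; passing to a point of its own
  \<open>\<alpha>\<close>-limit set makes the whole orbit stay near \<open>K\<close>.\<close>

lemma alpha_lim_descent:
  fixes K :: "'a::metric_space set"
  assumes F: "flow \<theta>" and K: "compact K" "K \<noteq> {}" "invariant \<theta> K"
    and e: "isolating_radius \<theta> K e"
    and D: "closed D" "invariant \<theta> D" "D \<subseteq> tube K e"
    and a: "\<And>x. x \<in> D - K \<Longrightarrow> \<not> alpha_lim \<theta> x \<subseteq> K"
    and x: "x \<in> D - K" and d: "d > 0"
  obtains w where "w \<in> alpha_lim \<theta> x" "w \<in> D - K" "orbit \<theta> w \<subseteq> tube K d"
proof -
  have e0: "e > 0" "compact (tube K e)" using e by (auto simp: isolating_radius_def)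
  have inD: "alpha_lim \<theta> y \<subseteq> D" "alpha_lim \<theta> y \<noteq> {}" if "y \<in> D" for y
  proof -
    have n: "neg_orbit \<theta> y \<subseteq> D"
      using half_orbits_subset_orbit(2)[of \<theta> y] orbit_subset[OF F D(2) that] by blast
    then show "alpha_lim \<theta> y \<subseteq> D" by (rule alpha_lim_subset_neg_orbit[OF D(1)])
    show "alpha_lim \<theta> y \<noteq> {}"
      by (rule alpha_lim_nonempty_neg_orbit[OF e0(2)]) (use n D(3) in blast)
  qed
  have "alpha_lim \<theta> x \<inter> K \<noteq> {}"
    by (rule isolating_meets[OF F e closed_alpha_lim _ invariant_alpha_lim[OF F]])
      (use inD[of x] x D(3) in blast)+
  moreover have "compact (tube K (min d e))" using compact_tube_mono[OF e0(2)] by simp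
  moreover have "min d e > 0" using d e0 by simp
  ultimately obtain z where z: "z \<in> alpha_lim \<theta> x" "z \<notin> K" "neg_orbit \<theta> z \<subseteq> tube K (min d e)"
    using alpha_lim_exit[OF F K _ _ _ a[OF x]] by blast
  have "z \<in> D - K" using z inD x by blast
  then obtain w where w: "w \<in> alpha_lim \<theta> z" "w \<notin> K" using a by blast
  have "alpha_lim \<theta> z \<subseteq> alpha_lim \<theta> x"
    by (rule alpha_lim_subset_neg_orbit[OF closed_alpha_lim])
      (rule subset_trans[OF half_orbits_subset_orbit(2)
          orbit_subset[OF F invariant_alpha_lim[OF F] z(1)]])
  moreover have "orbit \<theta> w \<subseteq> tube K (min d e)"
    using orbit_subset[OF F invariant_alpha_lim[OF F] w(1)]
      alpha_lim_subset_neg_orbit[OF closed_tube z(3)] by blast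
  ultimately show thesis
    using that[of w] w inD(1)[of z] \<open>z \<in> D - K\<close> tube_mono[of "min d e" d K] by auto
qed

lemma excess_le: "Y \<noteq> {} \<Longrightarrow> Y \<subseteq> tube X d \<Longrightarrow> excess Y X \<le> d"
  unfolding excess_def by (intro cSUP_least) (auto simp: tube_def)

lemma excess_closure_le:
  assumes "Y \<noteq> {}" "Y \<subseteq> tube X d"
  shows "0 \<le> excess (closure Y) X" "excess (closure Y) X \<le> d"
proof -
  have sub: "closure Y \<subseteq> tube X d" using assms(2) closed_tube closure_minimal by blast
  have ne: "closure Y \<noteq> {}" using assms(1) by simp
  show "excess (closure Y) X \<le> d" by (rule excess_le[OF ne sub])
  obtain y where y: "y \<in> closure Y" using ne unfolding ex_in_conv[symmetric] ..
  have "bdd_above ((\<lambda>y. infdist y X) ` closure Y)"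
    using sub by (intro bdd_aboveI[of _ d]) (auto simp: tube_def)
  then have "infdist y X \<le> excess (closure Y) X"
    unfolding excess_def using y by (intro cSUP_upper)
  then show "0 \<le> excess (closure Y) X" using infdist_nonneg[of y X] by linarith
qed

lemma limit_sets_subset:
  assumes F: "flow \<theta>" and "closed C" "orbit \<theta> x \<subseteq> C"
  shows "alpha_lim \<theta> x \<subseteq> C" "omega_lim \<theta> x \<subseteq> C"
  using assms half_orbits_subset_orbit[of \<theta> x]
  by (intro alpha_lim_subset_neg_orbit omega_lim_subset_pos_orbit; blast)+

text \<open>Limit sets inherit the distance bound, so a farther orbit cannot lie in the limit sets of a closer
  one.\<close>

lemma not_succ_if_closer:
  assumes F: "flow \<theta>" and w: "orbit \<theta> w \<subseteq> tube K (infdist x K / 2)" and x: "infdist x K > 0"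
  shows "\<not> succ \<theta> (orbit \<theta> w) (orbit \<theta> x)"
proof
  assume "succ \<theta> (orbit \<theta> w) (orbit \<theta> x)"
  then have "x \<in> alpha_lim \<theta> w \<union> omega_lim \<theta> w"
    using orbit_self[OF F] by (auto simp: succ_def alpha_orb_orbit[OF F] omega_orb_orbit[OF F])
  then have "x \<in> tube K (infdist x K / 2)"
    using limit_sets_subset[OF F closed_tube w] by blast
  then show False using x by (simp add: tube_def)
qed

text \<open>The common construction of shells and trees: dependent choice along all words over an alphabet of
  successor relations \<open>S c\<close>. Words are extended at the front, as recursion on lists does it.\<close>

lemma converging_descent:
  fixes S :: "'c \<Rightarrow> 'a::metric_space \<Rightarrow> 'a set"
  assumes F: "flow \<theta>" and K: "compact K" "K \<noteq> {}" and A: "A \<inter> K = {}" "A \<noteq> {}"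
    and pick: "\<And>c x d. x \<in> A \<Longrightarrow> d > 0 \<Longrightarrow> \<exists>w. w \<in> A \<inter> S c x \<and> orbit \<theta> w \<subseteq> tube K d"
  obtains q where "\<And>w. q w \<in> A" "\<And>c w. q (c # w) \<in> S c (q w)"
    "\<And>c w. \<not> succ \<theta> (orbit \<theta> (q (c # w))) (orbit \<theta> (q w))"
    "\<And>c w. orbit \<theta> (q (c # w)) \<subseteq> tube K (inverse (real (Suc (length w))))"
proof -
  define f where "f c x d = (SOME w. w \<in> A \<inter> S c x \<and> orbit \<theta> w \<subseteq> tube K d)" for c x d
  have f: "f c x d \<in> A \<inter> S c x \<and> orbit \<theta> (f c x d) \<subseteq> tube K d" if "x \<in> A" "d > 0" for c x d
    unfolding f_def by (rule someI_ex[OF pick[OF that]])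
  obtain x0 where x0: "x0 \<in> A" using A(2) by blast
  \<comment> \<open>Half the distance excludes the predecessor from the limit sets of the successor, and the second
    bound forces convergence to \<open>K\<close>.\<close>
  define rad where "rad x n = min (infdist x K / 2) (inverse (real (Suc n)))" for x and n :: nat
  define q where "q = rec_list x0 (\<lambda>c w x. f c x (rad x (length w)))"
  have q_Nil: "q [] = x0" and q_Cons: "q (c # w) = f c (q w) (rad (q w) (length w))" for c w
    by (simp_all add: q_def)
  have pos: "infdist x K > 0" if "x \<in> A" for x
    using infdist_pos_not_in_closed[OF compact_imp_closed[OF K(1)] K(2)] that A(1) by blast
  have rad: "rad x n > 0" if "x \<in> A" for x n
    using pos[OF that] by (simp add: rad_def)
  have q: "q w \<in> A" for w
    by (induction w) (use x0 f rad in \<open>auto simp: q_Nil q_Cons\<close>)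
  have step: "q (c # w) \<in> S c (q w)" "orbit \<theta> (q (c # w)) \<subseteq> tube K (rad (q w) (length w))" for c w
    using f[OF q rad[OF q]] by (auto simp: q_Cons)
  show thesis
  proof (rule that[OF q step(1)])
    fix c w
    have "orbit \<theta> (q (c # w)) \<subseteq> tube K (infdist (q w) K / 2)"
      by (rule subset_trans[OF step(2) tube_mono]) (simp add: rad_def)
    then show "\<not> succ \<theta> (orbit \<theta> (q (c # w))) (orbit \<theta> (q w))"
      by (rule not_succ_if_closer[OF F _ pos[OF q]])
    show "orbit \<theta> (q (c # w)) \<subseteq> tube K (inverse (real (Suc (length w))))"
      by (rule subset_trans[OF step(2) tube_mono]) (simp add: rad_def)
  qed
qed

text \<open>As all limit sets of orbits in \<open>D - K\<close> leave \<open>K\<close>, the descent is possible through \<open>\<alpha>\<close> and through \<open>\<omega>\<close>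
  at every step. A word of the tree has a fixed first digit, which is dropped, and is then reversed.\<close>

lemma tree_exists:
  fixes K :: "'a::metric_space set"
  assumes F: "flow \<theta>" and K: "compact K" "K \<noteq> {}" "invariant \<theta> K"
    and e: "isolating_radius \<theta> K e"
    and D: "closed D" "invariant \<theta> D" "D \<subseteq> tube K e" "\<not> D \<subseteq> K"
    and a: "\<And>x. x \<in> D - K \<Longrightarrow> \<not> alpha_lim \<theta> x \<subseteq> K"
    and o: "\<And>x. x \<in> D - K \<Longrightarrow> \<not> omega_lim \<theta> x \<subseteq> K"
  shows "\<exists>\<Theta> \<psi>. is_tree \<theta> K \<Theta> \<psi>"
proof -
  define lim where "lim c x = (if c then omega_lim \<theta> x else alpha_lim \<theta> x)" for c x
  have pick: "\<exists>w. w \<in> (D - K) \<inter> lim c x \<and> orbit \<theta> w \<subseteq> tube K d"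
    if x: "x \<in> D - K" "d > 0" for c x d
  proof (cases c)
    case True
    obtain w where "w \<in> omega_lim \<theta> x" "w \<in> D - K" "orbit \<theta> w \<subseteq> tube K d"
      by (rule alpha_lim_descent[OF flow_time_reversed[OF F], of K e D x d,
            unfolded alpha_lim_time_reversed orbit_time_reversed invariant_time_reversed
              isolating_radius_time_reversed, OF K e D(1-3) o x])
    then show ?thesis using True by (auto simp: lim_def)
  next
    case False
    obtain w where "w \<in> alpha_lim \<theta> x" "w \<in> D - K" "orbit \<theta> w \<subseteq> tube K d"
      using alpha_lim_descent[OF F K e D(1-3) a x] .
    then show ?thesis using False by (auto simp: lim_def)
  qed
  have "(D - K) \<inter> K = {}" "D - K \<noteq> {}" using D(4) by blast+
  then obtain q where q: "\<And>w. q w \<in> D - K" and step: "\<And>c w. q (c # w) \<in> lim c (q w)"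
    and not_back: "\<And>c w. \<not> succ \<theta> (orbit \<theta> (q (c # w))) (orbit \<theta> (q w))"
    and small: "\<And>c w. orbit \<theta> (q (c # w)) \<subseteq> tube K (inverse (real (Suc (length w))))"
    by (rule converging_descent[where S = lim, OF F K(1,2) _ _ pick]) (assumption | rule that)+
  define \<psi> where "\<psi> b = orbit \<theta> (q (rev (tl b)))" for b
  have \<psi>_snoc: "\<psi> (b @ [c]) = orbit \<theta> (q (c # rev (tl b)))" if "b \<in> words" for b c
    using that by (simp add: \<psi>_def words_def)
  have "is_tree \<theta> K (\<psi> ` words) \<psi>"
    unfolding is_tree_def
  proof (intro conjI ballI allI impI)
    have "orbit \<theta> (q w) \<subseteq> tube K e - K" for w
      using orbit_subset[OF F D(2)] orbit_disjoint[OF F K(3)] q[of w] D(3) by blast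
    then show "\<exists>U. compact U \<and> nbhd U K \<and> \<psi> ` words \<subseteq> Orb \<theta> (U - K)"
      using e nbhd_tube[of e K] unfolding isolating_radius_def Orb_def \<psi>_def by blast
    fix b c assume b: "b \<in> words"
    have "orbit \<theta> (q (c # rev (tl b))) \<subseteq> lim c (q (rev (tl b)))"
      using step invariant_alpha_lim[OF F] invariant_omega_lim[OF F]
      by (intro orbit_subset[OF F]) (auto simp: lim_def)
    then show "succ_by \<theta> c (\<psi> b) (\<psi> (b @ [c]))"
      unfolding succ_by_def \<psi>_snoc[OF b]
      by (cases c) (simp_all add: \<psi>_def lim_def alpha_orb_orbit[OF F] omega_orb_orbit[OF F])
    show "\<not> succ \<theta> (\<psi> (b @ [c])) (\<psi> b)"
      unfolding \<psi>_snoc[OF b] unfolding \<psi>_def by (rule not_back)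
  next
    fix v :: "nat \<Rightarrow> bool" assume v: "v 0 = False"
    let ?E = "\<lambda>n. excess (closure (\<psi> (map v [0..<Suc n]))) K"
    have bound: "0 \<le> ?E (Suc n)" "?E (Suc n) \<le> inverse (real (Suc n))" for n
    proof -
      define b where "b = map v [0..<Suc n]"
      have b: "b \<in> words" using v by (simp add: b_def words_def hd_map del: upt_Suc)
      have "map v [0..<Suc (Suc n)] = b @ [v (Suc n)]" by (simp add: b_def)
      then have "\<psi> (map v [0..<Suc (Suc n)]) = orbit \<theta> (q (v (Suc n) # rev (tl b)))"
        using \<psi>_snoc[OF b] by (simp only:)
      moreover have "orbit \<theta> (q (v (Suc n) # rev (tl b))) \<subseteq> tube K (inverse (real (Suc n)))"
        using small[of "v (Suc n)" "rev (tl b)"] by (simp add: b_def)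
      moreover have "orbit \<theta> (q (v (Suc n) # rev (tl b))) \<noteq> {}" using orbit_self[OF F] by blast
      ultimately show "0 \<le> ?E (Suc n)" "?E (Suc n) \<le> inverse (real (Suc n))"
        using excess_closure_le by metis+
    qed
    show "?E \<longlonglongrightarrow> 0" by (rule LIMSEQ_imp_Suc[OF null_le[OF LIMSEQ_inverse_real_of_nat bound]])
  qed simp
  then show ?thesis by blast
qed

text \<open>Either every orbit near \<open>K\<close> has, in its \<open>\<alpha>\<close>-limit set, orbits arbitrarily near
  \<open>K\<close> that are asymptotic to \<open>K\<close> in positive time, and then a shell is built step by step; or some
  piece of an \<open>\<alpha>\<close>-limit set contains no orbit asymptotic to \<open>K\<close> in either direction.\<close>

lemma alpha_shell_or_core:
  fixes K :: "'a::metric_space set"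
  assumes F: "flow \<theta>" and K: "compact K" "K \<noteq> {}" "invariant \<theta> K"
    and e: "isolating_radius \<theta> K e" and un: "\<not> stable \<theta> K"
    and a: "\<And>x. x \<notin> K \<Longrightarrow> alpha_lim \<theta> x \<noteq> {} \<Longrightarrow> \<not> alpha_lim \<theta> x \<subseteq> K"
  shows "(\<exists>\<gamma>. is_alpha_shell \<theta> K \<gamma>) \<or>
    (\<exists>D. closed D \<and> invariant \<theta> D \<and> D \<subseteq> tube K e \<and> \<not> D \<subseteq> K \<and>
      (\<forall>x\<in>D - K. \<not> alpha_lim \<theta> x \<subseteq> K \<and> \<not> omega_lim \<theta> x \<subseteq> K))"
proof -
  have e0: "e > 0" "compact (tube K e)" using e by (auto simp: isolating_radius_def)
  define D where "D = {x. orbit \<theta> x \<subseteq> tube K e}"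
  have D: "closed D" "invariant \<theta> D" "D \<subseteq> tube K e"
    using closed_core[OF F closed_tube] invariant_core[OF F] orbit_self[OF F]
    by (auto simp: D_def)
  have aD: "\<not> alpha_lim \<theta> x \<subseteq> K" if "x \<in> D - K" for x
    using a[of x] that alpha_lim_nonempty_neg_orbit[OF e0(2), of \<theta> x]
      half_orbits_subset_orbit(2)[of \<theta> x] by (auto simp: D_def)
  note descent = alpha_lim_descent[OF F K e D aD]
  obtain z where z: "z \<notin> K" "neg_orbit \<theta> z \<subseteq> tube K e"
    using unstable_exit[OF F K e0 un] .
  have "\<not> alpha_lim \<theta> z \<subseteq> K"
    by (rule a[OF z(1) alpha_lim_nonempty_neg_orbit[OF e0(2) z(2)]])
  then obtain y where y: "y \<in> alpha_lim \<theta> z" "y \<notin> K" by blast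
  have "orbit \<theta> y \<subseteq> tube K e"
    using orbit_subset[OF F invariant_alpha_lim[OF F] y(1)]
      alpha_lim_subset_neg_orbit[OF closed_tube z(2)] by blast
  then have yD: "y \<in> D - K" using y by (simp add: D_def)
  show ?thesis
  proof (cases "\<forall>x\<in>D - K. \<forall>d>0. \<exists>w\<in>alpha_lim \<theta> x - K. orbit \<theta> w \<subseteq> tube K d \<and> omega_lim \<theta> w \<subseteq> K")
    case True
    \<comment> \<open>A shell is a descent along the only infinite word over a one-letter alphabet.\<close>
    define A where "A = {w \<in> D - K. omega_lim \<theta> w \<subseteq> K}"
    have pick: "\<exists>w. w \<in> A \<inter> alpha_lim \<theta> x \<and> orbit \<theta> w \<subseteq> tube K d"
      if x: "x \<in> D - K" and d: "d > 0" for x d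
    proof -
      obtain w where w: "w \<in> alpha_lim \<theta> x - K" "orbit \<theta> w \<subseteq> tube K d" "omega_lim \<theta> w \<subseteq> K"
        using True x d by blast
      have "orbit \<theta> x \<subseteq> D" by (rule orbit_subset[OF F D(2)]) (use x in blast)
      then have "w \<in> D" using limit_sets_subset(1)[OF F D(1)] w(1) by blast
      then show ?thesis using w by (auto simp: A_def)
    qed
    have AD: "A \<inter> K = {}" "A \<noteq> {}" "A \<subseteq> D - K"
      using pick[OF yD zero_less_one] by (auto simp: A_def)
    have pickA: "\<exists>w. w \<in> A \<inter> alpha_lim \<theta> x \<and> orbit \<theta> w \<subseteq> tube K d" if "x \<in> A" "d > 0" for x d
      using pick AD(3) that by blast
    obtain p :: "unit list \<Rightarrow> 'a" where p: "\<And>w. p w \<in> A" and p_step: "\<And>c w. p (c # w) \<in> alpha_lim \<theta> (p w)"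
      and p_back: "\<And>c w. \<not> succ \<theta> (orbit \<theta> (p (c # w))) (orbit \<theta> (p w))"
      and p_small: "\<And>c w. orbit \<theta> (p (c # w)) \<subseteq> tube K (inverse (real (Suc (length w))))"
      by (rule converging_descent[where S = "\<lambda>c::unit. alpha_lim \<theta>", OF F K(1,2) AD(1,2) pickA])
        (assumption, assumption, rule that)
    define q where "q n = p (replicate n ())" for n
    have q: "q n \<in> D - K" "omega_lim \<theta> (q n) \<subseteq> K" for n using p by (auto simp: q_def A_def)
    have step: "q (Suc n) \<in> alpha_lim \<theta> (q n)" "\<not> succ \<theta> (orbit \<theta> (q (Suc n))) (orbit \<theta> (q n))"
      "orbit \<theta> (q (Suc n)) \<subseteq> tube K (inverse (real (Suc n)))" for n
      using p_step[of "()" "replicate n ()"] p_back[of "()" "replicate n ()"]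
        p_small[of "()" "replicate n ()"] by (simp_all add: q_def)
    have F': "flow (time_reversed \<theta>)" by (rule flow_time_reversed[OF F])
    have "is_alpha_shell \<theta> K (\<lambda>n. orbit \<theta> (q n))"
      unfolding is_alpha_shell_def is_omega_shell_def
    proof (intro conjI allI)
      have "orbit \<theta> (q n) \<subseteq> tube K e - K" for n
        using orbit_subset[OF F D(2)] orbit_disjoint[OF F K(3)] q(1)[of n] D(3) by blast
      then show "\<exists>U. compact U \<and> nbhd U K \<and> (\<forall>n. orbit \<theta> (q n) \<in> Orb (time_reversed \<theta>) (U - K))"
        using e0 nbhd_tube[of e K] unfolding Orb_def orbit_time_reversed by blast
      show "orbit \<theta> (q n) \<subseteq> neg_basin (time_reversed \<theta>) K" for n
      proof
        fix u assume "u \<in> orbit \<theta> (q n)"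
        then obtain t where t: "u = \<theta> t (q n)" by (auto simp: orbit_def)
        have "pos_orbit \<theta> (q n) \<subseteq> tube K e"
          using half_orbits_subset_orbit(1)[of \<theta> "q n"] q(1)[of n] by (auto simp: D_def)
        then have "omega_lim \<theta> (q n) \<noteq> {}" by (rule omega_lim_nonempty_pos_orbit[OF e0(2)])
        then show "u \<in> neg_basin (time_reversed \<theta>) K"
          using q(2)[of n] by (simp add: pos_basin_def t omega_lim_shift[OF F])
      qed
      show "succ_by (time_reversed \<theta>) True (orbit \<theta> (q n)) (orbit \<theta> (q (Suc n)))" for n
        using orbit_subset[OF F invariant_alpha_lim[OF F] step(1)[of n]]
          omega_orb_orbit[OF F', of "q n"] by (simp add: succ_by_def)
      show "\<not> succ (time_reversed \<theta>) (orbit \<theta> (q (Suc n))) (orbit \<theta> (q n))" for n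
        using step(2)[of n] unfolding succ_def omega_orb_def alpha_orb_def by (simp add: Un_commute)
      have "orbit \<theta> (q (Suc n)) \<noteq> {}" for n using orbit_self[OF F] by blast
      then show "(\<lambda>n. excess (closure (orbit \<theta> (q n))) K) \<longlonglongrightarrow> 0"
        using step(3)
        by (intro LIMSEQ_imp_Suc[OF null_le[OF LIMSEQ_inverse_real_of_nat]] excess_closure_le)
    qed
    then show ?thesis by blast
  next
    case False
    then obtain x d where x: "x \<in> D - K" "d > 0"
      "\<And>w. w \<in> alpha_lim \<theta> x - K \<Longrightarrow> orbit \<theta> w \<subseteq> tube K d \<Longrightarrow> \<not> omega_lim \<theta> w \<subseteq> K" by blast
    \<comment> \<open>Failure of the choice at \<open>x\<close> and \<open>d\<close> makes this piece of the limit set free of orbits asymptotic to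
      \<open>K\<close>.\<close>
    define C where "C = alpha_lim \<theta> x \<inter> {w. orbit \<theta> w \<subseteq> tube K d}"
    have "orbit \<theta> x \<subseteq> D" by (rule orbit_subset[OF F D(2)]) (use x in blast)
    then have CD: "C \<subseteq> D" using limit_sets_subset(1)[OF F D(1)] by (auto simp: C_def)
    have "closed C"
      unfolding C_def by (intro closed_Int closed_alpha_lim closed_core[OF F closed_tube])
    moreover have "invariant \<theta> C"
      using invariant_alpha_lim[OF F, of x] invariant_core[OF F, of "tube K d"]
      unfolding C_def invariant_iff[OF F] by blast
    moreover obtain w where "w \<in> alpha_lim \<theta> x" "w \<in> D - K" "orbit \<theta> w \<subseteq> tube K d"
      using descent[OF _ x(1,2)] by blast
    then have "\<not> C \<subseteq> K" by (auto simp: C_def)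
    moreover have "\<not> alpha_lim \<theta> w \<subseteq> K \<and> \<not> omega_lim \<theta> w \<subseteq> K" if "w \<in> C - K" for w
      using aD[of w] x(3)[of w] that CD by (auto simp: C_def)
    ultimately show ?thesis using CD D(3) by blast
  qed
qed

text \<open>A set that is isolated from minimals and neither an attractor nor a repeller is unstable in both
  time directions. If it is not stagnant, nothing outside it is asymptotic to it in one of the two
  directions, and the dichotomy above applies to the flow or to the reversed flow.\<close>

lemma isolated_conditions:
  fixes K :: "'a::metric_space set"
  assumes M: "locally compact (UNIV :: 'a set)" and F: "flow \<theta>"
    and K: "compact K" "K \<noteq> {}" "invariant \<theta> K" and iso: "isolated_from_minimals \<theta> K"
  shows "\<exists>i\<in>{1..6}. condition \<theta> i K"
proof -
  obtain e where e: "isolating_radius \<theta> K e" using isolating_radius_exists[OF M K(1,2) iso] .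
  have F': "flow (time_reversed \<theta>)" by (rule flow_time_reversed[OF F])
  have tree: "condition \<theta> 6 K"
    if "closed D \<and> invariant \<theta> D \<and> D \<subseteq> tube K e \<and> \<not> D \<subseteq> K \<and>
      (\<forall>x\<in>D - K. \<not> alpha_lim \<theta> x \<subseteq> K \<and> \<not> omega_lim \<theta> x \<subseteq> K)" for D
    using tree_exists[OF F K e, of D] that iso by (simp add: condition_def)
  consider "stable \<theta> K" | "neg_stable \<theta> K" | "stagnant \<theta> K"
    | "\<not> stable \<theta> K" "\<And>x. x \<notin> K \<Longrightarrow> alpha_lim \<theta> x \<noteq> {} \<Longrightarrow> \<not> alpha_lim \<theta> x \<subseteq> K"
    | "\<not> neg_stable \<theta> K" "\<And>x. x \<notin> K \<Longrightarrow> omega_lim \<theta> x \<noteq> {} \<Longrightarrow> \<not> omega_lim \<theta> x \<subseteq> K"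
    unfolding stagnant_def by blast
  then show ?thesis
  proof cases
    case 1
    then have "condition \<theta> 1 K"
      using stable_isolated_imp_attractor[OF F K(1,2) e] by (simp add: condition_def)
    then show ?thesis by force
  next
    case 2
    then have "condition \<theta> 2 K"
      using stable_isolated_imp_attractor[OF F' K(1,2)] e by (simp add: condition_def)
    then show ?thesis by force
  next
    case 3
    then have "condition \<theta> 3 K" using iso by (simp add: condition_def)
    then show ?thesis by force
  next
    case 4
    from alpha_shell_or_core[OF F K e this] have "condition \<theta> 4 K \<or> condition \<theta> 6 K"
      using tree iso by (auto simp: condition_def)
    then show ?thesis by force
  next
    case 5
    have "(\<exists>\<gamma>. is_alpha_shell (time_reversed \<theta>) K \<gamma>) \<or>
      (\<exists>D. closed D \<and> invariant \<theta> D \<and> D \<subseteq> tube K e \<and> \<not> D \<subseteq> K \<and>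
        (\<forall>x\<in>D - K. \<not> omega_lim \<theta> x \<subseteq> K \<and> \<not> alpha_lim \<theta> x \<subseteq> K))"
      using alpha_shell_or_core[OF F' K(1,2), of e] K(3) e 5 by simp
    then have "condition \<theta> 5 K \<or> condition \<theta> 6 K"
    proof
      assume "\<exists>\<gamma>. is_alpha_shell (time_reversed \<theta>) K \<gamma>"
      then show ?thesis using iso by (simp add: condition_def is_alpha_shell_def)
    qed (use tree in blast)
    then show ?thesis by force
  qed
qed


section \<open>Attractors, repellers and the other isolated sets exclude one another\<close>

text \<open>If the backward orbit of \<open>y\<close> came near \<open>K\<close>, stability would keep its forward continuation, hence
  \<open>y\<close> itself, near \<open>K\<close>. An \<open>\<alpha>\<close>-limit point in the basin would bring the backward orbit near \<open>K\<close>.\<close>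

lemma stable_alpha_lim_disjoint:
  assumes F: "flow \<theta>" and K: "compact K" "K \<noteq> {}" and st: "stable \<theta> K" and y: "y \<notin> K"
  shows "alpha_lim \<theta> y \<inter> (K \<union> pos_basin \<theta> K) = {}"
proof -
  obtain e where e: "e > 0" "tube K e \<inter> {y} = {}"
    using tube_avoids_closed[OF K, of "{y}"] y by auto
  obtain V where V: "nbhd V K" "(\<Union>x\<in>V. pos_orbit \<theta> x) \<subseteq> tube K e"
    using st nbhd_tube[OF e(1)] unfolding stable_def by blast
  have iV: "K \<subseteq> interior V" using V(1) by (simp add: nbhd_def)
  have K_free: "z \<notin> K" if z: "z \<in> alpha_lim \<theta> y" for z
  proof
    assume "z \<in> K"
    then have "z \<in> interior V" using iV by blast
    then obtain d where d: "d > 0" "ball z d \<subseteq> interior V"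
      using open_contains_ball open_interior by blast
    obtain t where t: "t \<le> 0" "dist (\<theta> t y) z < d"
      using z d(1) unfolding alpha_lim_iff by blast
    have "\<theta> t y \<in> V"
      using d(2) t(2) interior_subset[of V] by (auto simp: dist_commute subset_eq)
    moreover have "y \<in> pos_orbit \<theta> (\<theta> t y)"
      unfolding pos_orbit_def
      by (auto simp: flow_add[OF F] flow_zero[OF F] t(1) intro!: exI[of _ "- t"])
    ultimately show False using V(2) e(2) by blast
  qed
  have "z \<notin> pos_basin \<theta> K" if z: "z \<in> alpha_lim \<theta> y" for z
  proof
    assume "z \<in> pos_basin \<theta> K"
    then obtain k where "k \<in> omega_lim \<theta> z" "k \<in> K" by (auto simp: pos_basin_def)
    moreover have "omega_lim \<theta> z \<subseteq> alpha_lim \<theta> y"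
      using limit_sets_subset(2)[OF F closed_alpha_lim
          orbit_subset[OF F invariant_alpha_lim[OF F] z]] .
    ultimately show False using K_free by blast
  qed
  then show ?thesis using K_free by blast
qed

text \<open>A minimal set in the basin contains the limit sets of its points and so meets \<open>X\<close>.\<close>

lemma attractor_isolated:
  assumes F: "flow \<theta>" and a: "attractor \<theta> X"
  shows "isolated_from_minimals \<theta> X"
  unfolding isolated_from_minimals_def
proof (intro exI[of _ "pos_basin \<theta> X"] conjI notI; (elim exE conjE)?)
  show "nbhd (pos_basin \<theta> X) X" using a by (simp add: attractor_def)
  fix N assume N: "minimal_set \<theta> N" "N \<subseteq> pos_basin \<theta> X - X"
  then obtain y where y: "y \<in> N" by (auto simp: minimal_set_def)
  have "orbit \<theta> y \<subseteq> N" "closed N"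
    using N(1) orbit_subset[OF F _ y] by (auto simp: minimal_set_def)
  then have "omega_lim \<theta> y \<subseteq> N" using limit_sets_subset(2)[OF F] by blast
  then show False using N(2) y unfolding pos_basin_def by blast
qed

lemma condition_isolated:
  assumes F: "flow \<theta>" and i: "condition \<theta> i X"
  shows "isolated_from_minimals \<theta> X"
  using i attractor_isolated[OF F, of X] attractor_isolated[OF flow_time_reversed[OF F], of X]
  by (auto simp: condition_def)

lemma bdd_above_infdist: "compact Y \<Longrightarrow> bdd_above ((\<lambda>y. infdist y X) ` Y)"
  by (intro bounded_imp_bdd_above compact_imp_bounded compact_continuous_image
      continuous_on_infdist continuous_on_id)

lemma subset_tube_excess:
  assumes "compact Y"
  shows "Y \<subseteq> tube X (excess Y X)"
  unfolding tube_def excess_def using cSUP_upper[OF _ bdd_above_infdist[OF assms]] by blast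

lemma excess_null_eventually:
  fixes \<gamma> :: "nat \<Rightarrow> 'a::metric_space set"
  assumes "(\<lambda>n. excess (closure (\<gamma> n)) X) \<longlonglongrightarrow> 0" "compact U" "\<And>n. \<gamma> n \<subseteq> U"
    and X: "compact X" "X \<noteq> {}" "nbhd V X"
  shows "eventually (\<lambda>n. \<gamma> n \<subseteq> V) sequentially"
proof -
  obtain e where e: "e > 0" "tube X e \<subseteq> V" using nbhd_subset_tube[OF X] .
  have cpt: "compact (closure (\<gamma> n))" for n
    using assms(2,3) by (metis closed_closure closure_minimal compact_Int_closed compact_imp_closed
        inf.absorb_iff2)
  have "eventually (\<lambda>n. excess (closure (\<gamma> n)) X < e) sequentially"
    using order_tendstoD(2)[OF assms(1) e(1)] .
  then show ?thesis
  proof (rule eventually_mono)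
    fix n assume "excess (closure (\<gamma> n)) X < e"
    then have "closure (\<gamma> n) \<subseteq> tube X e"
      using subset_tube_excess[OF cpt, of n X] tube_mono[of "excess (closure (\<gamma> n)) X" e X] by auto
    then show "\<gamma> n \<subseteq> V" using e(2) closure_subset[of "\<gamma> n"] by blast
  qed
qed

lemma Orb_outside: "flow \<theta> \<Longrightarrow> \<gamma> \<in> Orb \<theta> (U - K) \<Longrightarrow> \<gamma> \<subseteq> U \<and> (\<exists>x. \<gamma> = orbit \<theta> x \<and> x \<notin> K)"
  using orbit_self[of \<theta>] by (fastforce simp: Orb_def)

text \<open>The orbits of such a sequence eventually lie in the basin, where an \<open>\<alpha>\<close>-limit set of a point outside
  an attractor has no points. This concerns \<open>\<alpha>\<close>-shells and the constant branches of trees.\<close>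

lemma attractor_no_alpha_sequence:
  assumes F: "flow \<theta>" and K: "compact K" "K \<noteq> {}" and a: "attractor \<theta> K"
    and U: "compact U" "\<And>n. \<gamma> n \<in> Orb \<theta> (U - K)"
    and succ: "\<And>n. \<gamma> (Suc n) \<subseteq> alpha_orb \<theta> (\<gamma> n)"
    and lim: "(\<lambda>n. excess (closure (\<gamma> n)) K) \<longlonglongrightarrow> 0"
  shows False
proof -
  have st: "stable \<theta> K" "nbhd (pos_basin \<theta> K) K" using a by (auto simp: attractor_def)
  note orb = Orb_outside[OF F U(2)]
  have "eventually (\<lambda>n. \<gamma> n \<subseteq> pos_basin \<theta> K) sequentially"
    by (rule excess_null_eventually[OF lim U(1) _ K st(2)]) (use orb in blast)
  then obtain n where n: "\<gamma> (Suc n) \<subseteq> pos_basin \<theta> K"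
    by (meson eventually_sequentially le_Suc_eq order_refl)
  obtain x where x: "\<gamma> n = orbit \<theta> x" "x \<notin> K" using orb by blast
  have "\<gamma> (Suc n) \<subseteq> alpha_lim \<theta> x" using succ[of n] by (simp add: x(1) alpha_orb_orbit[OF F])
  moreover have "\<gamma> (Suc n) \<noteq> {}" using orb[of "Suc n"] orbit_self[OF F] by blast
  ultimately show False using n stable_alpha_lim_disjoint[OF F K st(1) x(2)] by blast
qed

lemma attractor_excludes_shells:
  assumes F: "flow \<theta>" and K: "compact K" "K \<noteq> {}" and a: "attractor \<theta> K"
  shows "\<not> stagnant \<theta> K" "\<not> is_alpha_shell \<theta> K \<gamma>" "\<not> is_omega_shell \<theta> K \<gamma>"
proof -
  have st: "stable \<theta> K" using a by (auto simp: attractor_def)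
  note dis = stable_alpha_lim_disjoint[OF F K st]
  show "\<not> stagnant \<theta> K" using dis unfolding stagnant_def by blast
  show "\<not> is_omega_shell \<theta> K \<gamma>"
  proof
    assume "is_omega_shell \<theta> K \<gamma>"
    then obtain U where U: "\<gamma> 0 \<in> Orb \<theta> (U - K)" "\<gamma> 0 \<subseteq> neg_basin \<theta> K"
      unfolding is_omega_shell_def by blast
    obtain x where x: "\<gamma> 0 = orbit \<theta> x" "x \<notin> K" using Orb_outside[OF F U(1)] by blast
    then have "x \<in> neg_basin \<theta> K" using U(2) orbit_self[OF F] by blast
    then show False using dis[OF x(2)] unfolding neg_basin_def by blast
  qed
  show "\<not> is_alpha_shell \<theta> K \<gamma>"
  proof
    assume s: "is_alpha_shell \<theta> K \<gamma>"
    then obtain U where U: "compact U" "\<And>n. \<gamma> n \<in> Orb (time_reversed \<theta>) (U - K)"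
      unfolding is_alpha_shell_def is_omega_shell_def by blast
    have orb: "\<gamma> n \<in> Orb \<theta> (U - K)" for n using U(2)[of n] by (simp add: Orb_def)
    have succ: "\<gamma> (Suc n) \<subseteq> alpha_orb \<theta> (\<gamma> n)" for n
      using s unfolding is_alpha_shell_def is_omega_shell_def succ_by_def omega_orb_def alpha_orb_def
      by simp
    show False
      by (rule attractor_no_alpha_sequence[where \<gamma> = \<gamma>, OF F K a U(1) orb succ])
        (use s in \<open>simp add: is_alpha_shell_def is_omega_shell_def\<close>)
  qed
qed

lemma tree_branch:
  assumes t: "is_tree \<theta> X \<Theta> \<psi>"
  obtains U where "compact U" "\<And>n. \<psi> (False # replicate n c) \<in> Orb \<theta> (U - X)"
    "\<And>n. succ_by \<theta> c (\<psi> (False # replicate n c)) (\<psi> (False # replicate (Suc n) c))"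
    "(\<lambda>n. excess (closure (\<psi> (False # replicate n c))) X) \<longlonglongrightarrow> 0"
proof -
  obtain U where U: "compact U" "\<psi> ` words \<subseteq> Orb \<theta> (U - X)"
    using t by (auto simp: is_tree_def)
  have w: "False # replicate n c \<in> words" for n by (simp add: words_def)
  have "replicate (Suc n) c = replicate n c @ [c]" for n
    by (simp add: replicate_append_same)
  then have s: "succ_by \<theta> c (\<psi> (False # replicate n c)) (\<psi> (False # replicate (Suc n) c))" for n
    using t w[of n] unfolding is_tree_def by (metis append_Cons)
  define v where "v n = (if n = 0 then False else c)" for n :: nat
  have v: "map v [0..<Suc n] = False # replicate n c" for n
    by (rule nth_equalityI) (auto simp: v_def nth_Cons' simp del: upt_Suc)
  have "(\<lambda>n. excess (closure (\<psi> (map v [0..<Suc n]))) X) \<longlonglongrightarrow> 0"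
    using t unfolding is_tree_def by (auto simp: v_def simp del: upt_Suc)
  then show thesis using that U w s unfolding v by blast
qed

lemma attractor_excludes_trees:
  assumes F: "flow \<theta>" and K: "compact K" "K \<noteq> {}" and t: "is_tree \<theta> K \<Theta> \<psi>"
  shows "\<not> attractor \<theta> K" "\<not> repeller \<theta> K"
proof -
  show "\<not> attractor \<theta> K"
  proof
    assume a: "attractor \<theta> K"
    obtain U where U: "compact U" "\<And>n. \<psi> (False # replicate n False) \<in> Orb \<theta> (U - K)"
      "\<And>n. succ_by \<theta> False (\<psi> (False # replicate n False)) (\<psi> (False # replicate (Suc n) False))"
      "(\<lambda>n. excess (closure (\<psi> (False # replicate n False))) K) \<longlonglongrightarrow> 0"
      by (rule tree_branch[OF t, of False]) (rule that)
    show False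
      by (rule attractor_no_alpha_sequence[OF F K a U(1,2) _ U(4)])
        (use U(3) in \<open>simp add: succ_by_def\<close>)
  qed
  show "\<not> repeller \<theta> K"
  proof
    assume a: "repeller \<theta> K"
    obtain U where U: "compact U" "\<And>n. \<psi> (False # replicate n True) \<in> Orb \<theta> (U - K)"
      "\<And>n. succ_by \<theta> True (\<psi> (False # replicate n True)) (\<psi> (False # replicate (Suc n) True))"
      "(\<lambda>n. excess (closure (\<psi> (False # replicate n True))) K) \<longlonglongrightarrow> 0"
      by (rule tree_branch[OF t, of True]) (rule that)
    show False
      by (rule attractor_no_alpha_sequence[OF flow_time_reversed[OF F] K _ U(1) _ _ U(4)])
        (use U(2,3) a in \<open>simp_all add: succ_by_def Orb_def omega_orb_def alpha_orb_def\<close>)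
  qed
qed

text \<open>Points near \<open>K\<close> would be asymptotic to \<open>K\<close> in negative time, which stability allows only for points
  of \<open>K\<close>. So \<open>K\<close> would be open as well as closed.\<close>

lemma attractor_not_repeller:
  fixes K :: "'a::metric_space set"
  assumes con: "connected (UNIV :: 'a set)" and F: "flow \<theta>"
    and K: "compact K" "K \<noteq> {}" "K \<noteq> UNIV" and a: "attractor \<theta> K"
  shows "\<not> repeller \<theta> K"
proof
  assume r: "repeller \<theta> K"
  have st: "stable \<theta> K" and b: "K \<subseteq> interior (neg_basin \<theta> K)"
    using a r by (auto simp: attractor_def repeller_def nbhd_def)
  have "neg_basin \<theta> K \<subseteq> K"
    using stable_alpha_lim_disjoint[OF F K(1,2) st] unfolding neg_basin_def by blast
  then have "K = interior (neg_basin \<theta> K)" using b interior_subset by blast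
  then have "open K" by (metis open_interior)
  then have "K = {} \<or> K = UNIV"
    using con compact_imp_closed[OF K(1)] by (simp add: connected_clopen)
  then show False using K by blast
qed

lemma attractor_excludes_others:
  assumes F: "flow \<theta>" and K: "compact K" "K \<noteq> {}" and j: "j \<in> {3..6}" "condition \<theta> j K"
  shows "\<not> attractor \<theta> K" "\<not> repeller \<theta> K"
proof -
  have F': "flow (time_reversed \<theta>)" by (rule flow_time_reversed[OF F])
  have s: "stagnant (time_reversed \<theta>) K = stagnant \<theta> K"
    unfolding stagnant_def omega_lim_time_reversed alpha_lim_time_reversed by blast
  have "stagnant \<theta> K \<or> (\<exists>\<gamma>. is_alpha_shell \<theta> K \<gamma>) \<or> (\<exists>\<gamma>. is_omega_shell \<theta> K \<gamma>)
      \<or> (\<exists>\<Theta> \<psi>. is_tree \<theta> K \<Theta> \<psi>)"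
    using j by (auto simp: condition_def)
  moreover have "\<not> repeller \<theta> K" if "stagnant \<theta> K \<or> is_alpha_shell \<theta> K \<gamma> \<or> is_omega_shell \<theta> K \<gamma>" for \<gamma>
    using attractor_excludes_shells[OF F' K] that s by (auto simp: is_alpha_shell_def)
  ultimately show "\<not> attractor \<theta> K" "\<not> repeller \<theta> K"
    using attractor_excludes_shells[OF F K] attractor_excludes_trees[OF F K] by blast+
qed


section \<open>The Hausdorff distance\<close>

lemma hdist_le: "X \<noteq> {} \<Longrightarrow> Y \<noteq> {} \<Longrightarrow> X \<subseteq> tube Y d \<Longrightarrow> Y \<subseteq> tube X d \<Longrightarrow> hdist X Y \<le> d"
  by (simp add: hdist_def excess_le)

lemma hdist_commute: "hdist X Y = hdist Y X"
  by (simp add: hdist_def max.commute)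

lemma subset_tube_hdist: "compact Y \<Longrightarrow> hdist X Y \<le> d \<Longrightarrow> Y \<subseteq> tube X d"
  by (rule subset_trans[OF subset_tube_excess tube_mono]) (auto simp: hdist_def)

lemma hdist_nonneg:
  assumes "compact Y" "Y \<noteq> {}"
  shows "0 \<le> hdist X Y"
proof -
  obtain y where "y \<in> Y" using assms(2) by blast
  then have "y \<in> tube X (hdist X Y)" using subset_tube_hdist[OF assms(1) order_refl] by blast
  then show ?thesis using infdist_nonneg[of y X] by (simp add: tube_def)
qed

lemma disjoint_tubes:
  assumes X: "compact X" "X \<noteq> {}" and Y: "compact Y" "Y \<noteq> {}" and "X \<inter> Y = {}"
  obtains e where "e > 0" "tube X e \<inter> tube Y e = {}"
proof -
  obtain e where e: "e > 0" "tube X e \<inter> Y = {}"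
    using tube_avoids_closed[OF X compact_imp_closed[OF Y(1)] assms(5)] .
  have "z \<notin> tube Y (e / 3)" if z: "z \<in> tube X (e / 3)" for z
  proof
    assume "z \<in> tube Y (e / 3)"
    then have "infdist z Y < e / 2" using e(1) by (simp add: tube_def)
    then obtain y where y: "y \<in> Y" "dist z y < e / 2" by (rule infdist_less_witness[OF Y(2)])
    have "infdist y X \<le> infdist z X + dist y z" by (rule infdist_triangle)
    then have "y \<in> tube X e" using z y(2) e(1) by (simp add: tube_def dist_commute)
    then show False using y(1) e(2) by blast
  qed
  then show thesis using that[of "e / 3"] e(1) by auto
qed

text \<open>An invariant set near a minimal set \<open>X\<close> is near all of \<open>X\<close>, as it follows the dense orbits of
  \<open>X\<close>. Hence on minimal sets the Hausdorff topology is generated by the families of the sets that are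
  contained in a tube, and density in itself can be tested with tubes.\<close>

lemma minimal_hdist_small:
  fixes X :: "'a::metric_space set"
  assumes F: "flow \<theta>" and X: "X \<in> CMin \<theta> S" and e: "e > 0"
  obtains d where "d > 0"
    "\<And>Y. Y \<noteq> {} \<Longrightarrow> invariant \<theta> Y \<Longrightarrow> Y \<subseteq> tube X d \<Longrightarrow> hdist X Y < e"
proof -
  note X' = CMinD[OF X]
  have "\<exists>d>0. \<forall>Y. Y \<noteq> {} \<longrightarrow> invariant \<theta> Y \<longrightarrow> Y \<subseteq> tube X d \<longrightarrow> X \<subseteq> tube Y (e / 2)"
  proof (rule ccontr)
    assume neg: "\<not> ?thesis"
    have "\<exists>Y. Y \<noteq> {} \<and> invariant \<theta> Y \<and> Y \<subseteq> tube X (inverse (real (Suc n))) \<and>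
        \<not> X \<subseteq> tube Y (e / 2)" for n
    proof -
      have "inverse (real (Suc n)) > 0" by simp
      then show ?thesis
        using neg[unfolded not_ex, THEN spec, of "inverse (real (Suc n))"]
        by (simp only: simp_thms not_all not_imp)
    qed
    then have "\<forall>n. \<exists>Y. Y \<noteq> {} \<and> invariant \<theta> Y \<and> Y \<subseteq> tube X (inverse (real (Suc n))) \<and>
        \<not> X \<subseteq> tube Y (e / 2)"
      by (rule allI)
    from choice[OF this] obtain Y where Y0: "\<forall>n. Y n \<noteq> {} \<and> invariant \<theta> (Y n) \<and>
        Y n \<subseteq> tube X (inverse (real (Suc n))) \<and> \<not> X \<subseteq> tube (Y n) (e / 2)" ..
    have "\<forall>n. \<exists>y. y \<in> Y n" using Y0 by blast
    from choice[OF this] obtain y where y0: "\<And>n. y n \<in> Y n" by blast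
    have "\<forall>n. \<exists>p. p \<in> X \<and> p \<notin> tube (Y n) (e / 2)" using Y0 by blast
    from choice[OF this] obtain p where p0: "\<And>n. p n \<in> X \<and> p n \<notin> tube (Y n) (e / 2)" by blast
    have Y: "\<And>n. y n \<in> Y n" "\<And>n. invariant \<theta> (Y n)"
        "\<And>n. Y n \<subseteq> tube X (inverse (real (Suc n)))" "\<And>n. p n \<in> X" "\<And>n. p n \<notin> tube (Y n) (e / 2)"
      using Y0 y0 p0 by simp_all
    have "y n \<in> tube X (inverse (real (Suc n)))" for n using Y(1,3) by blast
    from limit_of_tubes[OF X'(2,3) this]
    obtain r y' where r: "strict_mono r" "y' \<in> X" "(\<lambda>n. y (r n)) \<longlonglongrightarrow> y'" .
    have "p (r n) \<in> X" for n by (rule Y(4))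
    from compact_subseq[OF X'(2) this]
    obtain r2 p' where r2: "strict_mono r2" "p' \<in> X" "(\<lambda>n. p (r (r2 n))) \<longlonglongrightarrow> p'" .
    have "p' \<in> closure (orbit \<theta> y')"
      using minimal_closure_orbit[OF F X'(1) r(2)] r2(2) by simp
    then obtain t where t: "dist (\<theta> t y') p' < e / 2"
      using e half_gt_zero unfolding closure_approachable orbit_def by blast
    from tendsto_dist[OF flow_tendsto[OF F tendsto_const subseq_LIMSEQ[OF r(3) r2(1)]] r2(3)]
    have "(\<lambda>n. dist (\<theta> t (y (r (r2 n)))) (p (r (r2 n)))) \<longlonglongrightarrow> dist (\<theta> t y') p'" .
    from order_tendstoD(2)[OF this t] obtain n
      where n: "dist (\<theta> t (y (r (r2 n)))) (p (r (r2 n))) < e / 2"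
      by (auto dest: eventually_happens)
    have "\<theta> t (y (r (r2 n))) \<in> Y (r (r2 n))" by (rule invariantD[OF F Y(2) Y(1)])
    then have "infdist (p (r (r2 n))) (Y (r (r2 n))) \<le> e / 2"
      by (rule infdist_le2) (use n in \<open>simp add: dist_commute\<close>)
    then show False using Y(5)[of "r (r2 n)"] by (simp add: tube_def)
  qed
  then obtain d where d: "d > 0"
    "\<And>Y. Y \<noteq> {} \<Longrightarrow> invariant \<theta> Y \<Longrightarrow> Y \<subseteq> tube X d \<Longrightarrow> X \<subseteq> tube Y (e / 2)" by blast
  have "hdist X Y < e"
    if Y: "Y \<noteq> {}" "invariant \<theta> Y" "Y \<subseteq> tube X (min d (e / 2))" for Y
  proof -
    have "tube X (min d (e / 2)) \<subseteq> tube X d" "tube X (min d (e / 2)) \<subseteq> tube X (e / 2)"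
      by (rule tube_mono, simp)+
    then have "hdist X Y \<le> e / 2"
      using Y by (intro hdist_le X'(3) d(2)) blast+
    then show ?thesis using e by simp
  qed
  then show thesis using that[of "min d (e / 2)"] d(1) e by simp
qed

lemma c_dense_iff_tubes:
  assumes F: "flow \<theta>" and \<CC>: "\<CC> \<subseteq> CMin \<theta> S"
  shows "c_dense_in_itself \<CC> \<longleftrightarrow> (\<forall>X\<in>\<CC>. \<forall>d>0. (UNIV :: real set) \<lesssim> {Y\<in>\<CC>. Y \<subseteq> tube X d})"
proof
  assume c: "c_dense_in_itself \<CC>"
  show "\<forall>X\<in>\<CC>. \<forall>d>0. (UNIV :: real set) \<lesssim> {Y\<in>\<CC>. Y \<subseteq> tube X d}"
  proof (intro ballI allI impI)
    fix X and d :: real assume X: "X \<in> \<CC>" "d > 0"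
    have sub: "{Y \<in> \<CC>. hdist X Y < d} \<subseteq> {Y\<in>\<CC>. Y \<subseteq> tube X d}"
    proof (intro subsetI CollectI; elim CollectE conjE; intro conjI)
      fix Y assume Y: "Y \<in> \<CC>" "hdist X Y < d"
      then have "compact Y" using CMinD(2) \<CC> by blast
      then show "Y \<subseteq> tube X d" using subset_tube_hdist Y(2) less_imp_le by blast
    qed
    have "(UNIV :: real set) \<lesssim> {Y \<in> \<CC>. hdist X Y < d}"
      using c X by (simp add: c_dense_in_itself_def)
    then show "(UNIV :: real set) \<lesssim> {Y\<in>\<CC>. Y \<subseteq> tube X d}"
      by (rule lepoll_trans[OF _ subset_imp_lepoll[OF sub]])
  qed
next
  assume t: "\<forall>X\<in>\<CC>. \<forall>d>0. (UNIV :: real set) \<lesssim> {Y\<in>\<CC>. Y \<subseteq> tube X d}"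
  show "c_dense_in_itself \<CC>"
    unfolding c_dense_in_itself_def
  proof (intro ballI allI impI)
    fix X and e :: real assume X: "X \<in> \<CC>" "e > 0"
    have X': "X \<in> CMin \<theta> S" using X(1) \<CC> by blast
    obtain d where d: "d > 0"
      "\<And>Y. Y \<noteq> {} \<Longrightarrow> invariant \<theta> Y \<Longrightarrow> Y \<subseteq> tube X d \<Longrightarrow> hdist X Y < e"
      by (rule minimal_hdist_small[OF F X' X(2)]) (rule that)
    have sub: "{Y\<in>\<CC>. Y \<subseteq> tube X d} \<subseteq> {Y \<in> \<CC>. hdist X Y < e}"
    proof (intro subsetI CollectI; elim CollectE conjE; intro conjI)
      fix Y assume Y: "Y \<in> \<CC>" "Y \<subseteq> tube X d"
      then have "Y \<in> CMin \<theta> S" using \<CC> by blast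
      then show "hdist X Y < e" using d(2) Y(2) by (simp add: CMinD)
    qed
    have "(UNIV :: real set) \<lesssim> {Y\<in>\<CC>. Y \<subseteq> tube X d}" using t X(1) d(1) by simp
    then show "(UNIV :: real set) \<lesssim> {Y \<in> \<CC>. hdist X Y < e}"
      by (rule lepoll_trans[OF _ subset_imp_lepoll[OF sub]])
  qed
qed


section \<open>Hausdorff limits\<close>

lemma compact_countable_dense:
  fixes C :: "'a::metric_space set"
  assumes C: "compact C" "C \<noteq> {}"
  obtains c :: "nat \<Rightarrow> 'a" where "\<And>k. c k \<in> C" "\<And>x e. x \<in> C \<Longrightarrow> e > 0 \<Longrightarrow> \<exists>k. dist x (c k) < e"
proof -
  have "seq_compact C" using C(1) by (simp add: compact_eq_seq_compact_metric)
  note tb = seq_compact_imp_totally_bounded[OF this, THEN spec, THEN mp]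
  have "inverse (real (Suc n)) > 0" for n by simp
  from tb[OF this] have "\<forall>n. \<exists>A. finite A \<and> A \<subseteq> C \<and> C \<subseteq> (\<Union>a\<in>A. ball a (inverse (real (Suc n))))"
    by (rule allI)
  from choice[OF this] obtain A where A0: "\<forall>n. finite (A n) \<and> A n \<subseteq> C \<and>
      C \<subseteq> (\<Union>a\<in>A n. ball a (inverse (real (Suc n))))" ..
  then have A: "finite (A n)" "A n \<subseteq> C" "C \<subseteq> (\<Union>a\<in>A n. ball a (inverse (real (Suc n))))" for n
    by simp_all
  define B where "B = (\<Union>n. A n)"
  have "countable B" unfolding B_def using A(1) by (auto intro: countable_finite)
  moreover have "B \<noteq> {}" using A(3)[of 0] C(2) unfolding B_def by blast
  ultimately have B: "range (from_nat_into B) = B" by (rule range_from_nat_into[rotated])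
  show thesis
  proof (rule that[of "from_nat_into B"])
    show "from_nat_into B k \<in> C" for k using B A(2) unfolding B_def by blast
    fix x and e :: real assume x: "x \<in> C" "e > 0"
    obtain n where n: "inverse (real (Suc n)) < e" using reals_Archimedean x(2) by blast
    obtain a where a: "a \<in> A n" "x \<in> ball a (inverse (real (Suc n)))" using A(3) x(1) by blast
    have "a \<in> range (from_nat_into B)" unfolding B using a(1) by (auto simp: B_def)
    then obtain k where "a = from_nat_into B k" by blast
    then show "\<exists>k. dist x (from_nat_into B k) < e"
      using a(2) n by (intro exI[of _ k]) (simp add: dist_commute)
  qed
qed

text \<open>Blaschke's selection theorem. The distances of the sets to the points of a countable dense
  set are points of a compact product of intervals. A convergent subsequence there is a Cauchy
  sequence in the Hausdorff metric, and converges to its topological upper limit.\<close>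

lemma hausdorff_subsequence:
  fixes C :: "'a::metric_space set"
  assumes C: "compact C" and X: "\<And>n::nat. compact (X n)" "\<And>n. X n \<noteq> {}" "\<And>n. X n \<subseteq> C"
  obtains r Q where "strict_mono (r :: nat \<Rightarrow> nat)" "compact Q" "Q \<noteq> {}" "h_converges (\<lambda>n. X (r n)) Q"
proof -
  have C_ne: "C \<noteq> {}" using X by blast
  obtain c where c: "\<And>k::nat. c k \<in> C" "\<And>x e. x \<in> C \<Longrightarrow> e > 0 \<Longrightarrow> \<exists>k. dist x (c k) < e"
    by (rule compact_countable_dense[OF C C_ne]) (rule that)
  obtain B where B: "\<And>x y. x \<in> C \<Longrightarrow> y \<in> C \<Longrightarrow> dist x y \<le> B"
    using compact_imp_bounded[OF C] bounded_two_points by metis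
  define f where "f n k = infdist (c k) (X n)" for n k
  have "f n \<in> Pi\<^sub>E UNIV (\<lambda>_. {0..B})" for n
  proof -
    obtain x where x: "x \<in> X n" using X(2) by blast
    have "f n k \<le> B" for k
      using infdist_le[OF x, of "c k"] B[OF c(1)[of k] subsetD[OF X(3) x]] by (simp add: f_def)
    then show ?thesis by (auto simp: f_def infdist_nonneg)
  qed
  moreover have "compact (Pi\<^sub>E (UNIV :: nat set) (\<lambda>_. {0..B}))"
  proof -
    have "compactin (product_topology (\<lambda>_::nat. euclidean :: real topology) UNIV)
        (Pi\<^sub>E UNIV (\<lambda>_. {0..B}))"
      unfolding compactin_PiE by simp
    then show ?thesis unfolding euclidean_product_topology by simp
  qed
  ultimately obtain r g where r: "strict_mono r" "(\<lambda>n. f (r n)) \<longlonglongrightarrow> g"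
    using compact_subseq[of "Pi\<^sub>E (UNIV :: nat set) (\<lambda>_. {0..B})" f] by metis
  have lim_c: "(\<lambda>n. infdist (c k) (X (r n))) \<longlonglongrightarrow> g k" for k
  proof -
    have "isCont (\<lambda>x::nat \<Rightarrow> real. x k) g"
      using continuous_on_product_coordinates[of k] continuous_on_eq_continuous_at open_UNIV by blast
    from isCont_tendsto_compose[OF this r(2)] show ?thesis by (simp add: f_def)
  qed
  \<comment> \<open>Finitely many of the dense points control all of \<open>C\<close>: the subsequence is Cauchy.\<close>
  have Cauchy: "\<exists>N. \<forall>m\<ge>N. \<forall>n\<ge>N. X (r m) \<subseteq> tube (X (r n)) e" if e: "e > 0" for e
  proof -
    have "C \<subseteq> (\<Union>k. ball (c k) (e / 4))" using c(2)[of _ "e / 4"] e by (force simp: dist_commute)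
    then obtain I where I: "finite I" "C \<subseteq> (\<Union>k\<in>I. ball (c k) (e / 4))"
      by (rule compactE_image[OF C open_ball])
    have "eventually (\<lambda>n. \<forall>k\<in>I. dist (infdist (c k) (X (r n))) (g k) < e / 4) sequentially"
      using tendstoD[OF lim_c, of "e / 4"] e by (intro eventually_ball_finite I(1)) simp
    then obtain N where N: "\<And>n k. n \<ge> N \<Longrightarrow> k \<in> I \<Longrightarrow> dist (infdist (c k) (X (r n))) (g k) < e / 4"
      unfolding eventually_sequentially by blast
    have "x \<in> tube (X (r n)) e" if mn: "m \<ge> N" "n \<ge> N" and x: "x \<in> X (r m)" for m n x
    proof -
      have "x \<in> (\<Union>k\<in>I. ball (c k) (e / 4))" using I(2) subsetD[OF X(3) x] by blast
      then obtain k where k: "k \<in> I" "dist (c k) x < e / 4" by auto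
      have "infdist (c k) (X (r m)) < e / 4" using infdist_le[OF x, of "c k"] k(2) by linarith
      moreover have "infdist x (X (r n)) \<le> infdist (c k) (X (r n)) + dist (c k) x"
        using infdist_triangle[of x "X (r n)" "c k"] by (simp add: dist_commute)
      moreover have "infdist (c k) (X (r n)) < infdist (c k) (X (r m)) + e / 2"
        using N[OF mn(1) k(1)] N[OF mn(2) k(1)] unfolding dist_real_def by linarith
      ultimately have "infdist x (X (r n)) \<le> e" using k(2) by linarith
      then show ?thesis by (simp add: tube_def)
    qed
    then show ?thesis by blast
  qed
  define Q where "Q = (\<Inter>N. closure (\<Union>n\<in>{N..}. X (r n)))"
  have "closure (\<Union>n\<in>{N..}. X (r n)) \<subseteq> C" for N
    using X(3) by (intro closure_minimal compact_imp_closed[OF C]) blast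
  then have "Q \<subseteq> C" "closed Q" unfolding Q_def by blast+
  then have Q_cpt: "compact Q" using C by (metis compact_Int_closed inf.absorb_iff2)
  have in_Q: "x \<in> Q" if s: "strict_mono s" and y: "\<And>n. y n \<in> X (r (s n))" "y \<longlonglongrightarrow> x" for s y x
    unfolding Q_def
  proof
    fix N
    have "eventually (\<lambda>n. y n \<in> (\<Union>n\<in>{N..}. X (r n))) sequentially"
      using eventually_ge_at_top[of N]
    proof (rule eventually_mono)
      fix n assume "N \<le> n"
      then have "s n \<in> {N..}" using seq_suble[OF s, of n] by simp
      then show "y n \<in> (\<Union>n\<in>{N..}. X (r n))" using y(1) by blast
    qed
    then have "eventually (\<lambda>n. y n \<in> closure (\<Union>n\<in>{N..}. X (r n))) sequentially"
      by (rule eventually_mono) (rule subsetD[OF closure_subset])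
    then show "x \<in> closure (\<Union>n\<in>{N..}. X (r n))" using y(2) by (intro Lim_in_closed_set) auto
  qed
  have near: "\<exists>q\<in>Q. dist x q \<le> e" if N: "\<And>n. n \<ge> N \<Longrightarrow> infdist x (X (r n)) < e" for x e N
  proof -
    have "\<forall>n. \<exists>y. y \<in> X (r (n + N)) \<and> dist x y < e"
    proof
      fix n
      have "infdist x (X (r (n + N))) < e" by (rule N) simp
      then show "\<exists>y. y \<in> X (r (n + N)) \<and> dist x y < e" by (rule infdist_less_witness[OF X(2)]) blast
    qed
    from choice[OF this] obtain y where y: "\<And>n. y n \<in> X (r (n + N))" "\<And>n. dist x (y n) < e" by blast
    have "y n \<in> C" for n using y(1) X(3) by blast
    from compact_subseq[OF C this] obtain s q
      where s: "strict_mono s" "q \<in> C" "(\<lambda>n. y (s n)) \<longlonglongrightarrow> q" .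
    have "strict_mono (\<lambda>n. s n + N)" using s(1) by (simp add: strict_mono_def)
    from in_Q[OF this y(1) s(3)] have "q \<in> Q" .
    moreover have "dist x q \<le> e"
      by (rule LIMSEQ_le_const2[OF tendsto_dist[OF tendsto_const s(3)]]) (use y(2) less_imp_le in blast)
    ultimately show ?thesis by blast
  qed
  have near1: "eventually (\<lambda>n. X (r n) \<subseteq> tube Q e) sequentially" if e: "e > 0" for e
  proof -
    obtain N where N: "\<forall>m\<ge>N. \<forall>n\<ge>N. X (r m) \<subseteq> tube (X (r n)) (e / 2)" using Cauchy[of "e / 2"] e by auto
    have "X (r m) \<subseteq> tube Q e" if m: "m \<ge> N" for m
    proof
      fix x assume "x \<in> X (r m)"
      then have "infdist x (X (r n)) < e" if "n \<ge> N" for n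
        using N m that e by (force simp: tube_def)
      from near[OF this] obtain q where "q \<in> Q" "dist x q \<le> e" by blast
      then show "x \<in> tube Q e" unfolding tube_def using infdist_le2 by blast
    qed
    then show ?thesis unfolding eventually_sequentially by blast
  qed
  have near2: "eventually (\<lambda>n. Q \<subseteq> tube (X (r n)) e) sequentially" if e: "e > 0" for e
  proof -
    obtain N where N: "\<forall>m\<ge>N. \<forall>n\<ge>N. X (r m) \<subseteq> tube (X (r n)) e" using Cauchy[OF e] by blast
    have "Q \<subseteq> tube (X (r n)) e" if n: "n \<ge> N" for n
    proof -
      have "closure (\<Union>n\<in>{N..}. X (r n)) \<subseteq> tube (X (r n)) e"
        using N n by (intro closure_minimal closed_tube) auto
      then show ?thesis unfolding Q_def by blast
    qed
    then show ?thesis unfolding eventually_sequentially by blast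
  qed
  obtain x where x: "x \<in> X (r 0)" using X(2) by blast
  have "infdist x (X (r n)) < B + 1" for n
  proof -
    obtain y where "y \<in> X (r n)" using X(2) by blast
    then show ?thesis using infdist_le[of y "X (r n)" x] B[of x y] x X(3) by force
  qed
  then have Q_ne: "Q \<noteq> {}" using near[of 0 x "B + 1"] by blast
  have "h_converges (\<lambda>n. X (r n)) Q"
    unfolding h_converges_def
  proof (rule tendstoI)
    fix e :: real assume e: "e > 0"
    have "eventually (\<lambda>n. X (r n) \<subseteq> tube Q (e / 2) \<and> Q \<subseteq> tube (X (r n)) (e / 2)) sequentially"
      using near1[of "e / 2"] near2[of "e / 2"] e by (simp add: eventually_conj)
    then show "eventually (\<lambda>n. dist (hdist (X (r n)) Q) 0 < e) sequentially"
    proof (rule eventually_mono)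
      fix n assume n: "X (r n) \<subseteq> tube Q (e / 2) \<and> Q \<subseteq> tube (X (r n)) (e / 2)"
      have "hdist (X (r n)) Q \<le> e / 2" using n by (intro hdist_le X(2) Q_ne) auto
      moreover have "0 \<le> hdist (X (r n)) Q" by (rule hdist_nonneg[OF Q_cpt Q_ne])
      ultimately show "dist (hdist (X (r n)) Q) 0 < e" using e by simp
    qed
  qed
  then show thesis using that r(1) Q_cpt Q_ne by blast
qed

lemma h_converges_tubes:
  fixes X :: "nat \<Rightarrow> 'a::metric_space set"
  assumes h: "h_converges X Q" and X: "\<And>n. compact (X n)" and Q: "compact Q" and e: "e > 0"
  shows "eventually (\<lambda>n. X n \<subseteq> tube Q e \<and> Q \<subseteq> tube (X n) e) sequentially"
proof -
  have "eventually (\<lambda>n. hdist (X n) Q < e) sequentially"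
    using order_tendstoD(2)[OF h[unfolded h_converges_def] e] .
  then show ?thesis
    by (rule eventually_mono)
      (use subset_tube_hdist[OF X] subset_tube_hdist[OF Q] hdist_commute less_imp_le in metis)
qed

lemma h_limit_iff:
  fixes X :: "nat \<Rightarrow> 'a::metric_space set"
  assumes h: "h_converges X Q" and X: "\<And>n. compact (X n)" "\<And>n. X n \<noteq> {}"
    and Q: "compact Q" "Q \<noteq> {}"
  shows "q \<in> Q \<longleftrightarrow> (\<lambda>n. infdist q (X n)) \<longlonglongrightarrow> 0"
proof
  assume q: "q \<in> Q"
  show "(\<lambda>n. infdist q (X n)) \<longlonglongrightarrow> 0"
    by (rule null_le[OF h[unfolded h_converges_def] infdist_nonneg])
      (use subset_tube_hdist[OF Q(1) order_refl] q in \<open>auto simp: tube_def\<close>)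
next
  assume l: "(\<lambda>n. infdist q (X n)) \<longlonglongrightarrow> 0"
  have "q \<in> tube Q e" if e: "e > 0" for e
  proof -
    have "eventually (\<lambda>n. (X n \<subseteq> tube Q (e / 2) \<and> Q \<subseteq> tube (X n) (e / 2)) \<and> infdist q (X n) < e / 2)
        sequentially"
      by (rule eventually_conj[OF h_converges_tubes[OF h X(1) Q(1)] order_tendstoD(2)[OF l]])
        (use e in auto)
    then obtain n where n: "X n \<subseteq> tube Q (e / 2)" "infdist q (X n) < e / 2"
      by (auto dest: eventually_happens)
    have "q \<in> tube (X n) (e / 2)" using n(2) by (simp add: tube_def)
    then show ?thesis using tube_tube[OF X(2) n(1), of "e / 2"] by auto
  qed
  then show "q \<in> Q" by (rule in_all_tubes[OF compact_imp_closed[OF Q(1)] Q(2)])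
qed

text \<open>A separation of the limit would give disjoint closed tubes that both meet the connected sets
  \<open>X n\<close> and together contain them.\<close>

lemma h_limit_connected:
  fixes X :: "nat \<Rightarrow> 'a::metric_space set"
  assumes h: "h_converges X Q" and X: "\<And>n. compact (X n)" "\<And>n. X n \<noteq> {}" "\<And>n. connected (X n)"
    and Q: "compact Q" "Q \<noteq> {}"
  shows "connected Q"
proof (rule ccontr)
  assume "\<not> connected Q"
  then obtain A B where AB: "closed A" "closed B" "Q \<subseteq> A \<union> B" "A \<inter> B \<inter> Q = {}"
      "A \<inter> Q \<noteq> {}" "B \<inter> Q \<noteq> {}"
    unfolding connected_closed by blast
  define A' B' where "A' = Q \<inter> A" and "B' = Q \<inter> B"
  have A': "compact A'" "A' \<noteq> {}" and B': "compact B'" "B' \<noteq> {}" and dis: "A' \<inter> B' = {}"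
    and Q': "Q = A' \<union> B'"
    using AB Q(1) by (auto simp: A'_def B'_def intro: compact_Int_closed)
  obtain e where e: "e > 0" "tube A' e \<inter> tube B' e = {}"
    using disjoint_tubes[OF A' B' dis] .
  obtain n where n: "X n \<subseteq> tube Q e" "Q \<subseteq> tube (X n) (e / 2)"
    using eventually_happens[OF eventually_conj[OF h_converges_tubes[OF h X(1) Q(1) e(1)]
          h_converges_tubes[OF h X(1) Q(1) half_gt_zero[OF e(1)]]]] by auto
  have "tube Q e \<subseteq> tube A' e \<union> tube B' e"
    using infdist_Un_min[OF A'(2) B'(2)] by (auto simp: tube_def Q' min_le_iff_disj)
  then have "tube A' e \<inter> X n = {} \<or> tube B' e \<inter> X n = {}"
    using connected_closedD[OF X(3)[of n], of "tube A' e" "tube B' e"] n(1) e(2) closed_tube by blast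
  moreover have "tube P e \<inter> X n \<noteq> {}" if P: "P \<subseteq> Q" "P \<noteq> {}" for P
  proof -
    obtain p where p: "p \<in> P" using P(2) by blast
    then have "infdist p (X n) < e" using P(1) n(2) e(1) by (force simp: tube_def)
    then obtain x where x: "x \<in> X n" "dist p x < e" by (rule infdist_less_witness[OF X(2)])
    have "infdist x P \<le> e" by (rule infdist_le2[OF p]) (use x(2) in \<open>simp add: dist_commute\<close>)
    then show ?thesis using x(1) by (auto simp: tube_def)
  qed
  ultimately show False using A'(2) B'(2) Q' by blast
qed

lemma h_limit_invariant:
  fixes X :: "nat \<Rightarrow> 'a::metric_space set"
  assumes F: "flow \<theta>" and h: "h_converges X Q"
    and X: "\<And>n. compact (X n)" "\<And>n. X n \<noteq> {}" "\<And>n. invariant \<theta> (X n)"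
    and Q: "compact Q" "Q \<noteq> {}"
  shows "invariant \<theta> Q"
  unfolding invariant_iff[OF F]
proof (intro ballI allI)
  fix q t assume q: "q \<in> Q"
  note lim = h_limit_iff[OF h X(1,2) Q]
  obtain x where x: "\<And>n. x n \<in> X n" "(\<lambda>n. dist q (x n)) \<longlonglongrightarrow> 0"
    using nearly_nearest_points[OF X(2) iffD1[OF lim q]] by blast
  then have "x \<longlonglongrightarrow> q" by (simp add: tendsto_dist_iff[of x] dist_commute)
  from flow_tendsto[OF F tendsto_const this, of t]
  have "(\<lambda>n. dist (\<theta> t (x n)) (\<theta> t q)) \<longlonglongrightarrow> 0" by (simp add: tendsto_dist_iff[symmetric])
  then have "(\<lambda>n. infdist (\<theta> t q) (X n)) \<longlonglongrightarrow> 0"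
    by (rule null_le[OF _ infdist_nonneg])
      (use infdist_le[OF invariantD[OF F X(3) x(1)], of "\<theta> t q"] in \<open>simp add: dist_commute\<close>)
  then show "\<theta> t q \<in> Q" using lim by blast
qed

text \<open>The limit lies in the frontier because the sets approach \<open>K\<close> from outside. That a limit of
  equilibrium orbits is an equilibrium orbit serves conditions 7 and 10.1.\<close>

lemma minimal_sets_accumulate:
  fixes K :: "'a::metric_space set"
  assumes M: "locally compact (UNIV :: 'a set)" and F: "flow \<theta>" and K: "compact K" "K \<noteq> {}"
    and X: "\<And>n. X n \<in> CMin \<theta> (tube K (inverse (real (Suc n))) - K)"
  obtains r Q where "strict_mono (r :: nat \<Rightarrow> nat)" "Q \<in> CCI \<theta> (frontier K)"
    "h_converges (\<lambda>n. X (r n)) Q" "(\<forall>n. X n \<in> Eq \<theta> UNIV) \<longrightarrow> Q \<in> Eq \<theta> (frontier K)"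
proof -
  obtain e where e: "e > 0" "compact (tube K e)" using compact_tube_exists[OF M K] .
  obtain N where N: "inverse (real (Suc N)) < e" using reals_Archimedean e(1) by blast
  note X' = CMinD[OF X]
  have sub: "X (n + N) \<subseteq> tube K e" for n
  proof -
    have "inverse (real (Suc (n + N))) \<le> inverse (real (Suc N))" by (intro le_imp_inverse_le) auto
    then have "inverse (real (Suc (n + N))) \<le> e" using N by linarith
    then show ?thesis using X'(6)[of "n + N"] tube_mono by blast
  qed
  obtain r0 Q where r0: "strict_mono r0" and Q: "compact Q" "Q \<noteq> {}" and
    h0: "h_converges (\<lambda>n. X (r0 n + N)) Q"
    by (rule hausdorff_subsequence[of "tube K e" "\<lambda>n. X (n + N)", OF e(2) X'(2) X'(3) sub])
      (rule that)
  define r where "r n = r0 n + N" for n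
  have r: "strict_mono r" using r0 by (auto simp: r_def strict_mono_def)
  have h: "h_converges (\<lambda>n. X (r n)) Q" using h0 by (simp add: r_def)
  note lim = h_limit_iff[OF h X'(2,3) Q]
  note small = subseq_LIMSEQ[OF LIMSEQ_inverse_real_of_nat r]
  have QF: "q \<in> frontier K" if q: "q \<in> Q" for q
  proof -
    have q0: "(\<lambda>n. infdist q (X (r n))) \<longlonglongrightarrow> 0" using lim q by blast
    have "infdist q K \<le> inverse (real (Suc (r n))) + infdist q (X (r n))" for n
      using tube_tube[OF X'(3), of "r n" K "inverse (real (Suc (r n)))" "infdist q (X (r n))"]
        X'(6)[of "r n"] by (auto simp: tube_def)
    then have "infdist q K \<le> 0 + 0"
      by (intro LIMSEQ_le_const[OF tendsto_add[OF small q0]]) blast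
    then have "infdist q K = 0" using infdist_nonneg[of q K] by linarith
    moreover have "infdist q (- K) \<le> infdist q (X (r n))" for n
      using X'(6)[of "r n"] X'(3)[of "r n"] by (intro infdist_mono) auto
    then have "infdist q (- K) \<le> 0" by (intro LIMSEQ_le_const[OF q0]) blast
    then have "infdist q (- K) = 0" using infdist_nonneg[of q "- K"] by linarith
    moreover have "- K \<noteq> {}" using X'(3,6)[of 0] by blast
    ultimately show ?thesis
      unfolding frontier_closures using K(2) by (simp add: in_closure_iff_infdist_zero)
  qed
  have con: "connected (X n)" for n by (rule connected_minimal[OF F X'(1)])
  have Qinv: "invariant \<theta> Q" by (rule h_limit_invariant[OF F h X'(2,3,5) Q])
  have "Q \<in> CCI \<theta> (frontier K)"
    using QF Q Qinv h_limit_connected[OF h X'(2,3) con Q]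
    unfolding CCI_def by blast
  moreover have "Q \<in> Eq \<theta> (frontier K)" if eq: "\<And>n. X n \<in> Eq \<theta> UNIV"
  proof -
    have "\<exists>z. X n = {z}" for n using eq[of n] by (auto simp: Eq_def)
    then obtain z where z: "\<And>n. X n = {z n}" by metis
    have to: "(\<lambda>n. z (r n)) \<longlonglongrightarrow> q" if "q \<in> Q" for q
      using lim[of q] that by (simp add: z tendsto_dist_iff[of "\<lambda>n. z (r n)"] dist_commute)
    obtain q where q: "q \<in> Q" using Q(2) by blast
    have "Q = {q}" using to[OF q] to LIMSEQ_unique q by blast
    moreover have "\<theta> t q = q" for t using invariantD[OF F Qinv q] \<open>Q = {q}\<close> by blast
    ultimately show ?thesis using QF unfolding Eq_def by blast
  qed
  ultimately show thesis using that r h by blast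
qed


section \<open>Continuum many minimal sets\<close>

lemma lepoll_Un_cases:
  assumes "infinite C" "C \<lesssim> A \<union> B"
  shows "C \<lesssim> A \<or> C \<lesssim> B"
  using card_of_Un_ordLess_infinite[OF assms(1), of A B] assms(2)
  unfolding card_of_ordLess[symmetric] lepoll_def by blast

lemma real_lepoll_infinite: "(UNIV :: real set) \<lesssim> A \<Longrightarrow> infinite A"
  using infinite_UNIV_char_0 lepoll_def by (metis finite_imageD finite_subset)

text \<open>The form in which a Cantor scheme yields continuum many objects.\<close>

lemma real_lepoll_of_binary_sequences:
  fixes N :: "(nat \<Rightarrow> bool) \<Rightarrow> 'b"
  assumes "inj N" "range N \<subseteq> S"
  shows "(UNIV :: real set) \<lesssim> S"
proof -
  have "(UNIV :: nat set set) \<lesssim> S"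
    unfolding lepoll_def
  proof (intro exI[of _ "\<lambda>A. N (\<lambda>n. n \<in> A)"] conjI)
    show "inj (\<lambda>A::nat set. N (\<lambda>n. n \<in> A))"
    proof (rule injI)
      fix A B :: "nat set" assume "N (\<lambda>n. n \<in> A) = N (\<lambda>n. n \<in> B)"
      then have "(\<lambda>n. n \<in> A) = (\<lambda>n. n \<in> B)" using assms(1) by (simp add: inj_eq)
      then show "A = B" by (auto dest: fun_cong)
    qed
  qed (use assms(2) in blast)
  then show ?thesis
    using lepoll_trans[OF eqpoll_imp_lepoll[OF eqpoll_sym[OF nat_sets_eqpoll_reals]]] by blast
qed

lemma shrink_tube:
  assumes X: "compact X" "X \<noteq> {}" "open W" "X \<subseteq> W" and d: "d > 0"
  obtains d' where "0 < d'" "d' \<le> d" "tube X d' \<subseteq> W"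
proof -
  obtain e where e: "e > 0" "tube X e \<subseteq> W" using tube_subset_open[OF X] .
  show thesis
    by (rule that[of "min d e"]) (use d e tube_mono[of "min d e" e X] in auto)
qed

text \<open>A Cantor scheme. The countably many properties \<open>R n\<close> of minimal sets hold near each member of
  \<open>\<CC>\<close> and together characterise membership, so that \<open>\<CC>\<close> is a kind of \<open>G\<^sub>\<delta>\<close>; they are imposed one per
  level. Each branch is a decreasing sequence of compact tubes around members of \<open>\<CC>\<close>, whose
  intersection contains a whole orbit and hence a minimal set.\<close>

lemma continuum_many_minimal_sets:
  fixes \<theta> :: "real \<Rightarrow> 'a::metric_space \<Rightarrow> 'a" and R :: "nat \<Rightarrow> 'a set \<Rightarrow> bool"
  assumes M: "locally compact (UNIV :: 'a set)" and F: "flow \<theta>" and \<CC>: "\<CC> \<subseteq> CMin \<theta> UNIV"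
    and R_near: "\<And>X n. X \<in> \<CC> \<Longrightarrow> \<exists>d>0. \<forall>Y\<in>CMin \<theta> (tube X d). R n Y"
    and R_all: "\<And>Y. Y \<in> CMin \<theta> UNIV \<Longrightarrow> (\<And>n. R n Y) \<Longrightarrow> Y \<in> \<CC>"
    and perfect: "\<And>X d. X \<in> \<CC> \<Longrightarrow> d > 0 \<Longrightarrow> \<exists>Y\<in>\<CC>. Y \<noteq> X \<and> Y \<subseteq> tube X d"
    and X0: "X0 \<in> \<CC>" "d0 > 0"
  shows "(UNIV :: real set) \<lesssim> {Y\<in>\<CC>. Y \<subseteq> tube X0 d0}"
proof -
  have split: "\<exists>Y e. Y \<in> \<CC> \<and> e > 0 \<and> tube X e \<inter> tube Y e = {} \<and>
      (\<forall>Z\<in>{X, Y}. tube Z e \<subseteq> tube X d \<and> compact (tube Z e) \<and> (\<forall>N\<in>CMin \<theta> (tube Z e). R n N))"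
    if X: "X \<in> \<CC>" "d > 0" for X d and n :: nat
  proof -
    obtain Y where Y: "Y \<in> \<CC>" "Y \<noteq> X" "Y \<subseteq> tube X (d / 2)"
      using perfect[OF X(1), of "d / 2"] X(2) by auto
    have X': "compact X" "X \<noteq> {}" and Y': "compact Y" "Y \<noteq> {}"
      using X(1) Y(1) \<CC> CMinD by blast+
    have "X \<inter> Y = {}" using CMin_disjoint[OF F] X(1) Y(1,2) \<CC> by blast
    then obtain e1 where e1: "e1 > 0" "tube X e1 \<inter> tube Y e1 = {}"
      by (rule disjoint_tubes[OF X' Y'])
    obtain e2 where e2: "e2 > 0" "compact (tube X e2)" using compact_tube_exists[OF M X'] .
    obtain e3 where e3: "e3 > 0" "compact (tube Y e3)" using compact_tube_exists[OF M Y'] .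
    obtain e4 where e4: "e4 > 0" "\<forall>N\<in>CMin \<theta> (tube X e4). R n N" using R_near[OF X(1)] by blast
    obtain e5 where e5: "e5 > 0" "\<forall>N\<in>CMin \<theta> (tube Y e5). R n N" using R_near[OF Y(1)] by blast
    \<comment> \<open>One radius for disjointness, compactness, the property \<open>R n\<close> and containment in the old tube.\<close>
    define e where "e = min (min e1 e2) (min (min e3 e4) (min e5 (d / 2)))"
    have e: "e > 0" "e \<le> e1" "e \<le> e2" "e \<le> e3" "e \<le> e4" "e \<le> e5" "e \<le> d / 2"
      using e1(1) e2(1) e3(1) e4(1) e5(1) X(2) by (simp_all add: e_def min_le_iff_disj)
    have "tube X e \<inter> tube Y e = {}" using e1(2) tube_mono[OF e(2)] by blast
    moreover have "tube X e \<subseteq> tube X d" by (rule tube_mono) (use e(7) X(2) in simp)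
    moreover have "tube Y e \<subseteq> tube X d"
      using tube_tube[OF Y'(2) Y(3), of e] tube_mono[of "d / 2 + e" d X] e(7) by auto
    moreover have "compact (tube X e)" "compact (tube Y e)"
      by (rule compact_tube_mono[OF e2(2) e(3)], rule compact_tube_mono[OF e3(2) e(4)])
    moreover have "\<forall>N\<in>CMin \<theta> (tube X e). R n N" "\<forall>N\<in>CMin \<theta> (tube Y e). R n N"
      using e4(2) e5(2) tube_mono[OF e(5), of X] tube_mono[OF e(6), of Y] CMin_mono CMinD(6)
      by (meson subset_trans)+
    ultimately show ?thesis using Y(1) e(1) by (intro exI[of _ Y] exI[of _ e]) simp
  qed
  obtain g h where gh: "\<And>X d n. X \<in> \<CC> \<Longrightarrow> d > 0 \<Longrightarrow> g X d n \<in> \<CC> \<and> h X d n > 0 \<and>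
      tube X (h X d n) \<inter> tube (g X d n) (h X d n) = {} \<and>
      (\<forall>Z\<in>{X, g X d n}. tube Z (h X d n) \<subseteq> tube X d \<and> compact (tube Z (h X d n)) \<and>
        (\<forall>N\<in>CMin \<theta> (tube Z (h X d n)). R n N))"
  proof -
    define p where "p X d n = (SOME q. fst q \<in> \<CC> \<and> snd q > 0 \<and>
      tube X (snd q) \<inter> tube (fst q) (snd q) = {} \<and>
      (\<forall>Z\<in>{X, fst q}. tube Z (snd q) \<subseteq> tube X d \<and> compact (tube Z (snd q)) \<and>
        (\<forall>N\<in>CMin \<theta> (tube Z (snd q)). R n N)))" for X d n
    show thesis
    proof (rule that[of "\<lambda>X d n. fst (p X d n)" "\<lambda>X d n. snd (p X d n)"])
      fix X d n assume X: "X \<in> \<CC>" "(d::real) > 0"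
      obtain Y e where Ye: "Y \<in> \<CC> \<and> e > 0 \<and> tube X e \<inter> tube Y e = {} \<and>
        (\<forall>Z\<in>{X, Y}. tube Z e \<subseteq> tube X d \<and> compact (tube Z e) \<and> (\<forall>N\<in>CMin \<theta> (tube Z e). R n N))"
        using split[OF X, of n] by (elim exE)
      show "fst (p X d n) \<in> \<CC> \<and> snd (p X d n) > 0 \<and>
        tube X (snd (p X d n)) \<inter> tube (fst (p X d n)) (snd (p X d n)) = {} \<and>
        (\<forall>Z\<in>{X, fst (p X d n)}. tube Z (snd (p X d n)) \<subseteq> tube X d \<and> compact (tube Z (snd (p X d n))) \<and>
          (\<forall>N\<in>CMin \<theta> (tube Z (snd (p X d n))). R n N))"
        unfolding p_def by (rule someI[of _ "(Y, e)"]) (unfold fst_conv snd_conv, rule Ye)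
    qed
  qed
  \<comment> \<open>At level \<open>n\<close> the digit \<open>v n\<close> decides whether to move to the new set or to keep the old one; the
    tube shrinks in both cases.\<close>
  define S where "S v = rec_nat (X0, d0)
      (\<lambda>n s. (if v n then g (fst s) (snd s) n else fst s, h (fst s) (snd s) n))" for v :: "nat \<Rightarrow> bool"
  have S_0: "S v 0 = (X0, d0)" for v by (simp add: S_def)
  have S_Suc: "S v (Suc n) = (if v n then g (fst (S v n)) (snd (S v n)) n else fst (S v n),
      h (fst (S v n)) (snd (S v n)) n)" for v n
    by (simp add: S_def)
  define T where "T v n = tube (fst (S v n)) (snd (S v n))" for v n
  have S: "fst (S v n) \<in> \<CC> \<and> snd (S v n) > 0" for v n
    by (induction n) (use X0 gh in \<open>auto simp: S_0 S_Suc\<close>)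
  then have S1: "fst (S v n) \<in> \<CC>" and S2: "snd (S v n) > 0" for v n by blast+
  have T_Suc: "T v (Suc n) \<subseteq> T v n" "compact (T v (Suc n))"
    "\<And>N. N \<in> CMin \<theta> (T v (Suc n)) \<Longrightarrow> R n N" for v n
    using gh[OF S1[of v n] S2[of v n], of n] by (auto simp: T_def S_Suc split: if_splits)
  have T_mono: "T v n \<subseteq> T v m" if "m \<le> n" for v m n
    using lift_Suc_antimono_le[of "T v", OF T_Suc(1) that] .
  have T_dis: "T v (Suc n) \<inter> T w (Suc n) = {}" if "\<And>k. k < n \<Longrightarrow> v k = w k" "v n \<noteq> w n" for v w n
  proof -
    have "S v m = S w m" if "m \<le> n" for m
      using that \<open>\<And>k. k < n \<Longrightarrow> v k = w k\<close> by (induction m) (auto simp: S_0 S_Suc)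
    then have "S v n = S w n" by simp
    then show ?thesis using that(2) gh[OF S1[of v n] S2[of v n], of n] by (auto simp: T_def S_Suc)
  qed
  have "\<exists>N. N \<in> CMin \<theta> UNIV \<and> (\<forall>n. N \<subseteq> T v (Suc n))" for v
  proof -
    \<comment> \<open>The intersection of the tubes need not be invariant. Its invariant core is nonempty because each
      tube contains the orbits of its own centre.\<close>
    define I where "I = {x. orbit \<theta> x \<subseteq> (\<Inter>n. T v (Suc n))}"
    have Tcl: "closed (\<Inter>n. T v (Suc n))" by (auto simp: T_def closed_tube)
    have I: "closed I" "invariant \<theta> I"
      unfolding I_def using closed_core[OF F Tcl] invariant_core[OF F] by blast+
    have IT: "I \<subseteq> T v (Suc n)" for n unfolding I_def using orbit_self[OF F] by blast
    then have I_cpt: "compact I"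
      using compact_Int_closed[OF T_Suc(2)[of v 0] I(1)] by (simp add: inf.absorb2)
    have "\<forall>n. \<exists>x. x \<in> fst (S v (Suc n))" using S1 \<CC> CMinD(3) by blast
    from choice[OF this] obtain x where x: "\<And>n. x n \<in> fst (S v (Suc n))" by blast
    have orb: "\<theta> t (x n) \<in> T v (Suc n)" for t n
      using CMin_time[OF F subsetD[OF \<CC> S1] x] subset_tube[OF less_imp_le[OF S2]]
      unfolding T_def by blast
    have "x n \<in> T v (Suc 0)" for n
      using orb[of 0 n] T_mono[of "Suc 0" "Suc n" v] by (auto simp: flow_zero[OF F])
    from compact_subseq[OF T_Suc(2) this]
    obtain r l where r: "strict_mono r" "l \<in> T v (Suc 0)" "(\<lambda>n. x (r n)) \<longlonglongrightarrow> l" .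
    have "\<theta> t l \<in> T v (Suc m)" for t m
    proof (rule Lim_in_closed_set[OF _ _ _ flow_tendsto[OF F tendsto_const r(3)]])
      show "closed (T v (Suc m))" by (simp add: T_def closed_tube)
      show "eventually (\<lambda>n. \<theta> t (x (r n)) \<in> T v (Suc m)) sequentially"
        using eventually_ge_at_top[of m]
      proof (rule eventually_mono)
        fix n assume "m \<le> n"
        then have "Suc m \<le> Suc (r n)" using seq_suble[OF r(1), of n] by simp
        then show "\<theta> t (x (r n)) \<in> T v (Suc m)" using orb T_mono by blast
      qed
    qed simp
    then have "l \<in> I" by (auto simp: I_def orbit_def)
    then have "I \<noteq> {}" by blast
    then obtain N where "N \<in> CMin \<theta> I" using CMin_exists[OF F I_cpt _ I(2)] by blast
    then show ?thesis using IT CMin_mono CMinD(6) by blast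
  qed
  then have "\<forall>v. \<exists>N. N \<in> CMin \<theta> UNIV \<and> (\<forall>n. N \<subseteq> T v (Suc n))" by (rule allI)
  from choice[OF this] obtain N
    where N: "\<forall>v. N v \<in> CMin \<theta> UNIV \<and> (\<forall>n. N v \<subseteq> T v (Suc n))" ..
  have N1: "N v \<in> CMin \<theta> UNIV" and N2: "N v \<subseteq> T v (Suc n)" for v n using N by blast+
  have "N v \<in> {Y\<in>\<CC>. Y \<subseteq> tube X0 d0}" for v
  proof -
    have "R n (N v)" for n using T_Suc(3) CMin_mono[OF N1 N2] by blast
    then have "N v \<in> \<CC>" using R_all N1 by blast
    moreover have "N v \<subseteq> T v 0" using N2[of v 0] T_Suc(1)[of v 0] by blast
    ultimately show ?thesis by (simp add: T_def S_0)
  qed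
  moreover have "inj N"
  proof (rule injI, rule ccontr)
    fix v w assume eq: "N v = N w" and ne: "v \<noteq> w"
    define n where "n = (LEAST n. v n \<noteq> w n)"
    obtain m where "v m \<noteq> w m" using ne by blast
    then have "v n \<noteq> w n" unfolding n_def by (rule LeastI)
    moreover have "v k = w k" if "k < n" for k using not_less_Least that unfolding n_def by blast
    ultimately have "T v (Suc n) \<inter> T w (Suc n) = {}" using T_dis by blast
    then show False using N2[of v n] N2[of w n] eq CMinD(3)[OF N1, of v] by auto
  qed
  ultimately show ?thesis by (intro real_lepoll_of_binary_sequences) auto
qed


section \<open>Neighbours of equilibria, of periodic orbits and of aperiodic minimal sets\<close>

lemma Eq_iff: "X \<in> Eq \<theta> S \<longleftrightarrow> X \<in> Eq \<theta> UNIV \<and> X \<subseteq> S"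
  by (auto simp: Eq_def)

lemma Per_iff: "X \<in> Per \<theta> S \<longleftrightarrow> X \<in> Per \<theta> UNIV \<and> X \<subseteq> S"
  by (auto simp: Per_def)

lemma Am_iff: "X \<in> Am \<theta> S \<longleftrightarrow> X \<in> Am \<theta> UNIV \<and> X \<subseteq> S"
  by (auto simp: Am_def)

lemma kinds_mono:
  assumes "S \<subseteq> T"
  shows "Eq \<theta> S \<subseteq> Eq \<theta> T" "Per \<theta> S \<subseteq> Per \<theta> T" "Am \<theta> S \<subseteq> Am \<theta> T"
  using assms by (auto simp: Eq_def Per_def Am_def)

text \<open>The equilibria form a closed set, and a minimal set that meets it is a single equilibrium.\<close>

lemma no_equilibria_near:
  assumes F: "flow \<theta>" and X: "X \<in> CMin \<theta> S" "X \<notin> Eq \<theta> UNIV"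
  obtains d where "d > 0" "Eq \<theta> (tube X d) = {}"
proof -
  define E where "E = {z. \<forall>t. \<theta> t z = z}"
  have "closed {z. \<theta> t z = z}" for t
    by (intro closed_Collect_eq continuous_on_id)
      (auto simp: continuous_on intro: flow_tendsto[OF F tendsto_const] tendsto_ident_at)
  then have "closed (\<Inter>t. {z. \<theta> t z = z})" by blast
  moreover have "E = (\<Inter>t. {z. \<theta> t z = z})" by (auto simp: E_def)
  ultimately have "closed E" by simp
  moreover have "X \<inter> E = {}"
  proof (rule ccontr)
    assume "X \<inter> E \<noteq> {}"
    then obtain z where z: "z \<in> X" "\<And>t. \<theta> t z = z" by (auto simp: E_def)
    then have eq: "{z} \<in> Eq \<theta> UNIV" by (auto simp: Eq_def)
    then have "X = {z}"
      using minimal_eq[OF F CMinD(1)[OF X(1)] CMinD(1)[OF subsetD[OF Eq_subset_CMin[OF F] eq]]] z(1)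
      by blast
    then show False using X(2) eq by simp
  qed
  ultimately obtain d where "d > 0" "tube X d \<inter> E = {}"
    by (rule tube_avoids_closed[OF CMinD(2,3)[OF X(1)]])
  moreover from this(2) have "Eq \<theta> (tube X d) = {}" by (auto simp: Eq_def E_def)
  ultimately show thesis using that by blast
qed

text \<open>Short periods have multiples in the compact interval from \<open>T\<close> to \<open>2 * T\<close>, so returning points
  that approach an aperiodic minimal set would produce a returning point in it.\<close>

lemma no_short_returns_near:
  fixes N :: "'a::metric_space set"
  assumes F: "flow \<theta>" and N: "N \<in> Am \<theta> S" and T: "T > 0"
  obtains d where "d > 0" "\<And>z p. z \<in> tube N d \<Longrightarrow> 0 < p \<Longrightarrow> p \<le> T \<Longrightarrow> \<theta> p z \<noteq> z"
proof (rule ccontr)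
  assume neg: "\<not> thesis"
  have "\<forall>n. \<exists>z. z \<in> tube N (inverse (real (Suc n))) \<and> (\<exists>u. T \<le> u \<and> u \<le> 2 * T \<and> \<theta> u z = z)"
  proof
    fix n
    have "\<exists>z p. z \<in> tube N (inverse (real (Suc n))) \<and> 0 < p \<and> p \<le> T \<and> \<theta> p z = z"
    proof (rule ccontr)
      assume *: "\<not> ?thesis"
      have "\<theta> p z \<noteq> z" if "z \<in> tube N (inverse (real (Suc n)))" "0 < p" "p \<le> T" for z p
        using * that by blast
      then show False using neg that[of "inverse (real (Suc n))"] by simp
    qed
    then obtain z p where z: "z \<in> tube N (inverse (real (Suc n)))" "0 < p" "p \<le> T" "\<theta> p z = z"
      by blast
    \<comment> \<open>The least multiple of \<open>p\<close> that is not below \<open>T\<close>.\<close>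
    define u where "u = of_int \<lceil>T / p\<rceil> * p"
    have "T / p \<le> of_int \<lceil>T / p\<rceil>" "of_int \<lceil>T / p\<rceil> \<le> T / p + 1" by linarith+
    then have "T / p * p \<le> u" "u \<le> (T / p + 1) * p"
      unfolding u_def using z(2) by (intro mult_right_mono; simp)+
    then have "T \<le> u" "u \<le> 2 * T" using z(2,3) by (simp_all add: distrib_right)
    moreover have "\<theta> u z = z" unfolding u_def by (rule return_multiple[OF F z(4)])
    ultimately show "\<exists>z. z \<in> tube N (inverse (real (Suc n))) \<and>
        (\<exists>u. T \<le> u \<and> u \<le> 2 * T \<and> \<theta> u z = z)" using z(1) by blast
  qed
  from choice[OF this] obtain z where z: "\<And>n. z n \<in> tube N (inverse (real (Suc n)))"
      and "\<forall>n. \<exists>u. T \<le> u \<and> u \<le> 2 * T \<and> \<theta> u (z n) = z n" by blast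
  from choice[OF this(2)] obtain u where u: "\<And>n. u n \<in> {T..2 * T}" "\<And>n. \<theta> (u n) (z n) = z n"
    by auto
  have N': "N \<in> CMin \<theta> S" using N Am_subset_CMin by blast
  obtain r x where r: "strict_mono r" "x \<in> N" "(\<lambda>n. z (r n)) \<longlonglongrightarrow> x"
    using limit_of_tubes[OF CMinD(2,3)[OF N'] z] .
  have "u (r n) \<in> {T..2 * T}" for n by (rule u(1))
  from compact_subseq[OF compact_Icc this]
  obtain r2 a where r2: "strict_mono r2" "a \<in> {T..2 * T}" "(\<lambda>n. u (r (r2 n))) \<longlonglongrightarrow> a" .
  have lim: "(\<lambda>n. z (r (r2 n))) \<longlonglongrightarrow> x" by (rule subseq_LIMSEQ[OF r(3) r2(1)])
  from flow_tendsto[OF F r2(3) this] have "(\<lambda>n. z (r (r2 n))) \<longlonglongrightarrow> \<theta> a x" by (simp only: u(2))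
  then have "\<theta> a x = x" using lim LIMSEQ_unique by blast
  then show False using Am_no_return[OF F N r(2), of a] r2(2) T by simp
qed

lemma Per_period_near_Am:
  assumes F: "flow \<theta>" and N: "N \<in> Am \<theta> S" and T: "T > 0"
  obtains d where "d > 0" "\<And>\<gamma> p. \<gamma> \<in> Per \<theta> (tube N d) \<Longrightarrow> has_period \<theta> \<gamma> p \<Longrightarrow> T < p"
proof -
  obtain d where d: "d > 0" "\<And>z p. z \<in> tube N d \<Longrightarrow> 0 < p \<Longrightarrow> p \<le> T \<Longrightarrow> \<theta> p z \<noteq> z"
    by (rule no_short_returns_near[OF F N T]) (rule that)
  have "T < p" if \<gamma>: "\<gamma> \<in> Per \<theta> (tube N d)" "has_period \<theta> \<gamma> p" for \<gamma> p
  proof (rule ccontr)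
    assume "\<not> T < p"
    obtain z where z: "z \<in> \<gamma>" using Per_subset_CMin[OF F] \<gamma>(1) CMinD(3) by blast
    have "z \<in> tube N d" using z \<gamma>(1) by (auto simp: Per_def)
    then show False
      using d(2) periodic_point(2,3)[OF F \<gamma>(2) z] \<open>\<not> T < p\<close> by (meson not_less)
  qed
  then show thesis using that d(1) by blast
qed

lemma continuum_many_in_open:
  fixes \<theta> :: "real \<Rightarrow> 'a::metric_space \<Rightarrow> 'a"
  assumes M: "locally compact (UNIV :: 'a set)" and F: "flow \<theta>" and W: "open W"
    and perfect: "\<And>X d. X \<in> CMin \<theta> W \<Longrightarrow> d > 0 \<Longrightarrow> \<exists>Y\<in>CMin \<theta> W. Y \<noteq> X \<and> Y \<subseteq> tube X d"
    and X: "X \<in> CMin \<theta> W" "d > 0"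
  shows "(UNIV :: real set) \<lesssim> CMin \<theta> (tube X d)"
proof -
  have "(UNIV :: real set) \<lesssim> {Y\<in>CMin \<theta> W. Y \<subseteq> tube X d}"
  proof (rule continuum_many_minimal_sets[OF M F _ _ _ perfect X, where R = "\<lambda>n Y. Y \<subseteq> W"])
    show "\<exists>d>0. \<forall>Y\<in>CMin \<theta> (tube X d). Y \<subseteq> W" if X: "X \<in> CMin \<theta> W" for X
    proof -
      obtain d where "d > 0" "tube X d \<subseteq> W"
        using tube_subset_open[OF CMinD(2,3)[OF X] W CMinD(6)[OF X]] .
      then show ?thesis using CMinD(6) by (intro exI[of _ d]) blast
    qed
  qed (auto intro: CMin_mono)
  moreover have "{Y\<in>CMin \<theta> W. Y \<subseteq> tube X d} \<subseteq> CMin \<theta> (tube X d)" by (auto intro: CMin_mono)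
  ultimately show ?thesis using lepoll_trans[OF _ subset_imp_lepoll] by blast
qed

text \<open>Aperiodicity is the conjunction of the conditions of not being an equilibrium and of having no
  period up to \<open>n\<close>, each of which persists near an aperiodic minimal set. So the Cantor scheme stays
  among aperiodic sets, provided that these have no isolated members.\<close>

lemma Am_isolated_or_c_dense:
  fixes \<theta> :: "real \<Rightarrow> 'a::metric_space \<Rightarrow> 'a"
  assumes M: "locally compact (UNIV :: 'a set)" and F: "flow \<theta>" and W: "open W"
    and nd: "\<not> c_dense_in_itself (Am \<theta> W)"
  obtains X d where "X \<in> Am \<theta> W" "d > 0" "\<And>Y. Y \<in> Am \<theta> W \<Longrightarrow> Y \<subseteq> tube X d \<Longrightarrow> Y = X"
proof (rule ccontr)
  assume neg: "\<not> thesis"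
  note witness = that
  have perfect: "\<exists>Y\<in>Am \<theta> W. Y \<noteq> X \<and> Y \<subseteq> tube X d" if X: "X \<in> Am \<theta> W" "d > 0" for X d
  proof (rule ccontr)
    assume "\<not> ?thesis"
    then show False using witness[OF X] neg by blast
  qed
  have "(UNIV :: real set) \<lesssim> {Y\<in>Am \<theta> W. Y \<subseteq> tube X d}" if X: "X \<in> Am \<theta> W" "d > 0" for X d
  proof (rule continuum_many_minimal_sets[OF M F _ _ _ perfect X, where
        R = "\<lambda>n Y. Y \<subseteq> W \<and> Y \<notin> Eq \<theta> UNIV \<and> (\<forall>p. has_period \<theta> Y p \<longrightarrow> real (Suc n) < p)"])
    show "Am \<theta> W \<subseteq> CMin \<theta> UNIV" using Am_subset_CMin CMin_mono by blast
    show "\<exists>d>0. \<forall>Y\<in>CMin \<theta> (tube X d). Y \<subseteq> W \<and> Y \<notin> Eq \<theta> UNIV \<and>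
        (\<forall>p. has_period \<theta> Y p \<longrightarrow> real (Suc n) < p)" if X: "X \<in> Am \<theta> W" for X n
    proof -
      have X': "X \<in> CMin \<theta> W" "X \<notin> Eq \<theta> UNIV" using X Am_subset_CMin by (auto simp: Am_def)
      obtain d1 where d1: "d1 > 0" "tube X d1 \<subseteq> W"
        using tube_subset_open[OF CMinD(2,3)[OF X'(1)] W CMinD(6)[OF X'(1)]] .
      obtain d2 where d2: "d2 > 0" "Eq \<theta> (tube X d2) = {}" using no_equilibria_near[OF F X'] .
      have "real (Suc n) > 0" by simp
      then obtain d3 where d3: "d3 > 0"
          "\<And>\<gamma> p. \<gamma> \<in> Per \<theta> (tube X d3) \<Longrightarrow> has_period \<theta> \<gamma> p \<Longrightarrow> real (Suc n) < p"
        by (rule Per_period_near_Am[OF F X]) (rule that)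
      define d where "d = Min {d1, d2, d3}"
      have d: "d > 0" "d \<le> d1" "d \<le> d2" "d \<le> d3" using d1 d2 d3 by (auto simp: d_def)
      have "Y \<subseteq> W \<and> Y \<notin> Eq \<theta> UNIV \<and> (\<forall>p. has_period \<theta> Y p \<longrightarrow> real (Suc n) < p)"
        if "Y \<in> CMin \<theta> (tube X d)" for Y
      proof (intro conjI allI impI notI)
        have Y: "Y \<subseteq> tube X d1" "Y \<subseteq> tube X d2" "Y \<subseteq> tube X d3"
          using CMinD(6)[OF that] tube_mono[OF d(2), of X] tube_mono[OF d(3), of X]
            tube_mono[OF d(4), of X] by blast+
        show "Y \<subseteq> W" using Y(1) d1(2) by blast
        show False if "Y \<in> Eq \<theta> UNIV" using Eq_mono[OF that Y(2)] d2(2) by simp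
        show "real (Suc n) < p" if "has_period \<theta> Y p" for p
          using d3(2)[OF _ that] that Y(3) by (auto simp: Per_def)
      qed
      then show ?thesis using d(1) by blast
    qed
    show "Y \<in> Am \<theta> W" if Y: "Y \<in> CMin \<theta> UNIV" and
      RY: "\<And>n. Y \<subseteq> W \<and> Y \<notin> Eq \<theta> UNIV \<and> (\<forall>p. has_period \<theta> Y p \<longrightarrow> real (Suc n) < p)" for Y
    proof -
      have "\<not> has_period \<theta> Y p" for p
      proof
        assume "has_period \<theta> Y p"
        then have less: "real (Suc n) < p" for n using RY by blast
        obtain n where "p < real n" using reals_Archimedean2 by blast
        then show False using less[of n] by simp
      qed
      then show ?thesis using Y RY[of 0] by (auto simp: Am_def CMin_def Per_def)
    qed
  qed
  then have "c_dense_in_itself (Am \<theta> W)"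
    using c_dense_iff_tubes[OF F Am_subset_CMin] by blast
  then show False using nd by blast
qed


section \<open>Minimal sets accumulating at the boundary\<close>

text \<open>Restriction to a compact tube turns the closed minimal sets of the definition into compact ones.\<close>

lemma minimals_near_not_isolated:
  fixes K :: "'a::metric_space set"
  assumes M: "locally compact (UNIV :: 'a set)" and K: "compact K" "K \<noteq> {}"
    and ni: "\<not> isolated_from_minimals \<theta> K" and d: "d > 0"
  obtains N where "N \<in> CMin \<theta> (tube K d - K)"
proof -
  obtain e where e: "e > 0" "compact (tube K e)" using compact_tube_exists[OF M K] .
  have "nbhd (tube K (min d e)) K" by (rule nbhd_tube) (use d e in simp)
  then obtain N where N: "minimal_set \<theta> N" "N \<subseteq> tube K (min d e) - K"
    using ni unfolding isolated_from_minimals_def by blast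
  have "N \<subseteq> tube K e" using N(2) tube_mono[of "min d e" e K] by auto
  then have "compact N"
    using compact_Int_closed[OF e(2), of N] N(1) by (simp add: minimal_set_def inf.absorb2)
  moreover have "N \<subseteq> tube K d - K" using N(2) tube_mono[of "min d e" d K] by auto
  ultimately show thesis using that N(1) by (simp add: CMin_def)
qed

lemma Eq_frontier_subset_CCI: "flow \<theta> \<Longrightarrow> Eq \<theta> S \<subseteq> CCI \<theta> S"
  by (auto simp: Eq_def CCI_def invariant_iff)

text \<open>A set near a Hausdorff limit in the frontier is near \<open>K\<close>. This makes alternatives D and E provide
  minimal sets outside \<open>K\<close> in every neighbourhood of \<open>K\<close>.\<close>

lemma CCI_near:
  assumes K: "compact K" and Q: "Q \<in> CCI \<theta> (frontier K)" and Y: "Y \<subseteq> tube Q d"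
  shows "Y \<subseteq> tube K d"
proof -
  have "Q \<subseteq> K" "Q \<noteq> {}"
    using Q frontier_subset_closed[OF compact_imp_closed[OF K]] by (auto simp: CCI_def)
  then have "infdist y K \<le> infdist y Q" for y by (rule infdist_mono)
  then show ?thesis using Y order_trans unfolding tube_def by blast
qed

lemma h_converges_near:
  assumes K: "compact K" "K \<noteq> {}" and Q: "Q \<in> CCI \<theta> (frontier K)"
    and X: "\<And>n. X n \<in> CMin \<theta> (- K)" "h_converges X Q" and U: "nbhd U K"
  obtains n where "X n \<in> CMin \<theta> (U - K)"
proof -
  obtain e where e: "e > 0" "tube K e \<subseteq> U" using nbhd_subset_tube[OF K U] .
  have "compact Q" using Q by (simp add: CCI_def)
  then obtain n where "X n \<subseteq> tube Q e"
    using eventually_happens[OF h_converges_tubes[OF X(2) CMinD(2)[OF X(1)] _ e(1)]] by auto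
  then have "X n \<subseteq> U - K" using CCI_near[OF K(1) Q] e(2) CMinD(6)[OF X(1)] by blast
  then show thesis using that CMin_mono[OF X(1)] by blast
qed

lemma accumulates_near:
  assumes K: "compact K" "K \<noteq> {}" and A: "h_accumulates \<AA> \<BB>" "\<AA> \<subseteq> CMin \<theta> S"
    and B: "\<BB> \<subseteq> CCI \<theta> (frontier K)" and U: "nbhd U K"
  obtains X where "X \<in> \<AA>" "X \<subseteq> U"
proof -
  obtain e where e: "e > 0" "tube K e \<subseteq> U" using nbhd_subset_tube[OF K U] .
  obtain Q where Q: "Q \<in> \<BB>" "Q \<in> h_closure \<AA>" using A(1) by (auto simp: h_accumulates_def)
  then obtain X where X: "X \<in> \<AA>" "hdist Q X < e" using e(1) by (auto simp: h_closure_def)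
  have "compact X" using A(2) X(1) CMinD(2) by blast
  then have "X \<subseteq> tube Q e" using subset_tube_hdist X(2) less_imp_le by blast
  then have "X \<subseteq> tube K e" using CCI_near[OF K(1)] Q(1) B by blast
  then show thesis using that X(1) e(2) by blast
qed

lemma accumulatesI:
  fixes K :: "'a::metric_space set"
  assumes M: "locally compact (UNIV :: 'a set)" and F: "flow \<theta>" and K: "compact K" "K \<noteq> {}"
    and A: "\<And>d. d > 0 \<Longrightarrow> \<exists>X\<in>\<AA>. X \<in> CMin \<theta> (tube K d - K)"
  shows "h_accumulates \<AA> (CCI \<theta> (frontier K))"
    and "\<AA> \<subseteq> Eq \<theta> UNIV \<Longrightarrow> h_accumulates \<AA> (Eq \<theta> (frontier K))"
proof -
  have "\<forall>n. \<exists>X. X \<in> \<AA> \<and> X \<in> CMin \<theta> (tube K (inverse (real (Suc n))) - K)"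
    using A by (meson inverse_positive_iff_positive of_nat_0_less_iff zero_less_Suc)
  from choice[OF this] obtain X where
    X: "\<And>n. X n \<in> \<AA>" "\<And>n. X n \<in> CMin \<theta> (tube K (inverse (real (Suc n))) - K)" by blast
  obtain r Q where rQ: "Q \<in> CCI \<theta> (frontier K)" "h_converges (\<lambda>n. X (r n)) Q"
    "(\<forall>n. X n \<in> Eq \<theta> UNIV) \<longrightarrow> Q \<in> Eq \<theta> (frontier K)"
    by (rule minimal_sets_accumulate[OF M F K X(2)]) (rule that)
  have "Q \<in> h_closure \<AA>"
    unfolding h_closure_def
  proof (intro CollectI conjI allI impI)
    show "Q \<in> Cpt" using rQ(1) by (simp add: CCI_def Cpt_def)
    fix e :: real assume "e > 0"
    then obtain n where "hdist (X (r n)) Q < e"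
      using eventually_happens[OF order_tendstoD(2)[OF rQ(2)[unfolded h_converges_def]]] by auto
    then show "\<exists>Z\<in>\<AA>. hdist Q Z < e" using X(1) by (auto simp: hdist_commute)
  qed
  then show "h_accumulates \<AA> (CCI \<theta> (frontier K))"
    and "\<AA> \<subseteq> Eq \<theta> UNIV \<Longrightarrow> h_accumulates \<AA> (Eq \<theta> (frontier K))"
    using rQ(1,3) X(1) by (auto simp: h_accumulates_def)
qed

text \<open>The kinds are numbered so that the choice of a kind can be made by a finite pigeonhole argument.\<close>

definition kind :: "nat \<Rightarrow> (real \<Rightarrow> 'a::metric_space \<Rightarrow> 'a) \<Rightarrow> 'a set \<Rightarrow> 'a set set" where
  "kind k = (if k = 0 then Eq else if k = 1 then Per else Am)"

text \<open>Isolated minimal sets near \<open>K\<close> each satisfy one of finitely many conditions and are of one of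
  three kinds, so one combination occurs arbitrarily near \<open>K\<close>.\<close>

lemma isolated_minimals_accumulate:
  fixes K :: "'a::metric_space set"
  assumes M: "locally compact (UNIV :: 'a set)" and F: "flow \<theta>" and K: "compact K" "K \<noteq> {}"
    and iso: "\<And>d. d > 0 \<Longrightarrow> \<exists>X\<in>CMin \<theta> (tube K d - K). isolated_from_minimals \<theta> X"
  shows "\<exists>j\<in>{1..6}. condition7 \<theta> j K \<or> condition8 \<theta> j K \<or> condition9 \<theta> j K"
proof -
  define P where "P n q \<longleftrightarrow> (\<exists>X. X \<in> kind (fst q) \<theta> (tube K (inverse (real (Suc n))) - K) \<and>
      condition \<theta> (snd q) X)" for n :: nat and q :: "nat \<times> nat"
  have "\<exists>q\<in>{0..2} \<times> {1..6}. P n q" for n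
  proof -
    have "inverse (real (Suc n)) > 0" by simp
    from iso[OF this] obtain X where X: "X \<in> CMin \<theta> (tube K (inverse (real (Suc n))) - K)"
      "isolated_from_minimals \<theta> X" by blast
    obtain i where i: "i \<in> {1..6}" "condition \<theta> i X"
      using isolated_conditions[OF M F CMinD(2,3,5)[OF X(1)] X(2)] by blast
    consider "X \<in> kind 0 \<theta> (tube K (inverse (real (Suc n))) - K)"
      | "X \<in> kind 1 \<theta> (tube K (inverse (real (Suc n))) - K)"
      | "X \<in> kind 2 \<theta> (tube K (inverse (real (Suc n))) - K)"
      using X(1) unfolding CMin_cases[OF F] kind_def by auto
    then have "\<exists>k\<in>{0..2}. X \<in> kind k \<theta> (tube K (inverse (real (Suc n))) - K)"
    proof cases
      case 1 then show ?thesis by (intro bexI[of _ 0]) auto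
    next
      case 2 then show ?thesis by (intro bexI[of _ 1]) auto
    next
      case 3 then show ?thesis by (intro bexI[of _ 2]) auto
    qed
    then obtain k where "k \<in> {0..2}" "X \<in> kind k \<theta> (tube K (inverse (real (Suc n))) - K)" by blast
    then have "P n (k, i)" "(k, i) \<in> {0..2} \<times> {1..6}" using i unfolding P_def by auto
    then show ?thesis by blast
  qed
  then have "\<exists>\<^sub>F n in sequentially. \<exists>q\<in>{0..2} \<times> {1..6}. P n q" by simp
  then have "\<exists>q\<in>{0..2} \<times> {1..6}. \<exists>\<^sub>F n in sequentially. P n q"
    by (rule frequently_bex_finite[rotated]) simp
  then obtain k i where ki: "k \<in> {0..2}" "i \<in> {1..6}" "\<exists>\<^sub>F n in sequentially. P n (k, i)" by auto
  have mono: "X \<in> kind k \<theta> T" if "X \<in> kind k \<theta> S" "S \<subseteq> T" for X S T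
    using that by (auto simp: kind_def Eq_def Per_def Am_def split: if_splits)
  have "\<exists>X. X \<in> kind k \<theta> (tube K (inverse (real (Suc n))) - K) \<and> condition \<theta> i X" for n
  proof -
    obtain m where m: "m \<ge> n" "P m (k, i)" using ki(3) unfolding frequently_sequentially by blast
    then obtain X where X: "X \<in> kind k \<theta> (tube K (inverse (real (Suc m))) - K)" "condition \<theta> i X"
      unfolding P_def by auto
    have "inverse (real (Suc m)) \<le> inverse (real (Suc n))"
      using m(1) by (intro le_imp_inverse_le) auto
    then have "tube K (inverse (real (Suc m))) - K \<subseteq> tube K (inverse (real (Suc n))) - K"
      using tube_mono by blast
    then show ?thesis using mono X by blast
  qed
  then have "\<forall>n. \<exists>X. X \<in> kind k \<theta> (tube K (inverse (real (Suc n))) - K) \<and> condition \<theta> i X"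
    by (rule allI)
  from choice[OF this] obtain X
    where X: "\<And>n. X n \<in> kind k \<theta> (tube K (inverse (real (Suc n))) - K)" "\<And>n. condition \<theta> i (X n)"
    by blast
  have "X n \<in> CMin \<theta> (tube K (inverse (real (Suc n))) - K)" for n
    using X(1)[of n] unfolding CMin_cases[OF F] kind_def by (auto split: if_splits)
  then obtain r Q where rQ: "Q \<in> CCI \<theta> (frontier K)" "h_converges (\<lambda>n. X (r n)) Q"
    "(\<forall>n. X n \<in> Eq \<theta> UNIV) \<longrightarrow> Q \<in> Eq \<theta> (frontier K)"
    by (rule minimal_sets_accumulate[OF M F K]) (rule that)
  have X': "X n \<in> kind k \<theta> (- K)" for n using mono[OF X(1)] by blast
  consider "k = 0" | "k = 1" | "k = 2" using ki(1) by fastforce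
  then show ?thesis
  proof cases
    case 1
    have eq: "X n \<in> Eq \<theta> (- K)" for n using X'[of n] 1 by (simp add: kind_def)
    then have "\<forall>n. \<exists>z. X n = {z}" by (fastforce simp: Eq_def)
    from choice[OF this] obtain z where z: "\<And>n. X n = {z n}" by blast
    have Q: "Q \<in> Eq \<theta> (frontier K)" using rQ(3) eq Eq_mono by blast
    then obtain q where q: "Q = {q}" by (auto simp: Eq_def)
    have "condition7 \<theta> i K"
      unfolding condition7_def
      using eq Q rQ(2) X(2) by (intro exI[of _ "\<lambda>n. z (r n)"] exI[of _ q]) (simp add: z q)
    then show ?thesis using ki(2) by blast
  next
    case 2
    have "condition8 \<theta> i K"
      unfolding condition8_def
      using X' rQ X(2) 2 by (intro exI[of _ "\<lambda>n. X (r n)"] exI[of _ Q]) (simp add: kind_def)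
    then show ?thesis using ki(2) by blast
  next
    case 3
    have "condition9 \<theta> i K"
      unfolding condition9_def
      using X' rQ X(2) 3 by (intro exI[of _ "\<lambda>n. X (r n)"] exI[of _ Q]) (simp add: kind_def)
    then show ?thesis using ki(2) by blast
  qed
qed

lemma isolated_minimal_near:
  assumes F: "flow \<theta>" and K: "compact K" "K \<noteq> {}"
    and c: "condition7 \<theta> j K \<or> condition8 \<theta> j K \<or> condition9 \<theta> j K" and U: "nbhd U K"
  obtains X where "X \<in> CMin \<theta> (U - K)" "isolated_from_minimals \<theta> X"
proof -
  have "\<exists>X Q. (\<forall>n::nat. X n \<in> CMin \<theta> (- K)) \<and> Q \<in> CCI \<theta> (frontier K) \<and> h_converges X Q \<and>
      (\<forall>n. condition \<theta> j (X n))"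
    using c
  proof (elim disjE)
    assume "condition7 \<theta> j K"
    then show ?thesis
      using Eq_subset_CMin[OF F] Eq_frontier_subset_CCI[OF F]
      unfolding condition7_def by (metis (no_types, lifting) subsetD)
  next
    assume "condition8 \<theta> j K"
    then show ?thesis using Per_subset_CMin[OF F] unfolding condition8_def by blast
  next
    assume "condition9 \<theta> j K"
    then show ?thesis using Am_subset_CMin unfolding condition9_def by blast
  qed
  then obtain X Q where XQ: "\<And>n::nat. X n \<in> CMin \<theta> (- K)" "Q \<in> CCI \<theta> (frontier K)"
    "h_converges X Q" "\<And>n. condition \<theta> j (X n)" by blast
  obtain n where "X n \<in> CMin \<theta> (U - K)" using h_converges_near[OF K XQ(2,1,3) U] .
  then show thesis using that condition_isolated[OF F XQ(4)] by blast
qed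

lemma condition10_near:
  assumes F: "flow \<theta>" and K: "compact K" "K \<noteq> {}" and c: "condition10 \<theta> K"
  obtains U where "nbhd U K" "c_dense_in_itself (CMin \<theta> (U - K))"
    "\<And>V. nbhd V K \<Longrightarrow> \<exists>X. X \<in> CMin \<theta> (V - K)"
proof -
  obtain U where U: "open U" "K \<subseteq> U" "c_dense_in_itself (CMin \<theta> (U - K))" and
    c4: "condition10_1 \<theta> U K \<or> condition10_2 \<theta> U K \<or> condition10_3 \<theta> U K \<or> condition10_4 \<theta> U K"
    using c unfolding condition10_def by blast
  have "\<exists>\<AA>. \<AA> \<subseteq> CMin \<theta> (U - K) \<and> h_accumulates \<AA> (CCI \<theta> (frontier K))"
    using c4
  proof (elim disjE)
    assume "condition10_1 \<theta> U K"
    then have "h_accumulates (Eq \<theta> (U - K)) (CCI \<theta> (frontier K))"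
      using Eq_frontier_subset_CCI[OF F, of "frontier K"]
      unfolding condition10_1_def h_accumulates_def by blast
    then show ?thesis using Eq_subset_CMin[OF F] by blast
  next
    assume "condition10_2 \<theta> U K"
    then show ?thesis using Per_subset_CMin[OF F] unfolding condition10_2_def by blast
  next
    assume "condition10_3 \<theta> U K"
    then show ?thesis using Am_subset_CMin unfolding condition10_3_def by blast
  next
    assume "condition10_4 \<theta> U K"
    then show ?thesis
      using Am_subset_CMin[of \<theta> "U - K"] unfolding condition10_4_def by (meson subset_trans)
  qed
  then obtain \<AA> where \<AA>: "\<AA> \<subseteq> CMin \<theta> (U - K)" "h_accumulates \<AA> (CCI \<theta> (frontier K))" by blast
  have "\<exists>X. X \<in> CMin \<theta> (V - K)" if V: "nbhd V K" for V
  proof -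
    obtain X where "X \<in> \<AA>" "X \<subseteq> V" using accumulates_near[OF K \<AA>(2,1) order_refl V] .
    then show ?thesis using \<AA>(1) unfolding CMin_def by blast
  qed
  moreover have "nbhd U K" using U(1,2) by (simp add: nbhd_def interior_open)
  ultimately show thesis using that U(3) by blast
qed

lemma not_isolated_if_minimals_near:
  assumes "\<And>V. nbhd V K \<Longrightarrow> \<exists>X. X \<in> CMin \<theta> (V - K)"
  shows "\<not> isolated_from_minimals \<theta> K"
  using assms unfolding isolated_from_minimals_def CMin_def by blast

text \<open>Near a member isolated from minimals the family would consist of that member alone.\<close>

lemma c_dense_no_isolated:
  assumes F: "flow \<theta>" and c: "c_dense_in_itself (CMin \<theta> S)" and X: "X \<in> CMin \<theta> S"
  shows "\<not> isolated_from_minimals \<theta> X"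
proof
  assume "isolated_from_minimals \<theta> X"
  then obtain V where V: "nbhd V X" "\<And>N. minimal_set \<theta> N \<Longrightarrow> \<not> N \<subseteq> V - X"
    unfolding isolated_from_minimals_def by blast
  obtain d where d: "d > 0" "tube X d \<subseteq> V" using nbhd_subset_tube[OF CMinD(2,3)[OF X] V(1)] .
  have "Y = X" if Y: "Y \<in> CMin \<theta> S" "Y \<subseteq> tube X d" for Y
  proof (rule ccontr)
    assume "Y \<noteq> X"
    then have "Y \<inter> X = {}" using CMin_disjoint[OF F Y(1) X] by blast
    then show False using V(2)[OF CMinD(1)[OF Y(1)]] Y(2) d(2) by blast
  qed
  then have "{Y\<in>CMin \<theta> S. Y \<subseteq> tube X d} \<subseteq> {X}" by blast
  then have "finite {Y\<in>CMin \<theta> S. Y \<subseteq> tube X d}" by (rule finite_subset) simp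
  moreover have "(UNIV :: real set) \<lesssim> {Y\<in>CMin \<theta> S. Y \<subseteq> tube X d}"
    using c X d(1) unfolding c_dense_iff_tubes[OF F order_refl] by blast
  ultimately show False using real_lepoll_infinite by blast
qed


section \<open>Windows that shrink to the set\<close>

lemma tube_avoids_initial_windows:
  fixes W :: "nat \<Rightarrow> 'a::metric_space set"
  assumes "\<And>n. \<exists>\<delta>>0. tube K \<delta> \<inter> W n = {}"
  shows "\<exists>\<delta>>0. \<forall>n<N. tube K \<delta> \<inter> W n = {}"
proof (induction N)
  case 0 show ?case by (intro exI[of _ 1]) simp
next
  case (Suc N)
  then obtain d where d: "d > 0" "\<forall>n<N. tube K d \<inter> W n = {}" by blast
  obtain d' where d': "d' > 0" "tube K d' \<inter> W N = {}" using assms by blast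
  have "tube K (min d d') \<subseteq> tube K d" "tube K (min d d') \<subseteq> tube K d'" by (rule tube_mono, simp)+
  then have "\<forall>n<Suc N. tube K (min d d') \<inter> W n = {}"
    using d(2) d'(2) by (auto simp: less_Suc_eq)
  then show ?case using d(1) d'(1) by (intro exI[of _ "min d d'"]) simp
qed

text \<open>Only windows with a large index come close to \<open>K\<close>, and these are contained in small tubes.\<close>

lemma bi_stable_windows:
  fixes W :: "nat \<Rightarrow> 'a::metric_space set"
  assumes F: "flow \<theta>" and K: "compact K" "K \<noteq> {}"
    and away: "\<And>n. \<exists>\<delta>>0. tube K \<delta> \<inter> W n = {}" and W: "\<And>n. W n \<subseteq> tube K (inverse (real (Suc n)))"
    and P: "\<And>X. X \<in> P \<Longrightarrow> \<exists>n. X \<in> CMin \<theta> (W n)"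
  shows "bi_stable_rel \<theta> K (\<Union>P)"
  unfolding bi_stable_rel_def
proof (intro allI impI)
  fix U assume "nbhd U K"
  then obtain e where e: "e > 0" "tube K e \<subseteq> U" by (rule nbhd_subset_tube[OF K])
  obtain N where N: "inverse (real (Suc N)) < e" using reals_Archimedean e(1) by blast
  obtain \<delta> where \<delta>: "\<delta> > 0" "\<forall>n<N. tube K \<delta> \<inter> W n = {}"
    using tube_avoids_initial_windows[where K = K and W = W and N = N, OF away] by blast
  have "orbit \<theta> x \<subseteq> U" if x: "x \<in> \<Union>P \<inter> tube K \<delta>" for x
  proof -
    obtain X n where X: "x \<in> X" "X \<in> CMin \<theta> (W n)" using x P by blast
    have "N \<le> n" using \<delta>(2) x X CMinD(6)[OF X(2)] by (intro leI notI) blast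
    then have "inverse (real (Suc n)) \<le> inverse (real (Suc N))" by (intro le_imp_inverse_le) auto
    then have "inverse (real (Suc n)) \<le> e" using N by linarith
    then have "W n \<subseteq> tube K e" by (rule subset_trans[OF W tube_mono])
    moreover have "orbit \<theta> x \<subseteq> X" by (rule orbit_subset[OF F CMinD(5)[OF X(2)] X(1)])
    ultimately show ?thesis using CMinD(6)[OF X(2)] e(2) by blast
  qed
  then show "\<exists>V. nbhd V K \<and> (\<Union>x\<in>\<Union>P \<inter> V. orbit \<theta> x) \<subseteq> U"
    using nbhd_tube[OF \<delta>(1), of K] by blast
qed

lemma periods_of_windows_tend_to_infinity:
  fixes W :: "nat \<Rightarrow> 'a::metric_space set"
  assumes F: "flow \<theta>" and K: "K \<noteq> {}"
    and away: "\<And>n. \<exists>\<delta>>0. tube K \<delta> \<inter> W n = {}"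
    and long: "\<And>n \<gamma> p. \<gamma> \<in> Per \<theta> (W n) \<Longrightarrow> has_period \<theta> \<gamma> p \<Longrightarrow> real n < p"
    and \<gamma>: "\<And>k. \<exists>n. \<gamma> k \<in> Per \<theta> (W n)" and lim: "(\<lambda>k. setdist (\<gamma> k) K) \<longlonglongrightarrow> 0"
  shows "filterlim (\<lambda>k. period \<theta> (\<gamma> k)) at_top sequentially"
  unfolding filterlim_at_top
proof
  fix Z :: real
  obtain N where N: "Z < real N" using reals_Archimedean2 by blast
  obtain \<delta> where \<delta>: "\<delta> > 0" "\<forall>n<N. tube K \<delta> \<inter> W n = {}"
    using tube_avoids_initial_windows[where K = K and W = W and N = N, OF away] by blast
  show "eventually (\<lambda>k. Z \<le> period \<theta> (\<gamma> k)) sequentially"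
    using order_tendstoD(2)[OF lim \<delta>(1)]
  proof (rule eventually_mono)
    fix k assume k: "setdist (\<gamma> k) K < \<delta>"
    obtain n where n: "\<gamma> k \<in> Per \<theta> (W n)" using \<gamma> by blast
    obtain p where p: "has_period \<theta> (\<gamma> k) p" using n by (auto simp: Per_def)
    have "\<gamma> k \<noteq> {}" using n Per_subset_CMin[OF F] CMinD(3) by blast
    then obtain x y where xy: "x \<in> \<gamma> k" "y \<in> K" "dist x y < \<delta>" by (rule setdist_ltE[OF k _ K])
    have "x \<in> tube K \<delta>" using infdist_le2[OF xy(2), of x \<delta>] xy(3) by (simp add: tube_def)
    moreover have "x \<in> W n" using xy(1) n by (auto simp: Per_def)
    ultimately have "N \<le> n" using \<delta>(2) by (intro leI notI) blast
    moreover have "period \<theta> (\<gamma> k) = p"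
      unfolding period_def using p has_period_unique[OF F] by (intro the_equality) blast+
    ultimately show "Z \<le> period \<theta> (\<gamma> k)" using long[OF n p] N by linarith
  qed
qed

text \<open>Being a subset of a fixed open set is an open condition on compact sets.\<close>

lemma h_open_Union:
  assumes F: "flow \<theta>" and W: "\<And>n::nat. open (W n)"
    and sub: "\<And>S. \<T> S \<subseteq> CMin \<theta> S" and iff: "\<And>S X. X \<in> \<T> S \<longleftrightarrow> X \<in> \<T> UNIV \<and> X \<subseteq> S"
  shows "h_open_in (\<Union>n. \<T> (W n)) (\<T> UNIV)"
  unfolding h_open_in_def
proof (intro conjI ballI)
  show "(\<Union>n. \<T> (W n)) \<subseteq> \<T> UNIV" using iff[of _ "W _"] by (intro UN_least subsetI) simp
  fix Y assume "Y \<in> (\<Union>n. \<T> (W n))"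
  then obtain n where Y: "Y \<in> \<T> (W n)" by blast
  then have Y': "Y \<in> CMin \<theta> (W n)" using sub by blast
  obtain e where e: "e > 0" "tube Y e \<subseteq> W n"
    using tube_subset_open[OF CMinD(2,3)[OF Y'] W[of n] CMinD(6)[OF Y']] .
  have "Z \<in> \<T> (W n)" if Z: "Z \<in> \<T> UNIV" "hdist Y Z < e" for Z
  proof -
    have "compact Z" using CMinD(2)[OF subsetD[OF sub Z(1)]] .
    then have "Z \<subseteq> W n" using subset_tube_hdist[of Z Y e] Z(2) e(2) by auto
    then show ?thesis using iff[of Z "W n"] Z(1) by simp
  qed
  then show "\<exists>e>0. \<forall>Z\<in>\<T> UNIV. hdist Y Z < e \<longrightarrow> Z \<in> (\<Union>n. \<T> (W n))" using e(1) by blast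
qed


section \<open>The case without isolated minimal sets\<close>

lemma c_denseI:
  assumes F: "flow \<theta>" and \<CC>: "\<CC> \<subseteq> CMin \<theta> S"
    and c: "\<And>X d. X \<in> \<CC> \<Longrightarrow> d > 0 \<Longrightarrow> \<exists>\<D>. (UNIV :: real set) \<lesssim> \<D> \<and> \<D> \<subseteq> {Y\<in>\<CC>. Y \<subseteq> tube X d}"
  shows "c_dense_in_itself \<CC>"
  unfolding c_dense_iff_tubes[OF F \<CC>]
proof (intro ballI allI impI)
  fix X and d :: real assume "X \<in> \<CC>" "d > 0"
  from c[OF this] obtain \<D>
    where D: "(UNIV :: real set) \<lesssim> \<D>" and sub: "\<D> \<subseteq> {Y\<in>\<CC>. Y \<subseteq> tube X d}" by blast
  show "(UNIV :: real set) \<lesssim> {Y\<in>\<CC>. Y \<subseteq> tube X d}"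
    by (rule lepoll_trans[OF D subset_imp_lepoll[OF sub]])
qed

text \<open>A family of continuum many sets is not the union of two smaller ones.\<close>

lemma one_kind_abounds:
  assumes W: "open W" and cover: "\<And>S. S \<subseteq> W \<Longrightarrow> CMin \<theta> S \<subseteq> \<T> S \<union> \<T>' S"
    and mono: "\<And>S. S \<subseteq> W \<Longrightarrow> \<T>' S \<subseteq> \<T>' W" and few: "\<not> (UNIV :: real set) \<lesssim> \<T>' W"
    and X: "X \<in> CMin \<theta> W" and d: "d > 0"
    and rich: "\<And>d. d > 0 \<Longrightarrow> (UNIV :: real set) \<lesssim> CMin \<theta> (tube X d)"
  obtains d' where "tube X d' \<subseteq> W" "tube X d' \<subseteq> tube X d" "(UNIV :: real set) \<lesssim> \<T> (tube X d')"
proof -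
  obtain d' where d': "0 < d'" "d' \<le> d" "tube X d' \<subseteq> W"
    using shrink_tube[OF CMinD(2,3)[OF X] W CMinD(6)[OF X] d] .
  have "(UNIV :: real set) \<lesssim> \<T> (tube X d') \<union> \<T>' (tube X d')"
    by (rule lepoll_trans[OF rich[OF d'(1)] subset_imp_lepoll[OF cover[OF d'(3)]]])
  moreover have "\<not> (UNIV :: real set) \<lesssim> \<T>' (tube X d')"
    using few lepoll_trans[OF _ subset_imp_lepoll[OF mono[OF d'(3)]]] by blast
  ultimately have "(UNIV :: real set) \<lesssim> \<T> (tube X d')"
    using lepoll_Un_cases[OF infinite_UNIV_char_0] by blast
  then show thesis using that d'(3) tube_mono[OF d'(2)] by blast
qed

lemma c_dense_Union_of_windows:
  fixes W :: "nat \<Rightarrow> 'a::metric_space set"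
  assumes F: "flow \<theta>" and W: "\<And>n. open (W n)"
    and sub: "\<And>S. \<T> S \<subseteq> CMin \<theta> S" and iff: "\<And>S X. X \<in> \<T> S \<longleftrightarrow> X \<in> \<T> UNIV \<and> X \<subseteq> S"
    and cover: "\<And>n S. S \<subseteq> W n \<Longrightarrow> CMin \<theta> S \<subseteq> \<T> S \<union> \<T>' S"
    and mono: "\<And>n S. S \<subseteq> W n \<Longrightarrow> \<T>' S \<subseteq> \<T>' (W n)"
    and few: "\<And>n. \<not> (UNIV :: real set) \<lesssim> \<T>' (W n)"
    and rich: "\<And>n X d. X \<in> CMin \<theta> (W n) \<Longrightarrow> d > 0 \<Longrightarrow> (UNIV :: real set) \<lesssim> CMin \<theta> (tube X d)"
  shows "c_dense_in_itself (\<Union>n. \<T> (W n))"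
proof (rule c_denseI[OF F])
  show "(\<Union>n. \<T> (W n)) \<subseteq> CMin \<theta> UNIV"
  proof
    fix X assume "X \<in> (\<Union>n. \<T> (W n))"
    then obtain n where "X \<in> \<T> (W n)" by blast
    then show "X \<in> CMin \<theta> UNIV" using CMin_mono[OF subsetD[OF sub]] by blast
  qed
  fix X and d :: real assume X: "X \<in> (\<Union>n. \<T> (W n))" "d > 0"
  then obtain n where "X \<in> \<T> (W n)" by blast
  then have X': "X \<in> CMin \<theta> (W n)" using sub by blast
  obtain d' where d': "tube X d' \<subseteq> W n" "tube X d' \<subseteq> tube X d" "(UNIV :: real set) \<lesssim> \<T> (tube X d')"
    by (rule one_kind_abounds[where W = "W n" and \<T> = \<T> and \<T>' = \<T>',
          OF W cover mono few X' X(2) rich[OF X']]; (assumption | rule that))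
  have "Y \<in> {Y\<in>\<Union>n. \<T> (W n). Y \<subseteq> tube X d}" if Y: "Y \<in> \<T> (tube X d')" for Y
  proof -
    have "Y \<in> \<T> UNIV" "Y \<subseteq> tube X d'" using iff[of Y "tube X d'"] Y by simp_all
    then have "Y \<in> \<T> (W n)" "Y \<subseteq> tube X d" using iff[of Y "W n"] d'(1,2) by auto
    then show ?thesis by blast
  qed
  then show "\<exists>\<D>. (UNIV :: real set) \<lesssim> \<D> \<and> \<D> \<subseteq> {Y\<in>\<Union>n. \<T> (W n). Y \<subseteq> tube X d}"
    using d'(3) by blast
qed

text \<open>Here every neighbourhood contains an aperiodic minimal set without aperiodic neighbours, and a
  periodic orbit with less than continuum many periodic neighbours. Around the former nearly all
  minimal sets are periodic, with long periods; around the latter most of them are aperiodic. Windows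
  around such sets, one for each scale, supply the families of condition 10.4.\<close>

lemma condition10_4_windows:
  fixes K :: "'a::metric_space set"
  assumes M: "locally compact (UNIV :: 'a set)" and F: "flow \<theta>" and K: "compact K" "K \<noteq> {}"
    and U0: "open U0" "K \<subseteq> U0"
    and rich: "\<And>X d. X \<in> CMin \<theta> (U0 - K) \<Longrightarrow> d > 0 \<Longrightarrow> (UNIV :: real set) \<lesssim> CMin \<theta> (tube X d)"
    and nA: "\<And>U. open U \<Longrightarrow> K \<subseteq> U \<Longrightarrow> U \<subseteq> U0 \<Longrightarrow> \<not> c_dense_in_itself (Am \<theta> (U - K))"
    and nP: "\<And>U. open U \<Longrightarrow> K \<subseteq> U \<Longrightarrow> U \<subseteq> U0 \<Longrightarrow> \<not> c_dense_in_itself (Per \<theta> (U - K))"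
  shows "condition10_4 \<theta> U0 K"
proof -
  define U where "U n = U0 \<inter> {y. infdist y K < inverse (real (Suc n))}" for n
  have U: "open (U n)" "K \<subseteq> U n" "U n \<subseteq> U0" "U n \<subseteq> tube K (inverse (real (Suc n)))" for n
    using U0 open_infdist_less by (auto simp: U_def tube_def)
  have cl: "closed K" by (rule compact_imp_closed[OF K(1)])
  have UK: "open (U n - K)" for n using U(1) cl by (rule open_Diff)
  \<comment> \<open>Windows stay away from \<open>K\<close>, so that a sequence approaching \<open>K\<close> runs through infinitely many of
    them, and contain no equilibria, so that only two kinds compete.\<close>
  define window where "window n W \<longleftrightarrow>
    open W \<and> W \<subseteq> U n - K \<and> (\<exists>\<delta>>0. tube K \<delta> \<inter> W = {}) \<and> Eq \<theta> W = {}" for n W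
  have window: "\<exists>W. window n W \<and> X \<in> CMin \<theta> W \<and> W \<subseteq> tube X d"
    if X: "X \<in> CMin \<theta> (U n - K)" "X \<notin> Eq \<theta> UNIV" "d > 0" for X n d
  proof -
    obtain d1 where d1: "d1 > 0" "Eq \<theta> (tube X d1) = {}" using no_equilibria_near[OF F X(1,2)] .
    have "min d d1 > 0" using d1(1) X(3) by simp
    then obtain d2 where d2: "0 < d2" "d2 \<le> min d d1" "tube X d2 \<subseteq> U n - K"
      by (rule shrink_tube[OF CMinD(2,3)[OF X(1)] UK CMinD(6)[OF X(1)]])
    define W where "W = {y. infdist y X < d2}"
    have W: "open W" "W \<subseteq> tube X d2" by (auto simp: W_def tube_def open_infdist_less)
    have "K \<inter> tube X d2 = {}" using d2(3) by blast
    then obtain \<delta> where \<delta>: "\<delta> > 0" "tube K \<delta> \<inter> tube X d2 = {}"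
      by (rule tube_avoids_closed[OF K closed_tube])
    have sub: "tube X d2 \<subseteq> tube X d" "tube X d2 \<subseteq> tube X d1" by (rule tube_mono, use d2(2) in simp)+
    have "Eq \<theta> W = {}" using kinds_mono(1)[OF subset_trans[OF W(2) sub(2)], of \<theta>] d1(2) by simp
    then have "window n W" using W d2(3) \<delta> unfolding window_def by blast
    moreover have "X \<subseteq> W" using d2(1) by (auto simp: W_def)
    then have "X \<in> CMin \<theta> W" by (rule CMin_mono[OF X(1)])
    ultimately show ?thesis using W(2) sub(1) by blast
  qed
  have winD: "open W" "W \<subseteq> U n - K" "\<exists>\<delta>>0. tube K \<delta> \<inter> W = {}" "Eq \<theta> W = {}" if "window n W" for n W
    using that by (auto simp: window_def)
  have rich': "(UNIV :: real set) \<lesssim> CMin \<theta> (tube X d)" if "window n W" "X \<in> CMin \<theta> W" "d > 0" for n W X d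
    using rich[OF CMin_mono[OF that(2)] that(3)] winD(2)[OF that(1)] U(3)[of n] CMinD(6)[OF that(2)]
    by blast
  have cover: "CMin \<theta> S \<subseteq> Per \<theta> S \<union> Am \<theta> S" "CMin \<theta> S \<subseteq> Am \<theta> S \<union> Per \<theta> S"
    if "window n W" "S \<subseteq> W" for n W S
    using winD(4)[OF that(1)] kinds_mono(1)[OF that(2), of \<theta>] by (auto simp: CMin_cases[OF F])
  have real_ne: "A \<noteq> {}" if "(UNIV :: real set) \<lesssim> A" for A :: "'a set set"
    using real_lepoll_infinite[OF that] by auto
  have "\<forall>n. \<exists>W. window n W \<and> \<not> (UNIV :: real set) \<lesssim> Am \<theta> W \<and> Per \<theta> W \<noteq> {} \<and>
      (\<forall>\<gamma> p. \<gamma> \<in> Per \<theta> W \<longrightarrow> has_period \<theta> \<gamma> p \<longrightarrow> real n < p)"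
  proof
    fix n
    obtain L d where L: "L \<in> Am \<theta> (U n - K)" "d > 0"
      "\<And>Y. Y \<in> Am \<theta> (U n - K) \<Longrightarrow> Y \<subseteq> tube L d \<Longrightarrow> Y = L"
      by (rule Am_isolated_or_c_dense[OF M F UK nA[OF U(1-3)]]) (rule that)
    have L': "L \<in> CMin \<theta> (U n - K)" "L \<notin> Eq \<theta> UNIV" using L(1) Am_subset_CMin by (auto simp: Am_def)
    \<comment> \<open>Within this radius all periods exceed \<open>n\<close>, which forces them to infinity along the windows.\<close>
    have "real (Suc n) > 0" by simp
    then obtain d1 where d1: "d1 > 0"
      "\<And>\<gamma> p. \<gamma> \<in> Per \<theta> (tube L d1) \<Longrightarrow> has_period \<theta> \<gamma> p \<Longrightarrow> real (Suc n) < p"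
      by (rule Per_period_near_Am[OF F L(1)]) (rule that)
    have "min d d1 > 0" using L(2) d1(1) by simp
    from window[OF L' this] obtain W where
      W: "window n W" "L \<in> CMin \<theta> W" "W \<subseteq> tube L (min d d1)" by blast
    have sub: "W \<subseteq> tube L d" "W \<subseteq> tube L d1"
      by (rule subset_trans[OF W(3) tube_mono], simp)+
    have Am_W: "Am \<theta> W \<subseteq> {L}"
    proof
      fix Y assume Y: "Y \<in> Am \<theta> W"
      then have "Y \<subseteq> tube L d" using sub(1) by (auto simp: Am_def)
      then show "Y \<in> {L}" using L(3) kinds_mono(3)[OF winD(2)[OF W(1)]] Y by blast
    qed
    have few: "\<not> (UNIV :: real set) \<lesssim> Am \<theta> W"
      using real_lepoll_infinite finite_subset[OF Am_W] by blast
    obtain d' where d': "tube L d' \<subseteq> W" "(UNIV :: real set) \<lesssim> Per \<theta> (tube L d')"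
      by (rule one_kind_abounds[where W = W and \<T> = "Per \<theta>" and \<T>' = "Am \<theta>",
          OF winD(1)[OF W(1)] cover(1)[OF W(1)] kinds_mono(3)
          few W(2) zero_less_one rich'[OF W(1,2)]]; (assumption | rule that))
    then have "Per \<theta> W \<noteq> {}" using real_ne[OF d'(2)] kinds_mono(2)[OF d'(1), of \<theta>] by blast
    moreover have "real n < p" if "\<gamma> \<in> Per \<theta> W" "has_period \<theta> \<gamma> p" for \<gamma> p
      using d1(2)[OF subsetD[OF kinds_mono(2)[OF sub(2)] that(1)] that(2)] by simp
    ultimately show "\<exists>W. window n W \<and> \<not> (UNIV :: real set) \<lesssim> Am \<theta> W \<and> Per \<theta> W \<noteq> {} \<and>
      (\<forall>\<gamma> p. \<gamma> \<in> Per \<theta> W \<longrightarrow> has_period \<theta> \<gamma> p \<longrightarrow> real n < p)" using W(1) few by blast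
  qed
  from choice[OF this] obtain W where "\<forall>n. window n (W n) \<and> \<not> (UNIV :: real set) \<lesssim> Am \<theta> (W n) \<and>
      Per \<theta> (W n) \<noteq> {} \<and> (\<forall>\<gamma> p. \<gamma> \<in> Per \<theta> (W n) \<longrightarrow> has_period \<theta> \<gamma> p \<longrightarrow> real n < p)" ..
  then have W: "window n (W n)" "\<not> (UNIV :: real set) \<lesssim> Am \<theta> (W n)" "Per \<theta> (W n) \<noteq> {}"
    "\<gamma> \<in> Per \<theta> (W n) \<Longrightarrow> has_period \<theta> \<gamma> p \<Longrightarrow> real n < p" for n \<gamma> p by blast+
  have "\<forall>n. \<exists>V. window n V \<and> \<not> (UNIV :: real set) \<lesssim> Per \<theta> V \<and> Am \<theta> V \<noteq> {}"
  proof
    fix n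
    obtain \<gamma> d where \<gamma>: "\<gamma> \<in> Per \<theta> (U n - K)" "d > 0"
      "\<not> (UNIV :: real set) \<lesssim> {Y\<in>Per \<theta> (U n - K). Y \<subseteq> tube \<gamma> d}"
      using nP[OF U(1-3), of n] unfolding c_dense_iff_tubes[OF F Per_subset_CMin[OF F]] by blast
    have \<gamma>': "\<gamma> \<in> CMin \<theta> (U n - K)" "\<gamma> \<notin> Eq \<theta> UNIV"
      using \<gamma>(1) Per_subset_CMin[OF F] Per_not_Eq[OF F] by blast+
    from window[OF \<gamma>' \<gamma>(2)] obtain V where
      V: "window n V" "\<gamma> \<in> CMin \<theta> V" "V \<subseteq> tube \<gamma> d" by blast
    have "Per \<theta> V \<subseteq> {Y\<in>Per \<theta> (U n - K). Y \<subseteq> tube \<gamma> d}"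
      using V(3) winD(2)[OF V(1)] by (auto simp: Per_def)
    from lepoll_trans[OF _ subset_imp_lepoll[OF this]] \<gamma>(3)
    have nV: "\<not> (UNIV :: real set) \<lesssim> Per \<theta> V" by blast
    obtain d' where d': "tube \<gamma> d' \<subseteq> V" "(UNIV :: real set) \<lesssim> Am \<theta> (tube \<gamma> d')"
      by (rule one_kind_abounds[where W = V and \<T> = "Am \<theta>" and \<T>' = "Per \<theta>",
          OF winD(1)[OF V(1)] cover(2)[OF V(1)] kinds_mono(2)
          nV V(2) zero_less_one rich'[OF V(1,2)]]; (assumption | rule that))
    then have "Am \<theta> V \<noteq> {}" using real_ne[OF d'(2)] kinds_mono(3)[OF d'(1), of \<theta>] by blast
    then show "\<exists>V. window n V \<and> \<not> (UNIV :: real set) \<lesssim> Per \<theta> V \<and> Am \<theta> V \<noteq> {}"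
      using V(1) nV by blast
  qed
  from choice[OF this] obtain V
    where V: "\<And>n. window n (V n) \<and> \<not> (UNIV :: real set) \<lesssim> Per \<theta> (V n) \<and> Am \<theta> (V n) \<noteq> {}" by blast
  then have V: "window n (V n)" "\<not> (UNIV :: real set) \<lesssim> Per \<theta> (V n)" "Am \<theta> (V n) \<noteq> {}" for n
    by blast+
  define P A where "P = (\<Union>n. Per \<theta> (W n))" and "A = (\<Union>n. Am \<theta> (V n))"
  have wsub: "Y \<subseteq> U0 - K" "Y \<subseteq> tube K (inverse (real (Suc n)))" if "window n Y" for n Y
    using winD(2)[OF that] U(3,4)[of n] by blast+
  have PU: "P \<subseteq> Per \<theta> (U0 - K)"
    unfolding P_def by (intro UN_least kinds_mono wsub(1)[OF W(1)])
  have AU: "A \<subseteq> Am \<theta> (U0 - K)"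
    unfolding A_def by (intro UN_least kinds_mono wsub(1)[OF V(1)])
  have Pden: "c_dense_in_itself P"
    unfolding P_def
    by (rule c_dense_Union_of_windows[where \<T>' = "Am \<theta>", OF F winD(1)[OF W(1)] Per_subset_CMin[OF F]
          Per_iff cover(1)[OF W(1)] kinds_mono(3) W(2) rich'[OF W(1)]])
  have Aden: "c_dense_in_itself A"
    unfolding A_def
    by (rule c_dense_Union_of_windows[where \<T>' = "Per \<theta>", OF F winD(1)[OF V(1)] Am_subset_CMin
          Am_iff cover(2)[OF V(1)] kinds_mono(2) V(2) rich'[OF V(1)]])
  have acc: "h_accumulates \<AA> (CCI \<theta> (frontier K))"
    if Y: "\<And>n. window n (Y n)" "\<And>n. \<exists>X\<in>\<AA>. X \<in> CMin \<theta> (Y n)" for \<AA> and Y :: "nat \<Rightarrow> 'a set"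
  proof (rule accumulatesI(1)[OF M F K])
    fix d :: real assume "d > 0"
    then obtain n where n: "inverse (real (Suc n)) < d" using reals_Archimedean by blast
    obtain X where X: "X \<in> \<AA>" "X \<in> CMin \<theta> (Y n)" using Y(2) by blast
    have "Y n \<subseteq> tube K d - K"
      using wsub[OF Y(1)[of n]] tube_mono[OF less_imp_le[OF n], of K] by blast
    then show "\<exists>X\<in>\<AA>. X \<in> CMin \<theta> (tube K d - K)"
      using X CMin_mono CMinD(6) by (meson subset_trans)
  qed
  have "\<exists>X\<in>P. X \<in> CMin \<theta> (W n)" "\<exists>X\<in>A. X \<in> CMin \<theta> (V n)" for n
    using W(3)[of n] V(3)[of n] Per_subset_CMin[OF F] Am_subset_CMin unfolding P_def A_def by blast+
  then have Pacc: "h_accumulates P (CCI \<theta> (frontier K))" and Aacc: "h_accumulates A (CCI \<theta> (frontier K))"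
    using acc[OF W(1)] acc[OF V(1)] by blast+
  have Pbi: "bi_stable_rel \<theta> K (\<Union>P)"
    by (rule bi_stable_windows[OF F K winD(3)[OF W(1)] wsub(2)[OF W(1)]])
      (use Per_subset_CMin[OF F] in \<open>auto simp: P_def\<close>)
  have Abi: "bi_stable_rel \<theta> K (\<Union>A)"
    by (rule bi_stable_windows[OF F K winD(3)[OF V(1)] wsub(2)[OF V(1)]])
      (use Am_subset_CMin in \<open>auto simp: A_def\<close>)
  have "filterlim (\<lambda>n. period \<theta> (\<gamma> n)) at_top sequentially"
    if "\<forall>n. \<gamma> n \<in> P" "(\<lambda>n. setdist (\<gamma> n) K) \<longlonglongrightarrow> 0" for \<gamma> :: "nat \<Rightarrow> 'a set"
    by (rule periods_of_windows_tend_to_infinity[OF F K(2) winD(3)[OF W(1)] W(4) _ that(2)])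
      (use that(1) in \<open>auto simp: P_def\<close>)
  moreover have "h_open_in P (Per \<theta> UNIV)"
    unfolding P_def by (rule h_open_Union[OF F winD(1)[OF W(1)] Per_subset_CMin[OF F] Per_iff])
  moreover have "h_open_in A (Am \<theta> UNIV)"
    unfolding A_def by (rule h_open_Union[OF F winD(1)[OF V(1)] Am_subset_CMin Am_iff])
  ultimately show ?thesis
    unfolding condition10_4_def using PU AU Pden Aden Pacc Aacc Pbi Abi by blast
qed

text \<open>If the aperiodic sets or the periodic orbits are absent near \<open>K\<close>, the other of these two kinds is
  open among the minimal sets, as the equilibria form a closed family, and inherits density in itself
  from them. If both are absent, only equilibria remain. If both occur at all scales and
  neither is dense in itself near \<open>K\<close>, the windows apply.\<close>

lemma condition10_if_no_isolated_minimals: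
  fixes K :: "'a::metric_space set"
  assumes M: "locally compact (UNIV :: 'a set)" and F: "flow \<theta>" and K: "compact K" "K \<noteq> {}"
    and ni: "\<not> isolated_from_minimals \<theta> K" and e: "e > 0"
    and all: "\<And>X. X \<in> CMin \<theta> (tube K e - K) \<Longrightarrow> \<not> isolated_from_minimals \<theta> X"
  shows "condition10 \<theta> K"
proof -
  define U0 where "U0 = {y. infdist y K < e}"
  have U0: "open U0" "K \<subseteq> U0" "U0 \<subseteq> tube K e"
    using e by (auto simp: U0_def tube_def open_infdist_less)
  have cl: "closed K" by (rule compact_imp_closed[OF K(1)])
  define adm where "adm U \<longleftrightarrow> open U \<and> K \<subseteq> U \<and> U \<subseteq> U0" for U
  have rich: "(UNIV :: real set) \<lesssim> CMin \<theta> (tube X d)" if X: "X \<in> CMin \<theta> (U0 - K)" "d > 0" for X d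
  proof (rule continuum_many_in_open[OF M F open_Diff[OF U0(1) cl] _ X])
    fix X and d :: real assume X: "X \<in> CMin \<theta> (U0 - K)" "d > 0"
    obtain d' where d': "0 < d'" "d' \<le> d" "tube X d' \<subseteq> U0 - K"
      using shrink_tube[OF CMinD(2,3)[OF X(1)] open_Diff[OF U0(1) cl] CMinD(6)[OF X(1)] X(2)] .
    have "X \<in> CMin \<theta> (tube K e - K)" using X(1) U0(3) by (auto simp: CMin_def)
    from minimals_near_not_isolated[OF M CMinD(2,3)[OF X(1)] all[OF this] d'(1)]
    obtain Y where Y: "Y \<in> CMin \<theta> (tube X d' - X)" .
    have "Y \<noteq> X" using CMinD(3,6)[OF Y] by blast
    moreover have "Y \<subseteq> tube X d" using CMinD(6)[OF Y] tube_mono[OF d'(2), of X] by blast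
    moreover have "Y \<in> CMin \<theta> (U0 - K)" by (rule CMin_mono[OF Y]) (use CMinD(6)[OF Y] d'(3) in blast)
    ultimately show "\<exists>Y\<in>CMin \<theta> (U0 - K). Y \<noteq> X \<and> Y \<subseteq> tube X d" by blast
  qed
  have dense: "c_dense_in_itself (\<T> (U - K))"
    if U: "adm U" and sub: "\<T> (U - K) \<subseteq> CMin \<theta> (U - K)"
      and near: "\<And>X. X \<in> \<T> (U - K) \<Longrightarrow> \<exists>d>0. \<forall>Y\<in>CMin \<theta> (tube X d). Y \<subseteq> U - K \<longrightarrow> Y \<in> \<T> (U - K)" for U \<T>
  proof (rule c_denseI[OF F sub])
    fix X and d :: real assume X: "X \<in> \<T> (U - K)" "d > 0"
    have X': "X \<in> CMin \<theta> (U - K)" using X(1) sub by blast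
    obtain d1 where d1: "d1 > 0" "\<forall>Y\<in>CMin \<theta> (tube X d1). Y \<subseteq> U - K \<longrightarrow> Y \<in> \<T> (U - K)"
      using near[OF X(1)] by blast
    have op: "open (U - K)" using U cl unfolding adm_def by (simp add: open_Diff)
    have "min d d1 > 0" using X(2) d1(1) by simp
    then obtain d' where d': "0 < d'" "d' \<le> min d d1" "tube X d' \<subseteq> U - K"
      by (rule shrink_tube[OF CMinD(2,3)[OF X'] op CMinD(6)[OF X']])
    have t: "tube X d' \<subseteq> tube X d" "tube X d' \<subseteq> tube X d1" by (rule tube_mono, use d'(2) in simp)+
    have "X \<in> CMin \<theta> (U0 - K)" using X' U unfolding adm_def CMin_def by blast
    then have "(UNIV :: real set) \<lesssim> CMin \<theta> (tube X d')" using rich d'(1) by blast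
    moreover have "CMin \<theta> (tube X d') \<subseteq> {Y\<in>\<T> (U - K). Y \<subseteq> tube X d}"
    proof
      fix Y assume Y: "Y \<in> CMin \<theta> (tube X d')"
      then have Y': "Y \<subseteq> tube X d'" by (rule CMinD(6))
      have "Y \<in> CMin \<theta> (tube X d1)" by (rule CMin_mono[OF Y subset_trans[OF Y' t(2)]])
      then have "Y \<in> \<T> (U - K)" using d1(2) Y' d'(3) by blast
      then show "Y \<in> {Y\<in>\<T> (U - K). Y \<subseteq> tube X d}" using Y' t(1) by blast
    qed
    ultimately show "\<exists>\<D>. (UNIV :: real set) \<lesssim> \<D> \<and> \<D> \<subseteq> {Y\<in>\<T> (U - K). Y \<subseteq> tube X d}" by blast
  qed
  have dense_kind: "c_dense_in_itself (\<T> (U - K))"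
    if U: "adm U" and sub: "\<T> (U - K) \<subseteq> CMin \<theta> (U - K)" and ne: "\<And>X. X \<in> \<T> (U - K) \<Longrightarrow> X \<notin> Eq \<theta> UNIV"
      and cover: "CMin \<theta> (U - K) \<subseteq> Eq \<theta> (U - K) \<union> \<T> (U - K)" for U \<T>
  proof (rule dense[where \<T> = \<T>, OF U sub])
    fix X assume X: "X \<in> \<T> (U - K)"
    obtain d where d: "d > 0" "Eq \<theta> (tube X d) = {}"
      using no_equilibria_near[OF F subsetD[OF sub X] ne[OF X]] .
    have "Y \<in> \<T> (U - K)" if Y: "Y \<in> CMin \<theta> (tube X d)" "Y \<subseteq> U - K" for Y
    proof -
      have "Y \<notin> Eq \<theta> (U - K)" using d(2) Eq_mono CMinD(6)[OF Y(1)] by blast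
      then show ?thesis using cover CMin_mono[OF Y] by blast
    qed
    then show "\<exists>d>0. \<forall>Y\<in>CMin \<theta> (tube X d). Y \<subseteq> U - K \<longrightarrow> Y \<in> \<T> (U - K)" using d(1) by blast
  qed
  have CMin_dense: "c_dense_in_itself (CMin \<theta> (U - K))" if "adm U" for U
    by (rule dense[where \<T> = "CMin \<theta>", OF that]) (auto intro: CMin_mono exI[of _ 1])
  have c10: "condition10 \<theta> K" if "adm U" "condition10_1 \<theta> U K \<or> condition10_2 \<theta> U K \<or>
      condition10_3 \<theta> U K \<or> condition10_4 \<theta> U K" for U
    using that CMin_dense[OF that(1)] unfolding condition10_def adm_def by blast
  have adm0: "adm U0" using U0 by (simp add: adm_def)
  have adm_cut: "adm (U \<inter> {y. infdist y K < d})" if "adm U" "d > 0" for U d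
    using that open_infdist_less[of K d] by (auto simp: adm_def)
  have kinds: "kind k \<theta> S \<subseteq> CMin \<theta> S" "X \<in> kind k \<theta> S \<longleftrightarrow> X \<in> kind k \<theta> UNIV \<and> X \<subseteq> S" for k S X
    using Eq_subset_CMin[OF F, of S] Per_subset_CMin[OF F, of S] Am_subset_CMin[of \<theta> S]
      Eq_iff[of X \<theta> S] Per_iff[of X \<theta> S] Am_iff[of X \<theta> S] by (auto simp: kind_def)
  have witness: "\<exists>X\<in>kind k \<theta> (U - K). X \<in> CMin \<theta> (tube K d - K)"
    if ne: "\<And>U. adm U \<Longrightarrow> kind k \<theta> (U - K) \<noteq> {}" and U: "adm U" "d > 0" for k U d
  proof -
    obtain X where X: "X \<in> kind k \<theta> (U \<inter> {y. infdist y K < d} - K)"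
      using ne[OF adm_cut[OF U]] by blast
    then have XC: "X \<in> CMin \<theta> (U \<inter> {y. infdist y K < d} - K)" using kinds(1) by blast
    have "X \<subseteq> U - K" "X \<subseteq> tube K d - K" using CMinD(6)[OF XC] by (auto simp: tube_def)
    moreover have "X \<in> kind k \<theta> UNIV" using X kinds(2) by blast
    ultimately show ?thesis using kinds(2) CMin_mono[OF XC] by blast
  qed
  note acc = accumulatesI(1)[OF M F K witness] and acc_Eq = accumulatesI(2)[OF M F K witness]
  have k: "kind 0 = Eq" "kind 1 = Per" "kind 2 = Am" by (simp_all add: kind_def)
  show ?thesis
  proof (cases "\<exists>U. adm U \<and> Am \<theta> (U - K) = {}")
    case True
    then obtain U where U: "adm U" "Am \<theta> (U - K) = {}" by blast
    show ?thesis
    proof (cases "\<exists>U'. adm U' \<and> Per \<theta> (U' - K) = {}")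
      case True
      then obtain U' where U': "adm U'" "Per \<theta> (U' - K) = {}" by blast
      define V where "V = U \<inter> U'"
      have V: "adm V" using U(1) U'(1) by (auto simp: V_def adm_def)
      then have V': "open V" "K \<subseteq> V" by (simp_all add: adm_def)
      have "V - K \<subseteq> U - K" "V - K \<subseteq> U' - K" by (auto simp: V_def)
      then have "Am \<theta> (V - K) = {}" "Per \<theta> (V - K) = {}"
        using kinds_mono(3)[of "V - K" "U - K" \<theta>] kinds_mono(2)[of "V - K" "U' - K" \<theta>] U(2) U'(2)
        by simp_all
      then have eq: "CMin \<theta> (V - K) = Eq \<theta> (V - K)" by (simp add: CMin_cases[OF F])
      have "\<exists>X\<in>Eq \<theta> (V - K). X \<in> CMin \<theta> (tube K d - K)" if d: "d > 0" for d
      proof -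
        obtain d' where d': "0 < d'" "d' \<le> d" "tube K d' \<subseteq> V"
          by (rule shrink_tube[OF K V' d])
        obtain X where X: "X \<in> CMin \<theta> (tube K d' - K)"
          using minimals_near_not_isolated[OF M K ni d'(1)] .
        have "X \<subseteq> V - K" "X \<subseteq> tube K d - K"
          using CMinD(6)[OF X] d'(3) tube_mono[OF d'(2), of K] by blast+
        then show ?thesis using CMin_mono[OF X] eq by blast
      qed
      moreover have "Eq \<theta> (V - K) \<subseteq> Eq \<theta> UNIV" by (rule kinds_mono) simp
      ultimately have "condition10_1 \<theta> V K"
        unfolding condition10_1_def
        using accumulatesI(2)[OF M F K] CMin_dense[OF V] unfolding eq by blast
      then show ?thesis using c10[OF V] by blast
    next
      case False
      have "c_dense_in_itself (Per \<theta> (U - K))"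
        by (rule dense_kind[where \<T> = "Per \<theta>", OF U(1) Per_subset_CMin[OF F] Per_not_Eq[OF F]])
          (assumption, simp add: CMin_cases[OF F] U(2))
      moreover have "h_accumulates (Per \<theta> (U - K)) (CCI \<theta> (frontier K))"
        using acc[of 1 U] False U(1) unfolding k by blast
      ultimately show ?thesis using c10[OF U(1)] unfolding condition10_2_def by blast
    qed
  next
    case False
    then have Am_near: "adm U \<Longrightarrow> Am \<theta> (U - K) \<noteq> {}" for U by blast
    show ?thesis
    proof (cases "\<exists>U. adm U \<and> c_dense_in_itself (Am \<theta> (U - K))")
      case True
      then obtain U where U: "adm U" "c_dense_in_itself (Am \<theta> (U - K))" by blast
      have "h_accumulates (Am \<theta> (U - K)) (CCI \<theta> (frontier K))"
        using acc[of 2 U] Am_near U(1) unfolding k by blast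
      then show ?thesis using c10[OF U(1)] U(2) unfolding condition10_3_def by blast
    next
      case nA: False
      show ?thesis
      proof (cases "\<exists>U. adm U \<and> c_dense_in_itself (Per \<theta> (U - K)) \<and> (\<forall>U. adm U \<longrightarrow> Per \<theta> (U - K) \<noteq> {})")
        case True
        then obtain U where U: "adm U" "c_dense_in_itself (Per \<theta> (U - K))" by blast
        have "h_accumulates (Per \<theta> (U - K)) (CCI \<theta> (frontier K))"
          using acc[of 1 U] True U(1) unfolding k by blast
        then show ?thesis using c10[OF U(1)] U(2) unfolding condition10_2_def by blast
      next
        case nP: False
        have Per_near: "Per \<theta> (U - K) \<noteq> {}" if U: "adm U" for U
        proof
          assume none: "Per \<theta> (U - K) = {}"
          have "c_dense_in_itself (Am \<theta> (U - K))"
          proof (rule dense_kind[where \<T> = "Am \<theta>", OF U Am_subset_CMin])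
            show "X \<notin> Eq \<theta> UNIV" if "X \<in> Am \<theta> (U - K)" for X using that by (simp add: Am_def)
            show "CMin \<theta> (U - K) \<subseteq> Eq \<theta> (U - K) \<union> Am \<theta> (U - K)"
              unfolding CMin_cases[OF F] none by blast
          qed
          then show False using nA U by blast
        qed
        have "condition10_4 \<theta> U0 K"
          by (rule condition10_4_windows[OF M F K U0(1,2) rich])
            (use nA nP Per_near in \<open>auto simp: adm_def\<close>)
        then show ?thesis using c10[OF adm0] by blast
      qed
    qed
  qed
qed


section \<open>The five alternatives\<close>

lemma exactly_one_of_five:
  assumes "A \<or> B \<or> C \<or> D \<or> E"
    and "\<not> (A \<and> B)" "\<not> (A \<and> C)" "\<not> (A \<and> D)" "\<not> (A \<and> E)" "\<not> (B \<and> C)" "\<not> (B \<and> D)" "\<not> (B \<and> E)"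
      "\<not> (C \<and> D)" "\<not> (C \<and> E)" "\<not> (D \<and> E)"
  shows "\<exists>!i::nat. i < 5 \<and> [A, B, C, D, E] ! i"
proof -
  have eq: "(i < 5 \<and> [A, B, C, D, E] ! i) \<longleftrightarrow>
      (i = 0 \<and> A) \<or> (i = 1 \<and> B) \<or> (i = 2 \<and> C) \<or> (i = 3 \<and> D) \<or> (i = 4 \<and> E)" for i :: nat
    by (auto simp: less_Suc_eq numeral_eq_Suc nth_Cons split: nat.splits)
  consider "A \<and> \<not> B \<and> \<not> C \<and> \<not> D \<and> \<not> E" | "\<not> A \<and> B \<and> \<not> C \<and> \<not> D \<and> \<not> E"
    | "\<not> A \<and> \<not> B \<and> C \<and> \<not> D \<and> \<not> E" | "\<not> A \<and> \<not> B \<and> \<not> C \<and> D \<and> \<not> E"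
    | "\<not> A \<and> \<not> B \<and> \<not> C \<and> \<not> D \<and> E"
    using assms by blast
  then show ?thesis unfolding eq by cases simp_all
qed

theorem theorem1:
  fixes \<theta> :: "real \<Rightarrow> 'a::metric_space \<Rightarrow> 'a" and K :: "'a set"
  assumes "locally compact (UNIV :: 'a set)"
    and "connected (UNIV :: 'a set)"
    and "flow \<theta>"
    and "K \<noteq> {}" and "compact K" and "invariant \<theta> K" and "K \<noteq> UNIV"
  shows "\<exists>!i::nat. i < 5 \<and>
    [ condition \<theta> 1 K,
      condition \<theta> 2 K,
      \<exists>j\<in>{3..6}. condition \<theta> j K,
      \<exists>j\<in>{1..6}. condition7 \<theta> j K \<or> condition8 \<theta> j K \<or> condition9 \<theta> j K,
      condition10 \<theta> K ] ! i"
proof -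
  note M = assms(1) and F = assms(3) and K = assms(5,4)
  let ?C = "\<exists>j\<in>{3..6}. condition \<theta> j K"
  let ?D = "\<exists>j\<in>{1..6}. condition7 \<theta> j K \<or> condition8 \<theta> j K \<or> condition9 \<theta> j K"
  have A: "condition \<theta> 1 K = attractor \<theta> K" and B: "condition \<theta> 2 K = repeller \<theta> K"
    by (auto simp: condition_def)
  have AB: "\<not> (condition \<theta> 1 K \<and> condition \<theta> 2 K)"
    unfolding A B using attractor_not_repeller[OF assms(2) F K assms(7)] by blast
  have ABC: "\<not> condition \<theta> 1 K \<and> \<not> condition \<theta> 2 K" if ?C
    using attractor_excludes_others[OF F K] that unfolding A B by blast
  have D: "\<not> isolated_from_minimals \<theta> K" if c: ?D
  proof (rule not_isolated_if_minimals_near)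
    fix V assume V: "nbhd V K"
    obtain j where j: "condition7 \<theta> j K \<or> condition8 \<theta> j K \<or> condition9 \<theta> j K" using c by blast
    obtain X where "X \<in> CMin \<theta> (V - K)" "isolated_from_minimals \<theta> X"
      using isolated_minimal_near[OF F K j V] .
    then show "\<exists>X. X \<in> CMin \<theta> (V - K)" by blast
  qed
  have E: "\<not> isolated_from_minimals \<theta> K" if c: "condition10 \<theta> K"
  proof (rule condition10_near[OF F K c])
    fix U assume "\<And>V. nbhd V K \<Longrightarrow> \<exists>X. X \<in> CMin \<theta> (V - K)"
    then show "\<not> isolated_from_minimals \<theta> K" by (rule not_isolated_if_minimals_near)
  qed
  have DE: "\<not> (?D \<and> condition10 \<theta> K)"
  proof
    assume c: "?D \<and> condition10 \<theta> K"
    then obtain j where j: "condition7 \<theta> j K \<or> condition8 \<theta> j K \<or> condition9 \<theta> j K" by blast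
    obtain U where U: "nbhd U K" "c_dense_in_itself (CMin \<theta> (U - K))"
      by (rule condition10_near[OF F K conjunct2[OF c]]) (rule that)
    obtain X where "X \<in> CMin \<theta> (U - K)" "isolated_from_minimals \<theta> X"
      using isolated_minimal_near[OF F K j U(1)] .
    then show False using c_dense_no_isolated[OF F U(2)] by blast
  qed
  have iso: "isolated_from_minimals \<theta> K"
    if "condition \<theta> 1 K \<or> condition \<theta> 2 K \<or> ?C"
    using that condition_isolated[OF F] by (elim disjE bexE)
  have some: "condition \<theta> 1 K \<or> condition \<theta> 2 K \<or> ?C \<or> ?D \<or> condition10 \<theta> K"
  proof (cases "isolated_from_minimals \<theta> K")
    case True
    obtain i where i: "i \<in> {1..6}" "condition \<theta> i K"
      using isolated_conditions[OF M F K assms(6) True] by blast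
    then have "i = 1 \<or> i = 2 \<or> i \<in> {3..6}" by auto
    then show ?thesis using i(2) by blast
  next
    case False
    show ?thesis
    proof (cases "\<forall>d>0. \<exists>X\<in>CMin \<theta> (tube K d - K). isolated_from_minimals \<theta> X")
      case True
      then show ?thesis using isolated_minimals_accumulate[OF M F K] by blast
    next
      case no: False
      then obtain e where "e > 0" "\<forall>X\<in>CMin \<theta> (tube K e - K). \<not> isolated_from_minimals \<theta> X" by blast
      then show ?thesis using condition10_if_no_isolated_minimals[OF M F K False] by blast
    qed
  qed
  show ?thesis
    by (rule exactly_one_of_five[OF some AB]; rule notI; elim conjE)
      (use ABC D E DE iso in satx)+
qed

end
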